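(* Let $\Bbbk$ be a field of characteristic zero, $n\ge2$, and let $M$ be an $(n-1)$-connected closed manifold of dimension $2n$ with $m:=\dim_\Bbbk H^n(M;\Bbbk)\ge 3$. Then the sequence $\dim H_{2,2k+1}$, $k=1,2,\dots$, grows at least exponentially in $k$.
   Context: Fix a generator $M^\vee$ of $H^{2n}(M;\Bbbk)$ and a basis $x_1,\dots,x_m$ of $H^n(M;\Bbbk)$, and let $c_{ij}$ be defined by $x_ix_j=c_{ij}M^\vee$. Let $A=H^*(M;\Bbbk)=A(0)\oplus A(1)\oplus A(2)$ with $A(0)=\Bbbk$, $A(1)=H^n(M;\Bbbk)$, $A(2)=H^{2n}(M;\Bbbk)$, graded homologically (so $H^i$ sits in degree $-i$). Let $U=\Bbbk\langle u_1,\dots,u_m\rangle/(\omega)$ with $|u_i|=n-1$ and $\omega=\sum_{i,j}(-1)^nc_{ji}u_iu_j$ (so $U\cong H_*(\Omega M;\Bbbk)$), and let $U(r)$ be the part of word length $r$. Let $\kappa=\sum_ix_i\otimes u_i\in A\otimes U$ (tensor product of graded algebras), and consider the complexes, with differential the graded commutator $[\kappa,-]$, $$A(0)\otimes U(r)\to A(1)\otimes U(r+1)\to A(2)\otimes U(r+2).$$ $H_{i,r}$ denotes the homology at $A(i)\otimes U(r)$. The sum of all $H_{i,r}$ is isomorphic to $H_{*+2n}(LM;\Bbbk)$, $LM$ the free loop space. *)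

theory Defs
  imports
    "HOL-Analysis.Analysis"
    "HOL-Homology.Homology"
    "HOL-Algebra.QuotRing"
    "Jordan_Normal_Form.VS_Connect"
begin

section \<open>Highly connected closed manifolds\<close>

text \<open>Topological manifolds. Charts have values in open subsets of Euclidean space, so
  there is no boundary.\<close>

definition closed_manifold :: "nat \<Rightarrow> 'a topology \<Rightarrow> bool" where
  "closed_manifold d X \<longleftrightarrow>
     Hausdorff_space X \<and> second_countable X \<and> compact_space X \<and>
     (\<forall>x \<in> topspace X. \<exists>U V. openin X U \<and> x \<in> U \<and> openin (Euclidean_space d) V \<and>
        subtopology X U homeomorphic_space subtopology (Euclidean_space d) V)"

definition sphere_base :: "nat \<Rightarrow> real" where
  "sphere_base = (\<lambda>j. if j = 0 then 1 else 0)"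

text \<open>Every based map from the i-sphere is homotopic to the constant map relative to the
  base point; for i = 0 this is path-connectedness.\<close>

definition trivial_homotopy_group :: "nat \<Rightarrow> 'a topology \<Rightarrow> 'a \<Rightarrow> bool" where
  "trivial_homotopy_group i X x \<longleftrightarrow>
     (\<forall>f. continuous_map (nsphere i) X f \<and> f sphere_base = x \<longrightarrow>
        homotopic_with (\<lambda>g. g sphere_base = x) (nsphere i) X f (\<lambda>_. x))"

definition k_connected :: "nat \<Rightarrow> 'a topology \<Rightarrow> bool" where
  "k_connected k X \<longleftrightarrow>
     topspace X \<noteq> {} \<and> (\<forall>i \<le> k. \<forall>x \<in> topspace X. trivial_homotopy_group i X x)"


section \<open>Linear algebra over a field type\<close>

text \<open>Vector spaces and algebras are \<open>module\<close> records over \<open>class_ring\<close>. For mere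
  vector spaces the fields \<open>mult\<close> and \<open>one\<close> carry no meaning.\<close>

abbreviation vdim :: "('k::field, 'v, 'r) module_scheme \<Rightarrow> nat" where
  "vdim V \<equiv> vectorspace.dim class_ring V"

abbreviation is_basis :: "('k::field, 'v, 'r) module_scheme \<Rightarrow> 'v set \<Rightarrow> bool" where
  "is_basis V B \<equiv> vectorspace.basis class_ring V B"

definition quot_module ::
  "('k, 'v, 'r) module_scheme \<Rightarrow> 'v set \<Rightarrow> ('k, 'v set) module" where
  "quot_module V W =
     ring.extend (V Quot W) (module.fields (\<lambda>a P. \<Union>v\<in>P. W +>\<^bsub>V\<^esub> (a \<odot>\<^bsub>V\<^esub> v)))"

definition single :: "'s \<Rightarrow> 's \<Rightarrow> 'k::field" where
  "single s = (\<lambda>t. if t = s then 1 else 0)"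

definition free_space :: "'s set \<Rightarrow> ('k::field, 's \<Rightarrow> 'k) module" where
  "free_space S =
     \<lparr> carrier = {f. finite {s. f s \<noteq> 0} \<and> {s. f s \<noteq> 0} \<subseteq> S},
       mult = undefined, one = undefined,
       zero = (\<lambda>_. 0), add = (\<lambda>f g s. f s + g s), smult = (\<lambda>a f s. a * f s) \<rparr>"

definition tensor_relations ::
  "('k::field, 'v, 'r) module_scheme \<Rightarrow> ('k, 'w, 's) module_scheme \<Rightarrow> ('v \<times> 'w \<Rightarrow> 'k) set" where
  "tensor_relations V W =
     module.span class_ring (free_space (carrier V \<times> carrier W))
      ({(\<lambda>z. single (v \<oplus>\<^bsub>V\<^esub> v', w) z - single (v, w) z - single (v', w) z) | v v' w.
          v \<in> carrier V \<and> v' \<in> carrier V \<and> w \<in> carrier W} \<union>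
       {(\<lambda>z. single (v, w \<oplus>\<^bsub>W\<^esub> w') z - single (v, w) z - single (v, w') z) | v w w'.
          v \<in> carrier V \<and> w \<in> carrier W \<and> w' \<in> carrier W} \<union>
       {(\<lambda>z. single (a \<odot>\<^bsub>V\<^esub> v, w) z - a * single (v, w) z) | a v w.
          v \<in> carrier V \<and> w \<in> carrier W} \<union>
       {(\<lambda>z. single (v, a \<odot>\<^bsub>W\<^esub> w) z - a * single (v, w) z) | a v w.
          v \<in> carrier V \<and> w \<in> carrier W})"

definition tensor ::
  "('k::field, 'v, 'r) module_scheme \<Rightarrow> ('k, 'w, 's) module_scheme \<Rightarrow>
     ('k, ('v \<times> 'w \<Rightarrow> 'k) set) module" where
  "tensor V W = quot_module (free_space (carrier V \<times> carrier W)) (tensor_relations V W)"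

definition pure_tensor ::
  "('k::field, 'v, 'r) module_scheme \<Rightarrow> ('k, 'w, 's) module_scheme \<Rightarrow>
     'v \<Rightarrow> 'w \<Rightarrow> ('v \<times> 'w \<Rightarrow> 'k) set" where
  "pure_tensor V W v w =
     tensor_relations V W +>\<^bsub>free_space (carrier V \<times> carrier W)\<^esub> single (v, w)"

definition koszul_sign :: "int \<Rightarrow> int \<Rightarrow> 'k::field" where
  "koszul_sign d e = (if even (d * e) then 1 else -1)"


section \<open>Singular cohomology with coefficients in a field\<close>

type_synonym 'a ssimplex = "(nat \<Rightarrow> real) \<Rightarrow> 'a"
type_synonym ('a, 'k) cochain = "'a ssimplex \<Rightarrow> 'k"

definition cochain_space :: "'a topology \<Rightarrow> nat \<Rightarrow> ('k::field, ('a, 'k) cochain) module" where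
  "cochain_space X p =
     \<lparr> carrier = {\<phi>. \<forall>\<sigma>. \<not> singular_simplex p X \<sigma> \<longrightarrow> \<phi> \<sigma> = 0},
       mult = undefined, one = undefined,
       zero = (\<lambda>_. 0), add = (\<lambda>\<phi> \<psi> \<sigma>. \<phi> \<sigma> + \<psi> \<sigma>), smult = (\<lambda>a \<phi> \<sigma>. a * \<phi> \<sigma>) \<rparr>"

definition coboundary ::
  "'a topology \<Rightarrow> nat \<Rightarrow> ('a, 'k::field) cochain \<Rightarrow> ('a, 'k) cochain" where
  "coboundary X p \<phi> = (\<lambda>\<sigma>.
     if singular_simplex (Suc p) X \<sigma>
     then \<Sum>i\<le>Suc p. (-1) ^ i * \<phi> (singular_face (Suc p) i \<sigma>) else 0)"

definition cocycles :: "'a topology \<Rightarrow> nat \<Rightarrow> ('a, 'k::field) cochain set" where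
  "cocycles X p = {\<phi> \<in> carrier (cochain_space X p). coboundary X p \<phi> = (\<lambda>_. 0)}"

definition coboundaries :: "'a topology \<Rightarrow> nat \<Rightarrow> ('a, 'k::field) cochain set" where
  "coboundaries X p =
     (if p = 0 then {\<lambda>_. 0} else coboundary X (p - 1) ` carrier (cochain_space X (p - 1)))"

definition cohomology ::
  "'a topology \<Rightarrow> nat \<Rightarrow> ('k::field, ('a, 'k) cochain set) module" where
  "cohomology X p =
     quot_module ((cochain_space X p)\<lparr>carrier := cocycles X p\<rparr>) (coboundaries X p)"

text \<open>The standard p-simplex consists of the points of the standard (p+q)-simplex whose
  last q coordinates vanish, so the front face is a mere restriction.\<close>

definition front_face :: "nat \<Rightarrow> 'a ssimplex \<Rightarrow> 'a ssimplex" where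
  "front_face p \<sigma> = restrict \<sigma> (standard_simplex p)"

definition back_face :: "nat \<Rightarrow> nat \<Rightarrow> 'a ssimplex \<Rightarrow> 'a ssimplex" where
  "back_face p q \<sigma> =
     restrict (\<sigma> \<circ> (\<lambda>t i. if i < p then 0 else t (i - p))) (standard_simplex q)"

definition cup_cochain ::
  "'a topology \<Rightarrow> nat \<Rightarrow> nat \<Rightarrow> ('a, 'k::field) cochain \<Rightarrow> ('a, 'k) cochain \<Rightarrow> ('a, 'k) cochain"
  where
  "cup_cochain X p q \<phi> \<psi> = (\<lambda>\<sigma>.
     if singular_simplex (p + q) X \<sigma>
     then \<phi> (front_face p \<sigma>) * \<psi> (back_face p q \<sigma>) else 0)"

definition cup ::
  "'a topology \<Rightarrow> nat \<Rightarrow> nat \<Rightarrow> ('a, 'k::field) cochain set \<Rightarrow> ('a, 'k) cochain set \<Rightarrow>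
     ('a, 'k) cochain set" where
  "cup X p q P Q =
     (\<Union>\<phi>\<in>P. \<Union>\<psi>\<in>Q. coboundaries X (p + q) +>\<^bsub>cochain_space X (p + q)\<^esub> cup_cochain X p q \<phi> \<psi>)"


section \<open>The algebra \<open>U\<close>\<close>

text \<open>A noncommutative polynomial in the variables \<open>0, \<dots>, m - 1\<close> is the family of its
  coefficients, indexed by words.\<close>

definition free_algebra :: "nat \<Rightarrow> ('k::field, nat list \<Rightarrow> 'k) module" where
  "free_algebra m = (free_space (lists {..<m}))
     \<lparr> mult := (\<lambda>f g w. \<Sum>i\<le>length w. f (take i w) * g (drop i w)),
       one := single [] \<rparr>"

definition omega :: "nat \<Rightarrow> nat \<Rightarrow> (nat \<Rightarrow> nat \<Rightarrow> 'k) \<Rightarrow> nat list \<Rightarrow> 'k::field" where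
  "omega n m c = (\<lambda>w. \<Sum>i<m. \<Sum>j<m. (-1) ^ n * c j i * single [i, j] w)"

definition U_ideal :: "nat \<Rightarrow> nat \<Rightarrow> (nat \<Rightarrow> nat \<Rightarrow> 'k::field) \<Rightarrow> (nat list \<Rightarrow> 'k) set" where
  "U_ideal n m c = Idl\<^bsub>free_algebra m\<^esub> {omega n m c}"

definition U_alg ::
  "nat \<Rightarrow> nat \<Rightarrow> (nat \<Rightarrow> nat \<Rightarrow> 'k::field) \<Rightarrow> ('k, (nat list \<Rightarrow> 'k) set) module" where
  "U_alg n m c = quot_module (free_algebra m) (U_ideal n m c)"

definition U_gen ::
  "nat \<Rightarrow> nat \<Rightarrow> (nat \<Rightarrow> nat \<Rightarrow> 'k::field) \<Rightarrow> nat \<Rightarrow> (nat list \<Rightarrow> 'k) set" where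
  "U_gen n m c i = U_ideal n m c +>\<^bsub>free_algebra m\<^esub> single [i]"

definition U_part ::
  "nat \<Rightarrow> nat \<Rightarrow> (nat \<Rightarrow> nat \<Rightarrow> 'k::field) \<Rightarrow> nat \<Rightarrow> ('k, (nat list \<Rightarrow> 'k) set) module" where
  "U_part n m c r = (U_alg n m c)
     \<lparr> carrier := {U_ideal n m c +>\<^bsub>free_algebra m\<^esub> f | f.
         f \<in> carrier (free_algebra m) \<and> (\<forall>w. f w \<noteq> 0 \<longrightarrow> length w = r)} \<rparr>"


section \<open>The complexes\<close>

text \<open>Homological degrees: \<open>H\<^sup>p\<close> sits in degree \<open>- p\<close>, and \<open>U(s)\<close> in degree \<open>s (n - 1)\<close>.\<close>

definition A_deg :: "nat \<Rightarrow> int" where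
  "A_deg p = - int p"

definition U_deg :: "nat \<Rightarrow> nat \<Rightarrow> int" where
  "U_deg n s = int s * (int n - 1)"

type_synonym ('a, 'k) AU = "(('a, 'k) cochain set \<times> (nat list \<Rightarrow> 'k) set \<Rightarrow> 'k) set"

definition AU ::
  "'a topology \<Rightarrow> nat \<Rightarrow> nat \<Rightarrow> (nat \<Rightarrow> nat \<Rightarrow> 'k::field) \<Rightarrow> nat \<Rightarrow> nat \<Rightarrow> ('k, ('a, 'k) AU) module"
  where
  "AU X n m c p s = tensor (cohomology X p) (U_part n m c s)"

text \<open>The component \<open>(H\<^sup>p \<otimes> U(s)) \<times> (H\<^sup>q \<otimes> U(t)) \<rightarrow> H\<^bsup>p+q\<^esup> \<otimes> U(s+t)\<close> of the product of
  the graded tensor product algebra, determined by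
  \<open>(a \<otimes> u)(b \<otimes> v) = (-1)\<^bsup>|u||b|\<^esup> ab \<otimes> uv\<close>.\<close>

definition AU_mult ::
  "'a topology \<Rightarrow> nat \<Rightarrow> nat \<Rightarrow> (nat \<Rightarrow> nat \<Rightarrow> 'k::field) \<Rightarrow> nat \<Rightarrow> nat \<Rightarrow> nat \<Rightarrow> nat \<Rightarrow>
     ('a, 'k) AU \<Rightarrow> ('a, 'k) AU \<Rightarrow> ('a, 'k) AU" where
  "AU_mult X n m c p s q t P Q =
     (let V = cohomology X (p + q); W = U_part n m c (s + t)
      in \<Union>f\<in>P. \<Union>g\<in>Q. tensor_relations V W +>\<^bsub>free_space (carrier V \<times> carrier W)\<^esub>
        (\<lambda>z. \<Sum>(a, u) \<in> {y. f y \<noteq> 0}. \<Sum>(b, v) \<in> {y. g y \<noteq> 0}.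
           koszul_sign (U_deg n s) (A_deg q) * f (a, u) * g (b, v) *
           single (cup X p q a b, u \<otimes>\<^bsub>U_alg n m c\<^esub> v) z))"

definition kappa ::
  "'a topology \<Rightarrow> nat \<Rightarrow> nat \<Rightarrow> (nat \<Rightarrow> nat \<Rightarrow> 'k::field) \<Rightarrow> (nat \<Rightarrow> ('a, 'k) cochain set) \<Rightarrow>
     ('a, 'k) AU" where
  "kappa X n m c x =
     finsum (AU X n m c n 1)
       (\<lambda>i. pure_tensor (cohomology X n) (U_part n m c 1) (x i) (U_gen n m c i)) {..<m}"

text \<open>The graded commutator \<open>[\<kappa>, -]\<close> on \<open>H\<^sup>p \<otimes> U(s)\<close>.\<close>

definition AU_diff ::
  "'a topology \<Rightarrow> nat \<Rightarrow> nat \<Rightarrow> (nat \<Rightarrow> nat \<Rightarrow> 'k::field) \<Rightarrow> (nat \<Rightarrow> ('a, 'k) cochain set) \<Rightarrow>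
     nat \<Rightarrow> nat \<Rightarrow> ('a, 'k) AU \<Rightarrow> ('a, 'k) AU" where
  "AU_diff X n m c x p s y =
     (let T = AU X n m c (p + n) (s + 1); \<kappa> = kappa X n m c x
      in AU_mult X n m c n 1 p s \<kappa> y \<ominus>\<^bsub>T\<^esub>
         koszul_sign (A_deg n + U_deg n 1) (A_deg p + U_deg n s) \<odot>\<^bsub>T\<^esub>
           AU_mult X n m c p s n 1 y \<kappa>)"

text \<open>Meaningful for \<open>i \<le> 2\<close>, where \<open>A(i) = H\<^bsup>in\<^esup>\<close>. The complexes begin at \<open>A(0)\<close> and
  at word length \<open>0\<close>, and end at \<open>A(2)\<close>.\<close>

definition AU_cycles ::
  "'a topology \<Rightarrow> nat \<Rightarrow> nat \<Rightarrow> (nat \<Rightarrow> nat \<Rightarrow> 'k::field) \<Rightarrow> (nat \<Rightarrow> ('a, 'k) cochain set) \<Rightarrow>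
     nat \<Rightarrow> nat \<Rightarrow> ('a, 'k) AU set" where
  "AU_cycles X n m c x i r =
     (if i < 2
      then {y \<in> carrier (AU X n m c (i * n) r).
              AU_diff X n m c x (i * n) r y = \<zero>\<^bsub>AU X n m c ((i + 1) * n) (r + 1)\<^esub>}
      else carrier (AU X n m c (i * n) r))"

definition AU_boundaries ::
  "'a topology \<Rightarrow> nat \<Rightarrow> nat \<Rightarrow> (nat \<Rightarrow> nat \<Rightarrow> 'k::field) \<Rightarrow> (nat \<Rightarrow> ('a, 'k) cochain set) \<Rightarrow>
     nat \<Rightarrow> nat \<Rightarrow> ('a, 'k) AU set" where
  "AU_boundaries X n m c x i r =
     (if i = 0 \<or> r = 0 then {\<zero>\<^bsub>AU X n m c (i * n) r\<^esub>}
      else AU_diff X n m c x ((i - 1) * n) (r - 1) ` carrier (AU X n m c ((i - 1) * n) (r - 1)))"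

definition AU_homology ::
  "'a topology \<Rightarrow> nat \<Rightarrow> nat \<Rightarrow> (nat \<Rightarrow> nat \<Rightarrow> 'k::field) \<Rightarrow> (nat \<Rightarrow> ('a, 'k) cochain set) \<Rightarrow>
     nat \<Rightarrow> nat \<Rightarrow> ('k, ('a, 'k) AU set) module" where
  "AU_homology X n m c x i r =
     quot_module ((AU X n m c (i * n) r)\<lparr>carrier := AU_cycles X n m c x i r\<rparr>)
       (AU_boundaries X n m c x i r)"

end

theory Submission
  imports Defs
begin

text \<open>For even word length \<open>s\<close>, graded commutativity of the cup product (which comes from Steenrod's
  cup-1 homotopy) turns every boundary in \<open>A(2) \<otimes> U(s + 1)\<close> into a combination of elements
  \<open>M\<^sup>\<or> \<otimes> (u\<^sub>i u - u u\<^sub>i)\<close>. Hence the trace of every matrix representation of \<open>U\<close> defines a functional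
  on \<open>H\<^bsub>2,s+1\<^esub>\<close>.

  Representations are found as follows. The form \<open>\<omega>\<close> is symmetric or alternating, so on three
  dimensions it either has an isotropic plane or splits off an anisotropic line \<open>z\<close>; in the second
  case the generators act through two free matrices \<open>P, Q\<close> and a block matrix whose square
  cancels the quadratic expression in \<open>P, Q\<close> that \<open>\<omega>\<close> prescribes. For a binary word \<open>g\<close>, let \<open>P\<close> and \<open>Q\<close>
  be the two parts of the cyclic shift on \<open>length g\<close> points, labelled by the letters of \<open>g\<close>: then the trace of
  a word in \<open>P, Q\<close> of the same length is twice the number of rotations that carry \<open>g\<close> to that word.
  So the functionals that belong to distinct necklaces of length \<open>r = 2k + 1\<close> are linearly independent, and
  there are at least \<open>2\<^sup>r / r \<ge> 2\<^sup>k\<close> necklaces.\<close>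

section \<open>Subsimplices on chosen vertices\<close>

text \<open>Only a lower bound is asked, so a basis or a normal form of \<open>U\<close> can be
  avoided: enough functionals that kill the boundaries will do, and traces do so because they are
  cyclic. The restriction to even \<open>s\<close> comes from the signs. The element \<kappa> has
  degree -1, and its commutator with an element of H^n \<otimes> U(s) carries the sign (-1)^(n +
  s(n-1)). For even s this is the sign (-1)^n by which the cup product in degree n commutes,
  whatever the parity of n. A nondegenerate ternary quadratic form has no isotropic plane over any
  field, so two free matrices alone cannot satisfy the relation in general. Hence the third matrix,
  an explicit square root on a doubled index set, which exists over every field. Characteristic zero
  enters twice: 2 is inverted in the study of the form, and the traces, as positive integers, must
  stay nonzero in the field. Finite dimension of the homology has to be shown as well, since
  \<open>vdim\<close> is the least size of a finite generating set.\<close>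

definition simplex_push :: "nat \<Rightarrow> (nat \<Rightarrow> nat) \<Rightarrow> (nat \<Rightarrow> real) \<Rightarrow> nat \<Rightarrow> real" where
  "simplex_push q e t = (\<lambda>j. \<Sum>i | i \<le> q \<and> e i = j. t i)"

text \<open>The singular simplex spanned by the vertices e 0, ..., e q of \<sigma>;
  \<open>simplex_push\<close> is the affine map that pushes barycentric coordinates forward along e.
  Singular faces, front faces and back faces are all of this form, so face identities become
  equalities of vertex maps. The \<open>restrict\<close> is there because singular simplices are
  extensional on the standard simplex.\<close>

definition subsimplex :: "nat \<Rightarrow> (nat \<Rightarrow> nat) \<Rightarrow> 'a ssimplex \<Rightarrow> 'a ssimplex" where
  "subsimplex q e \<sigma> = restrict (\<sigma> \<circ> simplex_push q e) (standard_simplex q)"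

definition skip :: "nat \<Rightarrow> nat \<Rightarrow> nat" where
  "skip k i = (if i < k then i else Suc i)"

text \<open>The cosimplicial identity, from which the square of the coboundary vanishes.\<close>

lemma skip_skip: "l < k \<Longrightarrow> skip k \<circ> skip l = skip l \<circ> skip (k - 1)"
  by (auto simp: skip_def fun_eq_iff)

lemma simplex_push_in:
  assumes "t \<in> standard_simplex q" "e \<in> {..q} \<rightarrow> {..p}"
  shows "simplex_push q e t \<in> standard_simplex p"
proof -
  have t: "\<And>i. 0 \<le> t i" "sum t {..q} = 1"
    using assms(1) by (auto simp: standard_simplex_def)
  have "(\<Sum>i | i \<le> q \<and> e i = j. t i) \<le> 1" for j
    using sum_mono2[of "{..q}" "{i. i \<le> q \<and> e i = j}" t] t by auto
  moreover have "(\<Sum>j\<le>p. \<Sum>i | i \<le> q \<and> e i = j. t i) = 1"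
    using sum.group[of "{..q}" "{..p}" e t] assms(2) t by (auto simp: Pi_iff image_subset_iff)
  moreover have "(\<Sum>i | i \<le> q \<and> e i = j. t i) = 0" if "p < j" for j
  proof -
    have "{i. i \<le> q \<and> e i = j} = {}" using assms(2) that by force
    then show ?thesis by (simp only: sum.empty)
  qed
  ultimately show ?thesis
    unfolding standard_simplex_def simplex_push_def by (auto intro!: sum_nonneg t)
qed

lemma simplex_push_comp:
  assumes "e' \<in> {..r} \<rightarrow> {..q}"
  shows "simplex_push q e (simplex_push r e' t) = simplex_push r (e \<circ> e') t"
proof
  fix j
  let ?S = "{l. l \<le> r \<and> e (e' l) = j}" and ?T = "{i. i \<le> q \<and> e i = j}"
  have "(\<Sum>l\<in>?S. t l) = (\<Sum>i\<in>?T. sum t {l\<in>?S. e' l = i})"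
    by (rule sum.group[symmetric]) (use assms in \<open>auto simp: Pi_iff\<close>)
  also have "\<dots> = (\<Sum>i\<in>?T. \<Sum>l | l \<le> r \<and> e' l = i. t l)"
    by (intro sum.cong refl) auto
  finally show "simplex_push q e (simplex_push r e' t) j = simplex_push r (e \<circ> e') t j"
    by (simp add: simplex_push_def)
qed

lemma singular_simplex_subsimplex:
  assumes "singular_simplex p X \<sigma>" "e \<in> {..q} \<rightarrow> {..p}"
  shows "singular_simplex q X (subsimplex q e \<sigma>)"
proof -
  let ?PT = "powertop_real UNIV"
  have "continuous_map (subtopology ?PT (standard_simplex q)) ?PT (simplex_push q e)"
    unfolding simplex_push_def continuous_map_componentwise_UNIV
    by (intro allI continuous_map_sum continuous_map_from_subtopology
        continuous_map_product_projection) auto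
  then have "continuous_map (subtopology ?PT (standard_simplex q))
      (subtopology ?PT (standard_simplex p)) (simplex_push q e)"
    using assms(2) by (auto simp: continuous_map_in_subtopology simplex_push_in)
  then have "continuous_map (subtopology ?PT (standard_simplex q)) X (\<sigma> \<circ> simplex_push q e)"
    using assms(1) continuous_map_compose unfolding singular_simplex_def by blast
  then have "continuous_map (subtopology ?PT (standard_simplex q)) X (subsimplex q e \<sigma>)"
    by (rule continuous_map_eq) (simp add: subsimplex_def)
  then show ?thesis
    by (simp add: singular_simplex_def subsimplex_def)
qed

lemma subsimplex_subsimplex:
  assumes "e' \<in> {..r} \<rightarrow> {..q}"
  shows "subsimplex r e' (subsimplex q e \<sigma>) = subsimplex r (e \<circ> e') \<sigma>"
proof
  fix t
  show "subsimplex r e' (subsimplex q e \<sigma>) t = subsimplex r (e \<circ> e') \<sigma> t"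
    using assms simplex_push_in[of t r e' q]
    by (cases "t \<in> standard_simplex r") (simp_all add: subsimplex_def simplex_push_comp del: o_apply add: o_apply[of \<sigma>] o_apply[of "restrict _ _"])
qed

lemma subsimplex_cong: "(\<And>i. i \<le> q \<Longrightarrow> e i = e' i) \<Longrightarrow> subsimplex q e \<sigma> = subsimplex q e' \<sigma>"
proof -
  assume "\<And>i. i \<le> q \<Longrightarrow> e i = e' i"
  then have "{i. i \<le> q \<and> e i = j} = {i. i \<le> q \<and> e' i = j}" for j by auto
  then have "simplex_push q e = simplex_push q e'"
    by (simp add: simplex_push_def fun_eq_iff)
  then show ?thesis by (simp only: subsimplex_def)
qed

lemma standard_simplex_outside: "t \<in> standard_simplex p \<Longrightarrow> p < i \<Longrightarrow> t i = 0"
  by (simp add: standard_simplex_def)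

text \<open>For i > q both sides vanish, the left one by an empty index set and the right one by the
  support of points of the simplex; so i may be arbitrary.\<close>

lemma simplex_push_inj:
  assumes "inj e" "e i = j" "t \<in> standard_simplex q"
  shows "simplex_push q e t j = t i"
proof (cases "i \<le> q")
  case True
  then have "{l. l \<le> q \<and> e l = j} = {i}"
    using assms by (auto dest: injD)
  then show ?thesis by (simp add: simplex_push_def)
next
  case False
  then have "{l. l \<le> q \<and> e l = j} = {}"
    using assms by (auto dest: injD)
  then show ?thesis using assms(3) False by (simp add: simplex_push_def standard_simplex_outside del: Collect_empty_eq)
qed

lemma simplex_push_notin: "j \<notin> range e \<Longrightarrow> simplex_push q e t j = 0"
  by (auto simp: simplex_push_def intro!: sum.neutral)

lemma inj_skip: "inj (skip k)"
  by (auto simp: skip_def inj_on_def split: if_splits)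

text \<open>The library's face map inserts a zero coordinate at position k. In the pushforward,
  coordinates below k are kept, k is missed by \<open>skip k\<close>, and those above k are shifted
  by one.\<close>

lemma singular_face_eq_subsimplex: "singular_face (Suc p) k \<sigma> = subsimplex p (skip k) \<sigma>"
proof -
  have "simplical_face k t j = simplex_push p (skip k) t j" if "t \<in> standard_simplex p" for t j
  proof -
    consider "j < k" | "j = k" | "k < j" by linarith
    then show ?thesis
    proof cases
      case 1
      then have "simplex_push p (skip k) t j = t j"
        by (intro simplex_push_inj inj_skip that) (simp add: skip_def)
      then show ?thesis using 1 by (simp add: simplical_face_def)
    next
      case 2
      then have "j \<notin> range (skip k)" by (auto simp: skip_def split: if_splits)
      then show ?thesis using 2 by (simp add: simplical_face_def simplex_push_notin)
    next
      case 3
      then have "simplex_push p (skip k) t j = t (j - 1)"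
        by (intro simplex_push_inj inj_skip that) (auto simp: skip_def)
      then show ?thesis using 3 by (simp add: simplical_face_def)
    qed
  qed
  then have "simplical_face k t = simplex_push p (skip k) t" if "t \<in> standard_simplex p" for t
    using that by blast
  then show ?thesis
    by (auto simp: singular_face_def subsimplex_def)
qed

lemma front_face_eq_subsimplex: "front_face p \<sigma> = subsimplex p id \<sigma>"
proof -
  have "simplex_push p id t = t" if "t \<in> standard_simplex p" for t
    using that by (intro ext simplex_push_inj) auto
  then show ?thesis
    by (auto simp: front_face_def subsimplex_def)
qed

lemma back_face_eq_subsimplex: "back_face p q \<sigma> = subsimplex q (\<lambda>i. p + i) \<sigma>"
proof -
  have "simplex_push q (\<lambda>i. p + i) t = (\<lambda>i. if i < p then 0 else t (i - p))"
    if "t \<in> standard_simplex q" for t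
  proof
    fix j
    show "simplex_push q (\<lambda>i. p + i) t j = (if j < p then 0 else t (j - p))"
    proof (cases "j < p")
      case True
      then show ?thesis by (auto intro: simplex_push_notin)
    next
      case False
      then show ?thesis using that by (auto intro!: simplex_push_inj simp: inj_on_def)
    qed
  qed
  then show ?thesis
    by (auto simp: back_face_def subsimplex_def)
qed

section \<open>The coboundary in terms of vertex maps, and its square\<close>

lemma coboundary_subsimplex:
  assumes "singular_simplex p X \<sigma>" "e \<in> {..Suc q} \<rightarrow> {..p}"
  shows "coboundary X q \<phi> (subsimplex (Suc q) e \<sigma>) =
    (\<Sum>k\<le>Suc q. (-1) ^ k * \<phi> (subsimplex q (e \<circ> skip k) \<sigma>))"
proof -
  have "skip k \<in> {..q} \<rightarrow> {..Suc q}" for k by (auto simp: skip_def)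
  then show ?thesis
    using singular_simplex_subsimplex[OF assms]
    by (simp only: coboundary_def singular_face_eq_subsimplex subsimplex_subsimplex if_True)
qed

lemma coboundary_eq:
  assumes "singular_simplex (Suc q) X \<sigma>"
  shows "coboundary X q \<phi> \<sigma> = (\<Sum>k\<le>Suc q. (-1) ^ k * \<phi> (subsimplex q (skip k) \<sigma>))"
  using assms by (simp add: coboundary_def singular_face_eq_subsimplex)

text \<open>Faces of faces cancel in pairs: for l < k the index pairs (k, l) and (l, k - 1) have the
  same value and opposite signs.\<close>

lemma sum_alternating_simplicial:
  fixes g :: "nat \<Rightarrow> nat \<Rightarrow> 'k::comm_ring_1"
  assumes "\<And>k l. l < k \<Longrightarrow> k \<le> Suc p \<Longrightarrow> g k l = g l (k - 1)"
  shows "(\<Sum>k\<le>Suc p. \<Sum>l\<le>p. (-1) ^ k * (-1) ^ l * g k l) = 0"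
proof -
  let ?h = "\<lambda>(k, l). (-1) ^ k * (-1) ^ l * g k l"
  let ?A = "{(k, l). k \<le> Suc p \<and> l < k}" and ?B = "{(k, l). l \<le> p \<and> k \<le> l}"
  have fin: "finite ?A" "finite ?B"
    by (rule finite_subset[of _ "{..Suc p} \<times> {..Suc p}"]; auto)+
  have "(\<Sum>k\<le>Suc p. \<Sum>l\<le>p. (-1) ^ k * (-1) ^ l * g k l) = sum ?h ({..Suc p} \<times> {..p})"
    by (simp add: sum.cartesian_product)
  also have "{..Suc p} \<times> {..p} = ?A \<union> ?B" by auto
  also have "sum ?h (?A \<union> ?B) = sum ?h ?A + sum ?h ?B"
    by (rule sum.union_disjoint[OF fin]) auto
  also have "sum ?h ?A = sum (\<lambda>x. - ?h x) ?B"
  proof (rule sum.reindex_bij_witness[of _ "\<lambda>(k, l). (Suc l, k)" "\<lambda>(k, l). (l, k - 1)"])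
    fix a assume "a \<in> ?A"
    then have "\<exists>k l. a = (Suc k, l) \<and> l < Suc k \<and> k \<le> p"
      by (intro exI[of _ "fst a - 1"] exI[of _ "snd a"]) (auto simp: prod_eq_iff)
    then obtain k l where a: "a = (Suc k, l)" "l < Suc k" "k \<le> p" by blast
    then show "- ?h (case a of (k, l) \<Rightarrow> (l, k - 1)) = ?h a"
      using assms[of l "Suc k"] by (simp add: algebra_simps)
  qed auto
  finally show ?thesis by (simp add: sum_negf)
qed

lemma coboundary_coboundary: "coboundary X (Suc p) (coboundary X p \<phi>) = (\<lambda>_. 0)"
proof
  fix \<sigma>
  show "coboundary X (Suc p) (coboundary X p \<phi>) \<sigma> = 0"
  proof (cases "singular_simplex (Suc (Suc p)) X \<sigma>")
    case True
    have "coboundary X (Suc p) (coboundary X p \<phi>) \<sigma> =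
      (\<Sum>k\<le>Suc (Suc p). (-1) ^ k * (\<Sum>l\<le>Suc p. (-1) ^ l * \<phi> (subsimplex p (skip k \<circ> skip l) \<sigma>)))"
      unfolding coboundary_eq[OF True]
      by (intro sum.cong refl arg_cong2[of _ _ _ _ "(*)"] coboundary_subsimplex[OF True])
        (auto simp: skip_def)
    also have "\<dots> = (\<Sum>k\<le>Suc (Suc p). \<Sum>l\<le>Suc p. (-1) ^ k * (-1) ^ l * \<phi> (subsimplex p (skip k \<circ> skip l) \<sigma>))"
      by (simp only: sum_distrib_left mult.assoc)
    also have "\<dots> = 0"
      by (rule sum_alternating_simplicial) (simp add: skip_skip)
    finally show ?thesis .
  qed (simp add: coboundary_def)
qed

section \<open>The cup product of cochains\<close>

lemma cochain_space_simps [simp]: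
  "carrier (cochain_space X p) = {\<phi>. \<forall>\<sigma>. \<not> singular_simplex p X \<sigma> \<longrightarrow> \<phi> \<sigma> = 0}"
  "zero (cochain_space X p) = (\<lambda>_. 0)"
  "add (cochain_space X p) = (\<lambda>\<phi> \<psi> \<sigma>. \<phi> \<sigma> + \<psi> \<sigma>)"
  "smult (cochain_space X p) = (\<lambda>a \<phi> \<sigma>. a * \<phi> \<sigma>)"
  by (simp_all add: cochain_space_def)

lemma cup_cochain_subsimplex:
  assumes "singular_simplex N X \<sigma>" "e \<in> {..p + q} \<rightarrow> {..N}"
  shows "cup_cochain X p q \<phi> \<psi> (subsimplex (p + q) e \<sigma>) =
    \<phi> (subsimplex p e \<sigma>) * \<psi> (subsimplex q (\<lambda>i. e (p + i)) \<sigma>)"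
proof -
  have "id \<in> {..p} \<rightarrow> {..p + q}" "(\<lambda>i. p + i) \<in> {..q} \<rightarrow> {..p + q}" by auto
  then show ?thesis
    using singular_simplex_subsimplex[OF assms]
    by (simp add: cup_cochain_def front_face_eq_subsimplex back_face_eq_subsimplex
        subsimplex_subsimplex o_def)
qed

lemma coboundary_add: "coboundary X p (\<lambda>\<sigma>. \<phi> \<sigma> + \<psi> \<sigma>) = (\<lambda>\<sigma>. coboundary X p \<phi> \<sigma> + coboundary X p \<psi> \<sigma>)"
  by (auto simp: coboundary_def fun_eq_iff sum.distrib distrib_left simp del: sum.atMost_Suc)

lemma coboundary_scale: "coboundary X p (\<lambda>\<sigma>. a * \<phi> \<sigma>) = (\<lambda>\<sigma>. a * coboundary X p \<phi> \<sigma>)"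
  by (simp only: coboundary_def sum_distrib_left mult.left_commute if_distrib[of "(*) a"] mult_zero_right)

lemma coboundary_zero: "coboundary X p (\<lambda>\<sigma>. 0) = (\<lambda>\<sigma>. 0)"
  by (auto simp: coboundary_def)

lemma coboundary_sum:
  "coboundary X p (\<lambda>\<sigma>. \<Sum>i\<in>I. \<phi> i \<sigma>) = (\<lambda>\<sigma>. \<Sum>i\<in>I. coboundary X p (\<phi> i) \<sigma>)"
  by (induction I rule: infinite_finite_induct) (simp_all add: coboundary_zero coboundary_add)

text \<open>The Leibniz rule. Omitting vertex k of the (p+q+1)-simplex affects the front factor for
  k \<le> p and the back factor for k > p. The right-hand side has two further terms, from the last
  face in the first product and face 0 in the second; both are \<phi>(0..p) \<psi>(p+1..p+q+1) and
  their signs are opposite.\<close>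

lemma coboundary_cup:
  "coboundary X (p + q) (cup_cochain X p q \<phi> \<psi>) =
    (\<lambda>\<sigma>. cup_cochain X (Suc p) q (coboundary X p \<phi>) \<psi> \<sigma> +
      (-1) ^ p * cup_cochain X p (Suc q) \<phi> (coboundary X q \<psi>) \<sigma>)"
proof
  fix \<sigma>
  show "coboundary X (p + q) (cup_cochain X p q \<phi> \<psi>) \<sigma> =
    cup_cochain X (Suc p) q (coboundary X p \<phi>) \<psi> \<sigma> +
      (-1) ^ p * cup_cochain X p (Suc q) \<phi> (coboundary X q \<psi>) \<sigma>"
  proof (cases "singular_simplex (Suc (p + q)) X \<sigma>")
    case True
    let ?A = "\<lambda>k. \<phi> (subsimplex p (skip k) \<sigma>)" and ?B = "\<psi> (subsimplex q (\<lambda>i. Suc (p + i)) \<sigma>)"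
      and ?C = "\<phi> (subsimplex p id \<sigma>)" and ?D = "\<lambda>j. \<psi> (subsimplex q ((\<lambda>i. p + i) \<circ> skip j) \<sigma>)"
    let ?t = "\<lambda>k. (-1) ^ k * (\<phi> (subsimplex p (skip k) \<sigma>) * \<psi> (subsimplex q (\<lambda>i. skip k (p + i)) \<sigma>))"
    have "coboundary X (p + q) (cup_cochain X p q \<phi> \<psi>) \<sigma> = (\<Sum>k\<le>Suc (p + q). ?t k)"
      unfolding coboundary_eq[OF True]
      by (intro sum.cong refl arg_cong2[of _ _ _ _ "(*)"] cup_cochain_subsimplex[OF True])
        (auto simp: skip_def)
    \<comment> \<open>Split at vertex p. The remaining faces are indexed by j = k - p, the position
      of the omitted vertex in the back part; hence j starts at 1.\<close>
    also have "{..Suc (p + q)} = {..p} \<union> (\<lambda>j. p + j) ` {1..Suc q}"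
    proof (intro equalityI subsetI)
      fix k assume "k \<in> {..Suc (p + q)}"
      then have "k \<le> p \<or> k = p + (k - p) \<and> k - p \<in> {1..Suc q}" by auto
      then show "k \<in> {..p} \<union> (\<lambda>j. p + j) ` {1..Suc q}" by blast
    qed auto
    also have "(\<Sum>k\<in>\<dots>. ?t k) = (\<Sum>k\<le>p. ?t k) + (\<Sum>k\<in>(\<lambda>j. p + j) ` {1..Suc q}. ?t k)"
      by (rule sum.union_disjoint) auto
    also have "(\<Sum>k\<le>p. ?t k) = (\<Sum>k\<le>p. (-1) ^ k * ?A k) * ?B"
    proof -
      have "subsimplex q (\<lambda>i. skip k (p + i)) \<sigma> = subsimplex q (\<lambda>i. Suc (p + i)) \<sigma>" if "k \<le> p" for k
        using that by (intro subsimplex_cong) (simp add: skip_def)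
      then show ?thesis by (simp add: sum_distrib_right mult.assoc)
    qed
    also have "(\<Sum>k\<in>(\<lambda>j. p + j) ` {1..Suc q}. ?t k) = (\<Sum>j = 1..Suc q. ?t (p + j))"
      by (subst sum.reindex) (auto simp: inj_on_def)
    also have "\<dots> = (\<Sum>j = 1..Suc q. (-1) ^ p * ?C * ((-1) ^ j * ?D j))"
    proof (intro sum.cong refl)
      fix j assume j: "j \<in> {1..Suc q}"
      then have "subsimplex p (skip (p + j)) \<sigma> = subsimplex p id \<sigma>"
        by (intro subsimplex_cong) (auto simp: skip_def)
      moreover have "subsimplex q (\<lambda>i. skip (p + j) (p + i)) \<sigma> = subsimplex q ((\<lambda>i. p + i) \<circ> skip j) \<sigma>"
        by (intro subsimplex_cong) (auto simp: skip_def)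
      ultimately show "?t (p + j) = (-1) ^ p * ?C * ((-1) ^ j * ?D j)"
        by (simp add: power_add)
    qed
    also have "\<dots> = (-1) ^ p * ?C * (\<Sum>j = 1..Suc q. (-1) ^ j * ?D j)"
      by (rule sum_distrib_left[symmetric])
    finally have lhs: "coboundary X (p + q) (cup_cochain X p q \<phi> \<psi>) \<sigma> =
      (\<Sum>k\<le>p. (-1) ^ k * ?A k) * ?B + (-1) ^ p * ?C * (\<Sum>j = 1..Suc q. (-1) ^ j * ?D j)" .
    have sing: "singular_simplex (Suc p + q) X \<sigma>" "singular_simplex (p + Suc q) X \<sigma>"
      using True by simp_all
    have "cup_cochain X (Suc p) q (coboundary X p \<phi>) \<psi> \<sigma> = (\<Sum>k\<le>Suc p. (-1) ^ k * ?A k) * ?B"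
    proof -
      have "coboundary X p \<phi> (subsimplex (Suc p) id \<sigma>) = (\<Sum>k\<le>Suc p. (-1) ^ k * ?A k)"
        by (subst coboundary_subsimplex[OF True]) auto
      then show ?thesis
        using sing by (simp add: cup_cochain_def front_face_eq_subsimplex back_face_eq_subsimplex del: sum.atMost_Suc)
    qed
    moreover have "?A (Suc p) = ?C"
      by (intro arg_cong[of _ _ \<phi>] subsimplex_cong) (simp add: skip_def)
    moreover have "cup_cochain X p (Suc q) \<phi> (coboundary X q \<psi>) \<sigma> =
      ?C * (\<Sum>j\<le>Suc q. (-1) ^ j * ?D j)"
    proof -
      have "coboundary X q \<psi> (subsimplex (Suc q) (\<lambda>i. p + i) \<sigma>) = (\<Sum>j\<le>Suc q. (-1) ^ j * ?D j)"
        by (subst coboundary_subsimplex[OF True]) auto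
      then show ?thesis
        using sing by (simp add: cup_cochain_def front_face_eq_subsimplex back_face_eq_subsimplex del: sum.atMost_Suc)
    qed
    moreover have "(\<Sum>j\<le>Suc q. (-1) ^ j * ?D j) = ?D 0 + (\<Sum>j = 1..Suc q. (-1) ^ j * ?D j)"
      by (simp add: sum.atLeast0_atMost_Suc atMost_atLeast0 sum.atLeast_Suc_atMost del: sum.atMost_Suc sum.atLeast0_atMost_Suc)
    moreover have "?D 0 = ?B"
      by (intro arg_cong[of _ _ \<psi>] subsimplex_cong) (simp add: skip_def)
    ultimately show ?thesis
      unfolding lhs by (simp only: sum.atMost_Suc) (simp add: ring_distribs mult_ac del: sum.cl_ivl_Suc sum.atMost_Suc)
  qed (simp add: coboundary_def cup_cochain_def)
qed

text \<open>The explicit homotopy of Steenrod's cup-1 product. Its \<open>i\<close>-th summand sends a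
  \<open>(2n-1)\<close>-simplex to \<open>\<phi>(0, \<dots>, i, i+n, \<dots>, 2n-1) \<psi>(i, \<dots>, i+n)\<close>.\<close>

definition cup1_summand ::
  "'a topology \<Rightarrow> nat \<Rightarrow> nat \<Rightarrow> ('a, 'k::field) cochain \<Rightarrow> ('a, 'k) cochain \<Rightarrow> ('a, 'k) cochain" where
  "cup1_summand X n i \<phi> \<psi> = (\<lambda>\<tau>.
     if singular_simplex (2 * n - 1) X \<tau>
     then \<phi> (subsimplex n (\<lambda>j. if j \<le> i then j else j + n - 1) \<tau>) *
       \<psi> (subsimplex n (\<lambda>j. i + j) \<tau>)
     else 0)"

text \<open>The form in which the cocycle condition is used below: for the (q+1)-simplex on chosen
  vertices e 0, ..., e (q+1) of a larger simplex.\<close>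

lemma cocycle_subsimplex:
  assumes "coboundary X q \<phi> = (\<lambda>_. 0)" "singular_simplex p X \<sigma>" "\<And>j. j \<le> Suc q \<Longrightarrow> e j \<le> p"
  shows "(\<Sum>k\<le>Suc q. (-1) ^ k * \<phi> (subsimplex q (e \<circ> skip k) \<sigma>)) = 0"
  using coboundary_subsimplex[OF assms(2), of e q \<phi>] assms(1,3)
  by (auto simp: Pi_iff simp del: sum.atMost_Suc)

text \<open>The right-hand side has this form in order to telescope. Of the (n+1)-simplex with
  vertices 0, ..., i, i+n, ..., 2n, \<open>a i\<close> collects the first i+1 faces under \<phi>,
  and \<open>G i\<close> is \<psi>(i, ..., i+n). The faces of \<sigma> fall into the ranges k \<le>
  i, i < k \<le> i+n and k > i+n. The first gives the faces in \<open>a (Suc i)\<close> except the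
  last one; in the other two, one factor is constant and the cocycle condition of the other
  evaluates the sum. All terms with the face \<open>?\<epsilon>\<close> cancel at the end.\<close>

lemma cup1_summand_coboundary:
  fixes \<phi> \<psi> :: "('a, 'k::field) cochain" and n i :: nat and \<sigma> :: "'a ssimplex"
  defines "\<alpha> \<equiv> \<lambda>i j. if j \<le> i then j else j + n - 1"
  defines "a \<equiv> \<lambda>i. \<Sum>k\<le>i. (-1) ^ k * \<phi> (subsimplex n (\<alpha> i \<circ> skip k) \<sigma>)"
  defines "G \<equiv> \<lambda>i. \<psi> (subsimplex n (\<lambda>j. i + j) \<sigma>)"
  assumes \<phi>: "coboundary X n \<phi> = (\<lambda>_. 0)" and \<psi>: "coboundary X n \<psi> = (\<lambda>_. 0)"
    and \<sigma>: "singular_simplex (2 * n) X \<sigma>" and i: "i < n"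
  shows "coboundary X (2 * n - 1) (cup1_summand X n i \<phi> \<psi>) \<sigma> =
    G (Suc i) * a (Suc i) + (-1) ^ n * (G i * a i)"
proof -
  let ?F = "\<lambda>e. \<phi> (subsimplex n e \<sigma>)"
  let ?H = "\<lambda>e. \<psi> (subsimplex n e \<sigma>)"
  let ?\<epsilon> = "\<lambda>j. if j \<le> i then j else j + n"
  let ?t = "\<lambda>k. (-1) ^ k * (?F (skip k \<circ> \<alpha> i) * ?H (skip k \<circ> (\<lambda>j. i + j)))"
  have F_cong: "?F e = ?F e'" if "\<And>j. j \<le> n \<Longrightarrow> e j = e' j" for e e'
    using that by (simp add: subsimplex_cong[of n e e'])
  have H_cong: "?H e = ?H e'" if "\<And>j. j \<le> n \<Longrightarrow> e j = e' j" for e e'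
    using that by (simp add: subsimplex_cong[of n e e'])
  have Suc: "Suc (2 * n - 1) = 2 * n" using i by simp
  have \<sigma>': "singular_simplex (Suc (2 * n - 1)) X \<sigma>" using \<sigma> Suc by simp
  have t: "cup1_summand X n i \<phi> \<psi> (subsimplex (2 * n - 1) (skip k) \<sigma>) =
      ?F (skip k \<circ> \<alpha> i) * ?H (skip k \<circ> (\<lambda>j. i + j))" for k
  proof -
    have "singular_simplex (2 * n - 1) X (subsimplex (2 * n - 1) (skip k) \<sigma>)"
      using i by (intro singular_simplex_subsimplex[OF \<sigma>]) (auto simp: skip_def)
    moreover have "\<alpha> i \<in> {..n} \<rightarrow> {..2 * n - 1}" "(\<lambda>j. i + j) \<in> {..n} \<rightarrow> {..2 * n - 1}"
      using i by (auto simp: \<alpha>_def)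
    moreover have "(\<lambda>j. if j \<le> i then j else j + n - 1) = \<alpha> i"
      by (simp add: \<alpha>_def)
    ultimately show ?thesis
      by (simp only: cup1_summand_def subsimplex_subsimplex if_True)
  qed
  have "coboundary X (2 * n - 1) (cup1_summand X n i \<phi> \<psi>) \<sigma> = (\<Sum>k\<le>2 * n. ?t k)"
    unfolding coboundary_eq[OF \<sigma>'] Suc t ..
  also have "{..2 * n} = {..i} \<union> ((\<lambda>l. i + l) ` {1..n} \<union> (\<lambda>l. l + n - 1) ` {i + 2..Suc n})"
  proof (intro equalityI subsetI)
    fix k assume k: "k \<in> {..2 * n}"
    consider "k \<le> i" | "i < k" "k \<le> i + n" | "i + n < k" by linarith
    then show "k \<in> {..i} \<union> ((\<lambda>l. i + l) ` {1..n} \<union> (\<lambda>l. l + n - 1) ` {i + 2..Suc n})"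
    proof cases
      case 2
      then have "k = i + (k - i)" "k - i \<in> {1..n}" by auto
      then show ?thesis by blast
    next
      case 3
      then have "k = (k + 1 - n) + n - 1" "k + 1 - n \<in> {i + 2..Suc n}" using k by auto
      then show ?thesis by blast
    qed simp
  qed (use i in auto)
  also have "(\<Sum>k\<in>\<dots>. ?t k) = (\<Sum>k\<le>i. ?t k) +
      (\<Sum>k\<in>(\<lambda>l. i + l) ` {1..n} \<union> (\<lambda>l. l + n - 1) ` {i + 2..Suc n}. ?t k)"
    by (rule sum.union_disjoint) (use i in auto)
  also have "(\<Sum>k\<in>(\<lambda>l. i + l) ` {1..n} \<union> (\<lambda>l. l + n - 1) ` {i + 2..Suc n}. ?t k) =
      (\<Sum>k\<in>(\<lambda>l. i + l) ` {1..n}. ?t k) + (\<Sum>k\<in>(\<lambda>l. l + n - 1) ` {i + 2..Suc n}. ?t k)"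
    by (rule sum.union_disjoint) (use i in auto)
  also have "(\<Sum>k\<in>(\<lambda>l. i + l) ` {1..n}. ?t k) = (\<Sum>l = 1..n. ?t (i + l))"
    by (subst sum.reindex) (auto simp: inj_on_def)
  also have "(\<Sum>k\<in>(\<lambda>l. l + n - 1) ` {i + 2..Suc n}. ?t k) = (\<Sum>l = i + 2..Suc n. ?t (l + n - 1))"
    by (subst sum.reindex) (auto simp: inj_on_def)
  finally have split: "coboundary X (2 * n - 1) (cup1_summand X n i \<phi> \<psi>) \<sigma> =
    (\<Sum>k\<le>i. ?t k) + ((\<Sum>l = 1..n. ?t (i + l)) + (\<Sum>l = i + 2..Suc n. ?t (l + n - 1)))" .
  \<comment> \<open>The face (0, ..., i, i+n+1, ..., 2n) is common to the two (n+1)-simplices behind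
    \<open>a i\<close> and \<open>a (Suc i)\<close>.\<close>
  have \<epsilon>: "?F (\<alpha> (Suc i) \<circ> skip (Suc i)) = ?F ?\<epsilon>" "?F (\<alpha> i \<circ> skip (Suc i)) = ?F ?\<epsilon>"
    by (rule F_cong, use i in \<open>auto simp: \<alpha>_def skip_def\<close>)+
  have "(\<Sum>k\<le>i. ?t k) = (\<Sum>k\<le>i. G (Suc i) * ((-1) ^ k * ?F (\<alpha> (Suc i) \<circ> skip k)))"
  proof (rule sum.cong[OF refl])
    fix k assume "k \<in> {..i}"
    then have "?F (skip k \<circ> \<alpha> i) = ?F (\<alpha> (Suc i) \<circ> skip k)" "?H (skip k \<circ> (\<lambda>j. i + j)) = G (Suc i)"
      unfolding G_def using i by (auto intro!: F_cong H_cong simp: \<alpha>_def skip_def)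
    then show "?t k = G (Suc i) * ((-1) ^ k * ?F (\<alpha> (Suc i) \<circ> skip k))" by simp
  qed
  also have "\<dots> = G (Suc i) * (a (Suc i) + (-1) ^ i * ?F ?\<epsilon>)"
    by (simp add: a_def \<epsilon> flip: sum_distrib_left)
  finally have first: "(\<Sum>k\<le>i. ?t k) = G (Suc i) * (a (Suc i) + (-1) ^ i * ?F ?\<epsilon>)" .
  \<comment> \<open>Here \<phi> always sees \<open>?\<epsilon>\<close>, while \<psi> runs over the
    inner faces of (i, ..., i+n+1).\<close>
  have "(\<Sum>l = 1..n. ?t (i + l)) = (\<Sum>l = 1..n. (-1) ^ i * ?F ?\<epsilon> * ((-1) ^ l * ?H ((\<lambda>j. i + j) \<circ> skip l)))"
  proof (rule sum.cong[OF refl])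
    fix l assume "l \<in> {1..n}"
    then have "?F (skip (i + l) \<circ> \<alpha> i) = ?F ?\<epsilon>"
      "?H (skip (i + l) \<circ> (\<lambda>j. i + j)) = ?H ((\<lambda>j. i + j) \<circ> skip l)"
      using i by (auto intro!: F_cong H_cong simp: \<alpha>_def skip_def)
    then show "?t (i + l) = (-1) ^ i * ?F ?\<epsilon> * ((-1) ^ l * ?H ((\<lambda>j. i + j) \<circ> skip l))"
      by (simp add: power_add)
  qed
  also have "\<dots> = (-1) ^ i * ?F ?\<epsilon> * (\<Sum>l = 1..n. (-1) ^ l * ?H ((\<lambda>j. i + j) \<circ> skip l))"
    by (simp add: sum_distrib_left)
  also have "(\<Sum>l = 1..n. (-1) ^ l * ?H ((\<lambda>j. i + j) \<circ> skip l)) = - G (Suc i) + (-1) ^ n * G i"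
  proof -
    have "(\<Sum>l\<le>Suc n. (-1) ^ l * ?H ((\<lambda>j. i + j) \<circ> skip l)) = 0"
      by (rule cocycle_subsimplex[OF \<psi> \<sigma>]) (use i in auto)
    moreover have "{..Suc n} = insert 0 (insert (Suc n) {1..n})" by auto
    moreover have "?H ((\<lambda>j. i + j) \<circ> skip 0) = G (Suc i)" "?H ((\<lambda>j. i + j) \<circ> skip (Suc n)) = G i"
      unfolding G_def by (auto intro!: H_cong simp: skip_def)
    ultimately show ?thesis by (simp add: algebra_simps eq_neg_iff_add_eq_0)
  qed
  finally have second: "(\<Sum>l = 1..n. ?t (i + l)) = (-1) ^ i * ?F ?\<epsilon> * (- G (Suc i) + (-1) ^ n * G i)" .
  \<comment> \<open>Here \<psi> always sees (i, ..., i+n). Vertex l + n - 1 of \<sigma> is vertex l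
    of the simplex that carries \<phi>, whence the shift of the index.\<close>
  have "(\<Sum>l = i + 2..Suc n. ?t (l + n - 1)) =
      (\<Sum>l = i + 2..Suc n. - ((-1) ^ n * G i) * ((-1) ^ l * ?F (\<alpha> i \<circ> skip l)))"
  proof (rule sum.cong[OF refl])
    fix l assume l: "l \<in> {i + 2..Suc n}"
    then have "?F (skip (l + n - 1) \<circ> \<alpha> i) = ?F (\<alpha> i \<circ> skip l)"
      "?H (skip (l + n - 1) \<circ> (\<lambda>j. i + j)) = G i"
      unfolding G_def using i by (auto intro!: F_cong H_cong simp: \<alpha>_def skip_def)
    moreover have "(-1) ^ (l + n - 1) = - ((-1) ^ n * (-1) ^ l :: 'k)"
      using l by (cases l) (auto simp: power_add)
    ultimately show "?t (l + n - 1) = - ((-1) ^ n * G i) * ((-1) ^ l * ?F (\<alpha> i \<circ> skip l))"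
      by simp
  qed
  also have "\<dots> = - ((-1) ^ n * G i) * (\<Sum>l = i + 2..Suc n. (-1) ^ l * ?F (\<alpha> i \<circ> skip l))"
    by (rule sum_distrib_left[symmetric])
  also have "(\<Sum>l = i + 2..Suc n. (-1) ^ l * ?F (\<alpha> i \<circ> skip l)) = - a i + (-1) ^ i * ?F ?\<epsilon>"
  proof -
    have "(\<Sum>l\<le>Suc n. (-1) ^ l * ?F (\<alpha> i \<circ> skip l)) = 0"
      by (rule cocycle_subsimplex[OF \<phi> \<sigma>]) (use i in \<open>auto simp: \<alpha>_def\<close>)
    moreover have "{..Suc n} = {..i} \<union> insert (Suc i) {i + 2..Suc n}" using i by auto
    moreover have "(\<Sum>l\<in>{..i} \<union> insert (Suc i) {i + 2..Suc n}. (-1) ^ l * ?F (\<alpha> i \<circ> skip l)) =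
      a i + (\<Sum>l\<in>insert (Suc i) {i + 2..Suc n}. (-1) ^ l * ?F (\<alpha> i \<circ> skip l))"
      unfolding a_def by (rule sum.union_disjoint) auto
    moreover have "(\<Sum>l\<in>insert (Suc i) {i + 2..Suc n}. (-1) ^ l * ?F (\<alpha> i \<circ> skip l)) =
      - ((-1) ^ i * ?F ?\<epsilon>) + (\<Sum>l = i + 2..Suc n. (-1) ^ l * ?F (\<alpha> i \<circ> skip l))"
      by (subst sum.insert) (auto simp: \<epsilon>)
    ultimately show ?thesis by (simp add: algebra_simps eq_neg_iff_add_eq_0 del: sum.cl_ivl_Suc)
  qed
  finally have third: "(\<Sum>l = i + 2..Suc n. ?t (l + n - 1)) =
    - ((-1) ^ n * G i) * (- a i + (-1) ^ i * ?F ?\<epsilon>)" .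
  show ?thesis
    unfolding split first second third by (simp add: algebra_simps)
qed

text \<open>The sign is (-1)^(n*n) = (-1)^n. Weighting the i-th summand by the i-th power of
  (-1)^(n+1) makes neighbouring coboundaries cancel. Only the outer terms remain:
  \<open>G 0 * a 0\<close> is \<psi>(0..n) \<phi>(n..2n), and \<open>G n * a n\<close> is
  \<phi>(0..n) \<psi>(n..2n) up to sign.\<close>

lemma cup_cochain_commute:
  fixes \<phi> \<psi> :: "('a, 'k::field) cochain"
  assumes "\<phi> \<in> cocycles X n" "\<psi> \<in> cocycles X n" "1 \<le> n"
  shows "(\<lambda>\<sigma>. cup_cochain X n n \<phi> \<psi> \<sigma> - (-1) ^ n * cup_cochain X n n \<psi> \<phi> \<sigma>) \<in> coboundaries X (2 * n)"
proof -
  define s :: "nat \<Rightarrow> 'k" where "s i = ((-1) ^ Suc n) ^ i" for i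
  define \<eta> where "\<eta> = (\<lambda>\<sigma>. \<Sum>i<n. - s i * cup1_summand X n i \<phi> \<psi> \<sigma>)"
  have \<phi>: "coboundary X n \<phi> = (\<lambda>_. 0)" and \<psi>: "coboundary X n \<psi> = (\<lambda>_. 0)"
    using assms by (auto simp: cocycles_def)
  have "coboundary X (2 * n - 1) \<eta> \<sigma> =
      cup_cochain X n n \<phi> \<psi> \<sigma> - (-1) ^ n * cup_cochain X n n \<psi> \<phi> \<sigma>" for \<sigma>
  proof (cases "singular_simplex (2 * n) X \<sigma>")
    case True
    let ?\<alpha> = "\<lambda>i j. if j \<le> i then j else j + n - 1"
    define a where "a = (\<lambda>i. \<Sum>k\<le>i. (-1) ^ k * \<phi> (subsimplex n (?\<alpha> i \<circ> skip k) \<sigma>))"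
    define G where "G = (\<lambda>i. \<psi> (subsimplex n (\<lambda>j. i + j) \<sigma>))"
    have d: "coboundary X (2 * n - 1) (cup1_summand X n i \<phi> \<psi>) \<sigma> =
        G (Suc i) * a (Suc i) + (-1) ^ n * (G i * a i)" if "i < n" for i
      using cup1_summand_coboundary[OF \<phi> \<psi> True that] by (simp only: a_def G_def)
    have ss: "s (Suc i) = - ((-1) ^ n * s i)" for i by (simp add: s_def)
    have sgn: "(-1) ^ n * ((-1) ^ n * z) = z" for z :: 'k
      by (simp flip: mult.assoc power_add)
    have tele: "(\<Sum>i<k. s i * coboundary X (2 * n - 1) (cup1_summand X n i \<phi> \<psi>) \<sigma>) =
      (-1) ^ n * (G 0 * a 0) - (-1) ^ n * s k * (G k * a k)" if "k \<le> n" for k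
      using that
    proof (induction k)
      case 0
      then show ?case by (simp add: s_def)
    next
      case (Suc k)
      then show ?case
        using d[of k] by (simp add: ss sgn algebra_simps)
    qed
    have "(-1) ^ (n * Suc n) = (1 :: 'k)" by (simp add: uminus_power_if)
    then have sn: "s n = 1" by (simp only: s_def mult.commute flip: power_mult)
    \<comment> \<open>Only one face of (0, ..., n, 2n) is absent from \<open>a n\<close>, the one
      without the last vertex; the cocycle condition expresses \<open>a n\<close> by it.\<close>
    have "a n = (-1) ^ n * \<phi> (subsimplex n id \<sigma>)"
    proof -
      have "(\<Sum>k\<le>Suc n. (-1) ^ k * \<phi> (subsimplex n (?\<alpha> n \<circ> skip k) \<sigma>)) = 0"
        by (rule cocycle_subsimplex[OF \<phi> True]) (use assms(3) in auto)
      moreover have "subsimplex n (?\<alpha> n \<circ> skip (Suc n)) \<sigma> = subsimplex n id \<sigma>"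
        by (rule subsimplex_cong) (simp add: skip_def)
      ultimately show ?thesis by (simp add: a_def)
    qed
    moreover have "a 0 = \<phi> (subsimplex n (\<lambda>j. n + j) \<sigma>)"
      by (simp add: a_def, intro arg_cong[of _ _ \<phi>] subsimplex_cong) (simp add: skip_def)
    moreover have "G 0 = \<psi> (subsimplex n id \<sigma>)"
      unfolding G_def by (intro arg_cong[of _ _ \<psi>] subsimplex_cong) simp
    moreover have "G n = \<psi> (subsimplex n (\<lambda>j. n + j) \<sigma>)"
      by (simp add: G_def)
    ultimately have "(\<Sum>i<n. s i * coboundary X (2 * n - 1) (cup1_summand X n i \<phi> \<psi>) \<sigma>) =
      (-1) ^ n * cup_cochain X n n \<psi> \<phi> \<sigma> - cup_cochain X n n \<phi> \<psi> \<sigma>"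
      using tele[of n] True[unfolded mult_2]
      by (simp add: sn sgn cup_cochain_def front_face_eq_subsimplex back_face_eq_subsimplex
          mult_ac)
    then show ?thesis
      unfolding \<eta>_def coboundary_sum coboundary_scale by (simp add: sum_negf)
  next
    case False
    then show ?thesis
      using assms(3) by (simp add: coboundary_def cup_cochain_def mult_2)
  qed
  moreover have "\<eta> \<in> carrier (cochain_space X (2 * n - 1))"
    by (simp add: \<eta>_def cup1_summand_def)
  ultimately show ?thesis
    using assms(3) by (auto simp: coboundaries_def intro!: image_eqI[of _ _ \<eta>])
qed

section \<open>Quotients of vector spaces\<close>

lemma quot_module_simps [simp]:
  "carrier (quot_module V W) = a_rcosets\<^bsub>V\<^esub> W"
  "add (quot_module V W) = set_add V"
  "zero (quot_module V W) = W"
  "mult (quot_module V W) = rcoset_mult V W"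
  "one (quot_module V W) = W +>\<^bsub>V\<^esub> \<one>\<^bsub>V\<^esub>"
  "smult (quot_module V W) = (\<lambda>a P. \<Union>v\<in>P. W +>\<^bsub>V\<^esub> (a \<odot>\<^bsub>V\<^esub> v))"
  by (simp_all add: quot_module_def FactRing_def ring.defs module.defs)

lemma vectorspace_class_ringI: "module class_ring V \<Longrightarrow> vectorspace class_ring V"
  for V :: "('k::field, 'v, 'r) module_scheme"
  by (intro vectorspace.intro class_field)

locale space_quotient =
  fixes V :: "('k::field, 'v, 'r) module_scheme" and W :: "'v set"
  assumes space: "vectorspace class_ring V"
    and sub: "submodule class_ring W V"
begin

sublocale V: vectorspace class_ring V
  rewrites "carrier class_ring = UNIV" by (fact space) simp

lemma W_subset: "W \<subseteq> carrier V"
  using sub by (simp add: submodule_def)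

lemma W_carrier: "w \<in> W \<Longrightarrow> w \<in> carrier V"
  using W_subset by blast

lemma W_smult: "w \<in> W \<Longrightarrow> a \<odot>\<^bsub>V\<^esub> w \<in> W"
  using submodule.smult_closed[OF sub] by simp

lemma W_add: "w \<in> W \<Longrightarrow> w' \<in> W \<Longrightarrow> w \<oplus>\<^bsub>V\<^esub> w' \<in> W"
  using submodule.m_closed[OF sub] by simp

lemma W_zero: "\<zero>\<^bsub>V\<^esub> \<in> W"
  using submodule.zero_closed[OF sub] by simp

lemma uminus_eq: "v \<in> carrier V \<Longrightarrow> \<ominus>\<^bsub>V\<^esub> v = (-1) \<odot>\<^bsub>V\<^esub> v"
  using V.smult_l_minus[of 1 v] V.smult_one by (simp add: class_ring_simps)

lemma space_smult:
  assumes "v \<in> carrier V"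
  shows "(a + b) \<odot>\<^bsub>V\<^esub> v = a \<odot>\<^bsub>V\<^esub> v \<oplus>\<^bsub>V\<^esub> b \<odot>\<^bsub>V\<^esub> v" "(a * b) \<odot>\<^bsub>V\<^esub> v = a \<odot>\<^bsub>V\<^esub> (b \<odot>\<^bsub>V\<^esub> v)"
    "1 \<odot>\<^bsub>V\<^esub> v = v" "a \<odot>\<^bsub>V\<^esub> v \<in> carrier V"
  using V.smult_l_distr[of a b v] V.smult_assoc1[of a b v] V.smult_one[of v] V.smult_closed[of a v] assms
  by simp_all

sublocale W: abelian_subgroup W V
proof (rule abelian_subgroupI3)
  show "additive_subgroup W V"
    unfolding additive_subgroup_def
  proof (rule group.subgroupI)
    show "group (add_monoid V)" by (rule V.a_group)
    show "W \<subseteq> carrier (add_monoid V)" using W_subset by simp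
    show "W \<noteq> {}" using W_zero by blast
    show "inv\<^bsub>add_monoid V\<^esub> w \<in> W" if "w \<in> W" for w
      using uminus_eq[of w] W_smult[OF that, of "-1"] W_carrier[OF that] by (simp add: a_inv_def)
    show "w \<otimes>\<^bsub>add_monoid V\<^esub> w' \<in> W" if "w \<in> W" "w' \<in> W" for w w'
      using W_add[OF that] by simp
  qed
qed (rule V.abelian_group_axioms)

abbreviation Q where "Q \<equiv> quot_module V W"

abbreviation cl where "cl v \<equiv> W +>\<^bsub>V\<^esub> v"

lemma quotient_carrier: "carrier Q = cl ` carrier V"
  by (auto simp: A_RCOSETS_def')

lemma cl_closed: "v \<in> carrier V \<Longrightarrow> cl v \<in> carrier Q"
  unfolding quotient_carrier by blast

lemma in_cl_iff: "u \<in> cl v \<longleftrightarrow> u \<in> carrier V \<and> u \<ominus>\<^bsub>V\<^esub> v \<in> W" if "v \<in> carrier V"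
  using W.a_elemrcos_carrier[OF that] W.a_rcos_module[OF that] unfolding a_minus_def by blast

lemma cl_eq_iff: "cl v = cl v' \<longleftrightarrow> v \<ominus>\<^bsub>V\<^esub> v' \<in> W" if "v \<in> carrier V" "v' \<in> carrier V"
proof -
  have "cl v = cl v'" if "v \<in> cl v'"
    using abelian_group.a_repr_independence[OF V.abelian_group_axioms that \<open>v' \<in> carrier V\<close> W.a_subgroup]
    by (rule sym)
  then have "cl v = cl v' \<longleftrightarrow> v \<in> cl v'"
    using W.a_rcos_self[OF that(1)] by metis
  then show ?thesis using that by (simp add: in_cl_iff)
qed

lemma cl_add: "v \<in> carrier V \<Longrightarrow> v' \<in> carrier V \<Longrightarrow> cl v \<oplus>\<^bsub>Q\<^esub> cl v' = cl (v \<oplus>\<^bsub>V\<^esub> v')"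
  by (simp add: W.a_rcos_sum)

lemma cl_zero: "cl v = \<zero>\<^bsub>Q\<^esub> \<longleftrightarrow> v \<in> W" if "v \<in> carrier V"
  using that cl_eq_iff[of v "\<zero>\<^bsub>V\<^esub>"] W.a_subset uminus_eq[of "\<zero>\<^bsub>V\<^esub>"]
  by (simp add: a_minus_def)

text \<open>The scalar action on a quotient is defined as a union over all representatives; the
  union is a single coset since a (u - v) stays in W.\<close>

lemma cl_smult: "a \<odot>\<^bsub>Q\<^esub> cl v = cl (a \<odot>\<^bsub>V\<^esub> v)" if v: "v \<in> carrier V"
proof -
  have "cl (a \<odot>\<^bsub>V\<^esub> u) = cl (a \<odot>\<^bsub>V\<^esub> v)" if "u \<in> cl v" for u
  proof -
    have u: "u \<in> carrier V" "u \<ominus>\<^bsub>V\<^esub> v \<in> W" using that v by (auto simp: in_cl_iff)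
    have "a \<odot>\<^bsub>V\<^esub> u \<ominus>\<^bsub>V\<^esub> a \<odot>\<^bsub>V\<^esub> v = a \<odot>\<^bsub>V\<^esub> (u \<ominus>\<^bsub>V\<^esub> v)"
      using u v by (simp add: a_minus_def V.smult_r_distr V.smult_r_minus)
    then show ?thesis using u v W_smult by (simp add: cl_eq_iff)
  qed
  then have "(\<Union>u\<in>cl v. cl (a \<odot>\<^bsub>V\<^esub> u)) = (\<Union>u\<in>cl v. cl (a \<odot>\<^bsub>V\<^esub> v))"
    by (rule SUP_cong[OF refl])
  also have "\<dots> = cl (a \<odot>\<^bsub>V\<^esub> v)"
    using W.a_rcos_self[OF v] by (intro SUP_const) blast
  finally show ?thesis by simp
qed

lemma quotient_space: "vectorspace class_ring Q"
proof (intro vectorspace_class_ringI moduleI)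
  show "cring (class_ring :: 'k ring)" by (rule class_cring.cring_axioms)
  have zero: "\<zero>\<^bsub>Q\<^esub> = cl \<zero>\<^bsub>V\<^esub>"
    using cl_zero[of "\<zero>\<^bsub>V\<^esub>"] W_zero by (simp del: quot_module_simps)
  show "abelian_group Q"
  proof (rule abelian_groupI)
    fix P assume "P \<in> carrier Q"
    then obtain v where v: "v \<in> carrier V" "P = cl v" by (auto simp: quotient_carrier simp del: quot_module_simps)
    then show "\<exists>R\<in>carrier Q. R \<oplus>\<^bsub>Q\<^esub> P = \<zero>\<^bsub>Q\<^esub>"
      by (intro bexI[of _ "cl (\<ominus>\<^bsub>V\<^esub> v)"])
        (simp_all add: cl_add cl_closed zero V.l_neg del: quot_module_simps)
  qed (auto simp: quotient_carrier cl_add zero V.a_ac simp del: quot_module_simps)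
qed (auto simp: quotient_carrier cl_smult cl_add space_smult V.smult_r_distr simp del: quot_module_simps)

lemma cl_minus: "v \<in> carrier V \<Longrightarrow> v' \<in> carrier V \<Longrightarrow> cl v \<ominus>\<^bsub>Q\<^esub> cl v' = cl (v \<ominus>\<^bsub>V\<^esub> v')"
proof -
  assume v: "v \<in> carrier V" "v' \<in> carrier V"
  interpret Q: vectorspace class_ring Q by (rule quotient_space)
  have "\<ominus>\<^bsub>Q\<^esub> cl v' = cl (\<ominus>\<^bsub>V\<^esub> v')"
    using v by (intro Q.minus_equality) (simp_all add: cl_add cl_closed V.l_neg cl_zero W_zero del: quot_module_simps)
  then show ?thesis using v by (simp add: a_minus_def cl_add del: quot_module_simps)
qed

lemma cl_finsum:
  assumes "finite A" "f \<in> A \<rightarrow> carrier V"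
  shows "finsum Q (\<lambda>i. cl (f i)) A = cl (finsum V f A)"
proof -
  interpret Q: vectorspace class_ring Q by (rule quotient_space)
  show ?thesis
    using assms
  proof (induction A rule: finite_induct)
    case empty
    then show ?case using cl_zero[of "\<zero>\<^bsub>V\<^esub>"] W_zero by (simp del: quot_module_simps)
  next
    case (insert a A)
    then have "(\<lambda>i. cl (f i)) \<in> A \<rightarrow> carrier Q" "f \<in> A \<rightarrow> carrier V" "f a \<in> carrier V"
      using cl_closed by auto
    then show ?case
      using insert by (simp add: cl_add cl_closed del: quot_module_simps)
  qed
qed

end

section \<open>Linear functionals on quotients, and bounds for the dimension\<close>

definition linear_functional :: "('k::field, 'v, 'r) module_scheme \<Rightarrow> ('v \<Rightarrow> 'k) \<Rightarrow> bool" where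
  "linear_functional V F \<longleftrightarrow>
     (\<forall>x \<in> carrier V. \<forall>y \<in> carrier V. F (x \<oplus>\<^bsub>V\<^esub> y) = F x + F y) \<and>
     (\<forall>a. \<forall>x \<in> carrier V. F (a \<odot>\<^bsub>V\<^esub> x) = a * F x)"

lemma linear_functionalD:
  assumes "linear_functional V F" "x \<in> carrier V"
  shows "y \<in> carrier V \<Longrightarrow> F (x \<oplus>\<^bsub>V\<^esub> y) = F x + F y" "F (a \<odot>\<^bsub>V\<^esub> x) = a * F x"
  using assms by (auto simp: linear_functional_def)

text \<open>The induced map on cosets, by choice of a representative; the choice is immaterial once
  F vanishes on the subspace.\<close>

definition coset_functional :: "('v \<Rightarrow> 'k) \<Rightarrow> 'v set \<Rightarrow> 'k" where
  "coset_functional F P = F (SOME v. v \<in> P)"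

context space_quotient
begin

lemma linear_functional_uminus:
  assumes "linear_functional V F" "v \<in> carrier V" "v' \<in> carrier V"
  shows "F (v \<ominus>\<^bsub>V\<^esub> v') = F v - F v'"
  using linear_functionalD[OF assms(1)] assms(2,3) by (simp add: a_minus_def uminus_eq)

lemma coset_functional_cl:
  assumes F: "linear_functional V F" "\<And>w. w \<in> W \<Longrightarrow> F w = 0" and v: "v \<in> carrier V"
  shows "coset_functional F (cl v) = F v"
proof -
  define u where "u = (SOME u. u \<in> cl v)"
  have "u \<in> cl v"
    unfolding u_def using W.a_rcos_self[OF v] by (rule someI)
  then have u: "u \<in> carrier V" "u \<ominus>\<^bsub>V\<^esub> v \<in> W" using v by (auto simp: in_cl_iff)
  have "F u - F v = 0" using linear_functional_uminus[OF F(1) u(1) v] F(2)[OF u(2)] by simp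
  then show ?thesis by (simp add: coset_functional_def u_def)
qed

lemma linear_functional_coset:
  assumes F: "linear_functional V F" "\<And>w. w \<in> W \<Longrightarrow> F w = 0"
  shows "linear_functional Q (coset_functional F)"
  unfolding linear_functional_def quotient_carrier
  by (auto simp: cl_add cl_smult coset_functional_cl[OF F] linear_functionalD[OF F(1)]
      simp del: quot_module_simps)

end

lemma linear_functional_zero:
  assumes "vectorspace class_ring V" "linear_functional V F"
  shows "F \<zero>\<^bsub>V\<^esub> = 0"
proof -
  interpret V: vectorspace class_ring V by fact
  have "F \<zero>\<^bsub>V\<^esub> = F \<zero>\<^bsub>V\<^esub> + F \<zero>\<^bsub>V\<^esub>"
    using linear_functionalD(1)[OF assms(2), of "\<zero>\<^bsub>V\<^esub>" "\<zero>\<^bsub>V\<^esub>"] by simp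
  then show ?thesis by (simp only: add_cancel_right_right)
qed

lemma linear_functional_finsum:
  assumes "vectorspace class_ring V" "linear_functional V F" "finite A" "f \<in> A \<rightarrow> carrier V"
  shows "F (finsum V f A) = (\<Sum>i\<in>A. F (f i))"
proof -
  interpret V: vectorspace class_ring V by fact
  show ?thesis
    using assms(3,4)
  proof (induction A rule: finite_induct)
    case empty
    then show ?case using linear_functional_zero[OF assms(1,2)] by simp
  next
    case (insert a A)
    then have "f a \<in> carrier V" "f \<in> A \<rightarrow> carrier V" by auto
    then show ?case using insert by (simp add: linear_functionalD[OF assms(2)])
  qed
qed

text \<open>Applying \<open>F i\<close> to a vanishing linear combination of the \<open>e j\<close>
  isolates the i-th coefficient. Finite dimension is assumed because \<open>dim\<close> is the least
  cardinality of a finite generating set and says nothing if there is none.\<close>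

lemma card_le_vdim:
  assumes "vectorspace class_ring V" "vectorspace.fin_dim class_ring V" "finite I"
    and e: "\<And>i. i \<in> I \<Longrightarrow> e i \<in> carrier V"
    and F: "\<And>i. i \<in> I \<Longrightarrow> linear_functional V (F i)"
    and diag: "\<And>i. i \<in> I \<Longrightarrow> F i (e i) \<noteq> 0"
    and off: "\<And>i j. i \<in> I \<Longrightarrow> j \<in> I \<Longrightarrow> i \<noteq> j \<Longrightarrow> F i (e j) = 0"
  shows "card I \<le> vdim V"
proof -
  interpret V: vectorspace class_ring V by fact
  have inj: "inj_on e I"
    using diag off by (metis inj_onI)
  have sub: "e ` I \<subseteq> carrier V" using e by blast
  have "V.lin_indpt (e ` I)"
  proof (rule V.finite_lin_indpt2)
    fix a assume a: "V.lincomb a (e ` I) = \<zero>\<^bsub>V\<^esub>"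
    show "\<forall>v \<in> e ` I. a v = \<zero>\<^bsub>class_ring\<^esub>"
    proof
      fix v assume "v \<in> e ` I"
      then obtain i where i: "i \<in> I" "v = e i" by blast
      have "F i (V.lincomb a (e ` I)) = (\<Sum>v\<in>e ` I. F i (a v \<odot>\<^bsub>V\<^esub> v))"
        unfolding V.lincomb_def using sub assms(3)
        by (intro linear_functional_finsum[OF assms(1) F[OF i(1)]]) auto
      also have "\<dots> = (\<Sum>j\<in>I. a (e j) * F i (e j))"
        using sub by (subst sum.reindex[OF inj]) (auto intro!: sum.cong linear_functionalD(2)[OF F[OF i(1)]])
      also have "\<dots> = a (e i) * F i (e i)"
      proof -
        have "a (e j) * F i (e j) = 0" if "j \<in> I - {i}" for j
          using off[of i j] that i(1) by auto
        then have "(\<Sum>j\<in>I - {i}. a (e j) * F i (e j)) = 0"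
          by (intro sum.neutral ballI)
        then show ?thesis by (simp add: sum.remove[OF assms(3) i(1)])
      qed
      finally have "a (e i) * F i (e i) = 0"
        using a linear_functional_zero[OF assms(1) F[OF i(1)]] by simp
      then show "a v = \<zero>\<^bsub>class_ring\<^esub>" using diag i by simp
    qed
  qed (use assms(3) sub in auto)
  then have "card (e ` I) \<le> V.dim"
    using V.li_le_dim[OF assms(2) sub] by simp
  then show ?thesis by (simp add: card_image inj)
qed

text \<open>Spanning is tested on subspaces instead of linear combinations: in a quotient of a
  quotient, a subspace can be pulled back to the representatives and checked on generators
  there.\<close>

lemma fin_dimI:
  assumes "vectorspace class_ring V" "finite S" "S \<subseteq> carrier V"
    and "\<And>N. submodule class_ring N V \<Longrightarrow> S \<subseteq> N \<Longrightarrow> carrier V \<subseteq> N"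
  shows "vectorspace.fin_dim class_ring V"
proof -
  interpret V: vectorspace class_ring V by fact
  have "carrier V \<subseteq> V.span S"
    using assms(3) by (intro assms(4) V.span_is_submodule V.in_own_span)
  then have "V.gen_set S"
    using V.span_is_subset2[OF assms(3)] by blast
  then show ?thesis using assms(2,3) by (auto simp: V.fin_dim_def)
qed

section \<open>Free spaces and tensor products\<close>

text \<open>Cocycles, finitely supported functions and noncommutative polynomials all carry
  pointwise operations. The predicate treats them at once, whatever \<open>mult\<close> and
  \<open>one\<close> mean in the record.\<close>

definition function_space :: "('k::field, 's \<Rightarrow> 'k, 'r) module_scheme \<Rightarrow> bool" where
  "function_space V \<longleftrightarrow>
     zero V = (\<lambda>_. 0) \<and> add V = (\<lambda>f g s. f s + g s) \<and> smult V = (\<lambda>a f s. a * f s) \<and>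
     (\<lambda>_. 0) \<in> carrier V \<and>
     (\<forall>f \<in> carrier V. \<forall>g \<in> carrier V. (\<lambda>s. f s + g s) \<in> carrier V) \<and>
     (\<forall>a. \<forall>f \<in> carrier V. (\<lambda>s. a * f s) \<in> carrier V)"

lemma function_spaceD:
  assumes "function_space V"
  shows "zero V = (\<lambda>_. 0)" "add V = (\<lambda>f g s. f s + g s)" "smult V = (\<lambda>a f s. a * f s)"
    "(\<lambda>_. 0) \<in> carrier V"
    "\<And>f g. f \<in> carrier V \<Longrightarrow> g \<in> carrier V \<Longrightarrow> (\<lambda>s. f s + g s) \<in> carrier V"
    "\<And>a f. f \<in> carrier V \<Longrightarrow> (\<lambda>s. a * f s) \<in> carrier V"
  using assms by (auto simp: function_space_def)

lemma function_space_diff_closed: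
  assumes "function_space V" "f \<in> carrier V" "g \<in> carrier V"
  shows "(\<lambda>s. f s - g s) \<in> carrier V"
  using function_spaceD(5)[OF assms(1,2) function_spaceD(6)[OF assms(1,3), of "-1"]] by simp

lemma function_space_is_space:
  fixes V :: "('k::field, 's \<Rightarrow> 'k, 'r) module_scheme"
  assumes V: "function_space V"
  shows "vectorspace class_ring V"
proof (intro vectorspace_class_ringI moduleI)
  show "cring (class_ring :: 'k ring)" by (rule class_cring.cring_axioms)
  show "abelian_group V"
  proof (rule abelian_groupI)
    fix f assume "f \<in> carrier V"
    then show "\<exists>g\<in>carrier V. g \<oplus>\<^bsub>V\<^esub> f = \<zero>\<^bsub>V\<^esub>"
      by (intro bexI[of _ "\<lambda>s. -1 * f s"] function_spaceD[OF V]) (simp add: function_spaceD(1-3)[OF V])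
  qed (use function_spaceD[OF V] in \<open>auto simp: add_ac\<close>)
qed (use function_spaceD[OF V] in \<open>auto simp: algebra_simps\<close>)

lemma function_space_minus:
  assumes V: "function_space V" and "f \<in> carrier V" "g \<in> carrier V"
  shows "f \<ominus>\<^bsub>V\<^esub> g = (\<lambda>s. f s - g s)"
proof -
  interpret V: vectorspace class_ring V by (rule function_space_is_space[OF V])
  have "\<ominus>\<^bsub>V\<^esub> g = (\<lambda>s. - g s)"
    using function_spaceD(6)[OF V assms(3), of "-1"] assms(3)
    by (intro V.minus_equality) (simp_all add: function_spaceD(1-3)[OF V])
  then show ?thesis by (simp add: a_minus_def function_spaceD(2)[OF V])
qed

lemma function_space_submodule:
  assumes V: "function_space V" and "W \<subseteq> carrier V" "(\<lambda>_. 0) \<in> W"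
    "\<And>f g. f \<in> W \<Longrightarrow> g \<in> W \<Longrightarrow> (\<lambda>s. f s + g s) \<in> W"
    "\<And>a f. f \<in> W \<Longrightarrow> (\<lambda>s. a * f s) \<in> W"
  shows "submodule class_ring W V"
  using assms function_space_is_space[OF V]
  by (intro submodule.intro) (auto simp: function_spaceD(1-3)[OF V] vectorspace_def)

lemma function_space_finsum:
  assumes V: "function_space V" and "finite A" "f \<in> A \<rightarrow> carrier V"
  shows "finsum V f A = (\<lambda>s. \<Sum>i\<in>A. f i s)"
proof -
  interpret V: vectorspace class_ring V by (rule function_space_is_space[OF V])
  show ?thesis
    using assms(2,3)
  proof (induction A rule: finite_induct)
    case (insert a A)
    then have "f a \<in> carrier V" "f \<in> A \<rightarrow> carrier V" by auto
    then show ?case using insert by (simp add: function_spaceD(2)[OF V])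
  qed (simp add: function_spaceD(1)[OF V])
qed

lemma free_space_carrier: "f \<in> carrier (free_space S) \<longleftrightarrow> finite {s. f s \<noteq> 0} \<and> {s. f s \<noteq> 0} \<subseteq> S"
  by (simp add: free_space_def)

lemma free_space_finite: "f \<in> carrier (free_space S) \<Longrightarrow> finite {s. f s \<noteq> 0}"
  by (simp add: free_space_carrier)

lemma free_space_simps [simp]:
  "zero (free_space S) = (\<lambda>_. 0)"
  "add (free_space S) = (\<lambda>f g s. f s + g s)"
  "smult (free_space S) = (\<lambda>a f s. a * f s)"
  by (simp_all add: free_space_def)

lemma finite_support_add:
  "finite {s. f s \<noteq> (0::'k::field)} \<Longrightarrow> finite {s. g s \<noteq> 0} \<Longrightarrow> finite {s. f s + g s \<noteq> 0}"
  by (rule finite_subset[of _ "{s. f s \<noteq> 0} \<union> {s. g s \<noteq> 0}"]) auto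

lemma function_space_free_space: "function_space (free_space S :: ('k::field, 's \<Rightarrow> 'k) module)"
proof -
  have "(\<lambda>s. f s + g s) \<in> carrier (free_space S)"
    if "f \<in> carrier (free_space S)" "g \<in> carrier (free_space S)" for f g :: "'s \<Rightarrow> 'k"
  proof -
    have "{s. f s + g s \<noteq> 0} \<subseteq> {s. f s \<noteq> 0} \<union> {s. g s \<noteq> 0}" by auto
    then show ?thesis using that finite_support_add[of f g] by (auto simp: free_space_carrier)
  qed
  moreover have "(\<lambda>s. a * f s) \<in> carrier (free_space S)" if "f \<in> carrier (free_space S)" for a and f :: "'s \<Rightarrow> 'k"
  proof -
    have "finite {s. a * f s \<noteq> 0}" using that by (auto simp: free_space_carrier intro: finite_subset[of _ "{s. f s \<noteq> 0}"])
    then show ?thesis using that by (auto simp: free_space_carrier)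
  qed
  ultimately show ?thesis by (simp add: function_space_def) (simp add: free_space_carrier)
qed

lemma single_in_free_space: "s \<in> S \<Longrightarrow> single s \<in> carrier (free_space S)"
  by (auto simp: single_def free_space_carrier)

text \<open>A finitely supported f is the finite sum of the \<open>f s * single s\<close>, so
  induction over subsets of the support applies.\<close>

lemma free_space_induct [consumes 1, case_names zero single add scale]:
  assumes "f \<in> carrier (free_space S)"
    and zero: "P (\<lambda>_. 0)"
    and single: "\<And>s. s \<in> S \<Longrightarrow> P (single s)"
    and add: "\<And>f g. f \<in> carrier (free_space S) \<Longrightarrow> g \<in> carrier (free_space S) \<Longrightarrow> P f \<Longrightarrow> P g \<Longrightarrow>
      P (\<lambda>s. f s + g s)"
    and scale: "\<And>a f. f \<in> carrier (free_space S) \<Longrightarrow> P f \<Longrightarrow> P (\<lambda>s. a * f s)"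
  shows "P f"
proof -
  have "P (\<lambda>t. \<Sum>s\<in>A. f s * single s t) \<and> (\<lambda>t. \<Sum>s\<in>A. f s * single s t) \<in> carrier (free_space S)"
    if "finite A" "A \<subseteq> S" for A
    using that
  proof (induction A rule: finite_induct)
    case empty
    then show ?case using zero by (simp add: free_space_carrier)
  next
    case (insert a A)
    have "P (\<lambda>t. f a * single a t)" "(\<lambda>t. f a * single a t) \<in> carrier (free_space S)"
      using insert single_in_free_space[of a S] single scale
        function_spaceD(6)[OF function_space_free_space] by blast+
    then show ?case
      using insert add function_spaceD(5)[OF function_space_free_space, of "\<lambda>t. f a * single a t"]
      by simp
  qed
  moreover have "f = (\<lambda>t. \<Sum>s\<in>{s. f s \<noteq> 0}. f s * single s t)"
  proof
    fix t
    have "(\<Sum>s\<in>{s. f s \<noteq> 0}. f s * single s t) = (\<Sum>s\<in>{s. f s \<noteq> 0}. if s = t then f t else 0)"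
      by (intro sum.cong) (auto simp: single_def)
    then show "f t = (\<Sum>s\<in>{s. f s \<noteq> 0}. f s * single s t)"
      using assms(1) by (simp add: sum.delta' free_space_carrier)
  qed
  moreover have "finite {s. f s \<noteq> 0}" "{s. f s \<noteq> 0} \<subseteq> S" using assms(1) by (simp_all add: free_space_carrier)
  ultimately show ?thesis by metis
qed

text \<open>The linear extension of \<beta> from the basis of the functions \<open>single s\<close>,
  evaluated at f. Over an infinite support the sum is 0 by default, so additivity carries finiteness
  assumptions.\<close>

definition lin_val :: "('s \<Rightarrow> 'k::field) \<Rightarrow> ('s \<Rightarrow> 'k) \<Rightarrow> 'k" where
  "lin_val \<beta> f = (\<Sum>s | f s \<noteq> 0. f s * \<beta> s)"

lemma lin_val_eq: "finite A \<Longrightarrow> {s. f s \<noteq> 0} \<subseteq> A \<Longrightarrow> lin_val \<beta> f = (\<Sum>s\<in>A. f s * \<beta> s)"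
  unfolding lin_val_def by (rule sum.mono_neutral_left) auto

lemma lin_val_add:
  assumes "finite {s. f s \<noteq> 0}" "finite {s. g s \<noteq> 0}"
  shows "lin_val \<beta> (\<lambda>s. f s + g s) = lin_val \<beta> f + lin_val \<beta> g"
proof -
  let ?A = "{s. f s \<noteq> 0} \<union> {s. g s \<noteq> 0}"
  have "lin_val \<beta> (\<lambda>s. f s + g s) = (\<Sum>s\<in>?A. (f s + g s) * \<beta> s)"
    using assms by (intro lin_val_eq) auto
  moreover have "lin_val \<beta> f = (\<Sum>s\<in>?A. f s * \<beta> s)" "lin_val \<beta> g = (\<Sum>s\<in>?A. g s * \<beta> s)"
    using assms by (intro lin_val_eq; auto)+
  ultimately show ?thesis by (simp add: sum.distrib distrib_right)
qed

lemma lin_val_scale: "lin_val \<beta> (\<lambda>s. a * f s) = a * lin_val \<beta> f"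
  by (cases "a = 0") (simp_all add: lin_val_def sum_distrib_left mult.assoc)

lemma lin_val_zero [simp]: "lin_val \<beta> (\<lambda>_. 0) = 0"
  by (simp add: lin_val_def)

lemma lin_val_diff:
  assumes "finite {s. f s \<noteq> 0}" "finite {s. g s \<noteq> 0}"
  shows "lin_val \<beta> (\<lambda>s. f s - g s) = lin_val \<beta> f - lin_val \<beta> g"
  using lin_val_add[OF assms(1), of "\<lambda>s. -1 * g s" \<beta>] lin_val_scale[of \<beta> "-1" g] assms(2) by simp

lemma lin_val_single [simp]: "lin_val \<beta> (single s) = \<beta> s"
  using lin_val_eq[of "{s}" "single s" \<beta>] by (simp add: single_def)

lemma linear_functional_lin_val: "linear_functional (free_space S) (lin_val \<beta>)"
  by (simp add: linear_functional_def lin_val_add free_space_finite lin_val_scale)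

lemma finite_support_single: "finite {t. single s t \<noteq> (0::'k::field)}"
  by (simp add: single_def)

lemma lin_val_swap:
  assumes "finite {s. f s \<noteq> 0}" "finite {t. g t \<noteq> 0}"
  shows "lin_val (\<lambda>s. lin_val (\<beta> s) g) f = lin_val (\<lambda>t. lin_val (\<lambda>s. \<beta> s t) f) g"
  unfolding lin_val_def sum_distrib_left by (subst sum.swap) (simp add: mult.left_commute)

lemma lin_val_add_right: "lin_val (\<lambda>s. \<beta> s + \<gamma> s) f = lin_val \<beta> f + lin_val \<gamma> f"
  by (simp add: lin_val_def distrib_left sum.distrib)

lemma lin_val_scale_right: "lin_val (\<lambda>s. a * \<beta> s) f = a * lin_val \<beta> f"
  by (simp add: lin_val_def sum_distrib_left mult.left_commute)

section \<open>Tensor products by generators and relations\<close>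

definition tensor_generators ::
  "('k::field, 'v, 'r) module_scheme \<Rightarrow> ('k, 'w, 's) module_scheme \<Rightarrow> ('v \<times> 'w \<Rightarrow> 'k) set" where
  "tensor_generators V W =
      ({(\<lambda>z. single (v \<oplus>\<^bsub>V\<^esub> v', w) z - single (v, w) z - single (v', w) z) | v v' w.
          v \<in> carrier V \<and> v' \<in> carrier V \<and> w \<in> carrier W} \<union>
       {(\<lambda>z. single (v, w \<oplus>\<^bsub>W\<^esub> w') z - single (v, w) z - single (v, w') z) | v w w'.
          v \<in> carrier V \<and> w \<in> carrier W \<and> w' \<in> carrier W} \<union>
       {(\<lambda>z. single (a \<odot>\<^bsub>V\<^esub> v, w) z - a * single (v, w) z) | a v w.
          v \<in> carrier V \<and> w \<in> carrier W} \<union>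
       {(\<lambda>z. single (v, a \<odot>\<^bsub>W\<^esub> w) z - a * single (v, w) z) | a v w.
          v \<in> carrier V \<and> w \<in> carrier W})"

text \<open>Closure under the operations places the relations in the free space; it is what has to
  be checked for the graded pieces of U.\<close>

locale tensor_pair =
  fixes V :: "('k::field, 'v, 'r) module_scheme" and W :: "('k, 'w, 's) module_scheme"
  assumes V_add: "\<And>v v'. v \<in> carrier V \<Longrightarrow> v' \<in> carrier V \<Longrightarrow> v \<oplus>\<^bsub>V\<^esub> v' \<in> carrier V"
    and V_smult: "\<And>a v. v \<in> carrier V \<Longrightarrow> a \<odot>\<^bsub>V\<^esub> v \<in> carrier V"
    and W_add: "\<And>w w'. w \<in> carrier W \<Longrightarrow> w' \<in> carrier W \<Longrightarrow> w \<oplus>\<^bsub>W\<^esub> w' \<in> carrier W"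
    and W_smult: "\<And>a w. w \<in> carrier W \<Longrightarrow> a \<odot>\<^bsub>W\<^esub> w \<in> carrier W"
begin

abbreviation F where "F \<equiv> free_space (carrier V \<times> carrier W) :: ('k, 'v \<times> 'w \<Rightarrow> 'k) module"

abbreviation R where "R \<equiv> tensor_relations V W"

lemma tensor_generators_subset: "tensor_generators V W \<subseteq> carrier F"
proof -
  note d = function_space_diff_closed[OF function_space_free_space[of "carrier V \<times> carrier W"]]
    and s = single_in_free_space[of _ "carrier V \<times> carrier W"]
    and a = function_spaceD(6)[OF function_space_free_space[of "carrier V \<times> carrier W"]]
  show ?thesis
    unfolding tensor_generators_def
    by (auto intro!: d s a V_add V_smult W_add W_smult)
qed

lemma R_eq_span: "R = module.span class_ring F (tensor_generators V W)"
  by (simp only: tensor_relations_def tensor_generators_def)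

lemma R_submodule: "submodule class_ring R F"
proof -
  interpret F: vectorspace class_ring F by (rule function_space_is_space[OF function_space_free_space])
  show ?thesis unfolding R_eq_span by (rule F.span_is_submodule[OF tensor_generators_subset])
qed

lemma generators_in_R: "g \<in> tensor_generators V W \<Longrightarrow> g \<in> R"
proof -
  interpret F: vectorspace class_ring F by (rule function_space_is_space[OF function_space_free_space])
  show "g \<in> tensor_generators V W \<Longrightarrow> g \<in> R"
    unfolding R_eq_span using F.in_own_span[OF tensor_generators_subset] by blast
qed

lemma R_minimal: "submodule class_ring N F \<Longrightarrow> tensor_generators V W \<subseteq> N \<Longrightarrow> R \<subseteq> N"
proof -
  interpret F: vectorspace class_ring F by (rule function_space_is_space[OF function_space_free_space])
  show "submodule class_ring N F \<Longrightarrow> tensor_generators V W \<subseteq> N \<Longrightarrow> R \<subseteq> N"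
    unfolding R_eq_span by (rule F.span_is_subset)
qed

sublocale T: space_quotient F R
  by (intro space_quotient.intro function_space_is_space function_space_free_space R_submodule)

lemma tensor_eq: "tensor V W = quot_module F R"
  by (simp add: tensor_def)

lemma R_function_space:
  shows "(\<lambda>_. 0) \<in> R" "\<And>f g. f \<in> R \<Longrightarrow> g \<in> R \<Longrightarrow> (\<lambda>s. f s + g s) \<in> R"
    "\<And>a f. f \<in> R \<Longrightarrow> (\<lambda>s. a * f s) \<in> R" "\<And>f g. f \<in> R \<Longrightarrow> g \<in> R \<Longrightarrow> (\<lambda>s. f s - g s) \<in> R"
proof -
  show z: "(\<lambda>_. 0) \<in> R" using T.W_zero by simp
  show a: "\<And>f g. f \<in> R \<Longrightarrow> g \<in> R \<Longrightarrow> (\<lambda>s. f s + g s) \<in> R" using T.W_add by simp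
  show s: "\<And>a f. f \<in> R \<Longrightarrow> (\<lambda>s. a * f s) \<in> R" using T.W_smult by simp
  show "(\<lambda>s. f s - g s) \<in> R" if "f \<in> R" "g \<in> R" for f g
    using a[OF that(1) s[OF that(2), of "-1"]] by simp
qed

text \<open>The universal property, relative to a subspace N of the target: if T is bilinear modulo
  N, its linear extension sends relations into N. With N the relations of another tensor product
  this yields maps of tensor products, with N = 0 it yields functionals.\<close>

lemma lin_val_R:
  fixes T :: "'v \<times> 'w \<Rightarrow> 't \<Rightarrow> 'k"
  assumes f: "f \<in> R"
    and N: "(\<lambda>_. 0) \<in> N" "\<And>f g. f \<in> N \<Longrightarrow> g \<in> N \<Longrightarrow> (\<lambda>s. f s + g s) \<in> N"
      "\<And>a f. f \<in> N \<Longrightarrow> (\<lambda>s. a * f s) \<in> N"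
    and T: "\<And>v v' w. v \<in> carrier V \<Longrightarrow> v' \<in> carrier V \<Longrightarrow> w \<in> carrier W \<Longrightarrow>
        (\<lambda>z. T (v \<oplus>\<^bsub>V\<^esub> v', w) z - T (v, w) z - T (v', w) z) \<in> N"
      "\<And>v w w'. v \<in> carrier V \<Longrightarrow> w \<in> carrier W \<Longrightarrow> w' \<in> carrier W \<Longrightarrow>
        (\<lambda>z. T (v, w \<oplus>\<^bsub>W\<^esub> w') z - T (v, w) z - T (v, w') z) \<in> N"
      "\<And>a v w. v \<in> carrier V \<Longrightarrow> w \<in> carrier W \<Longrightarrow>
        (\<lambda>z. T (a \<odot>\<^bsub>V\<^esub> v, w) z - a * T (v, w) z) \<in> N"
      "\<And>a v w. v \<in> carrier V \<Longrightarrow> w \<in> carrier W \<Longrightarrow>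
        (\<lambda>z. T (v, a \<odot>\<^bsub>W\<^esub> w) z - a * T (v, w) z) \<in> N"
  shows "(\<lambda>z. lin_val (\<lambda>y. T y z) f) \<in> N"
proof -
  let ?M = "{f \<in> carrier F. (\<lambda>z. lin_val (\<lambda>y. T y z) f) \<in> N}"
  have three: "lin_val \<beta> (\<lambda>z. single x z - single y z - single y' z) = \<beta> x - \<beta> y - \<beta> y'"
    and two: "lin_val \<beta> (\<lambda>z. single x z - a * single y z) = \<beta> x - a * \<beta> y"
    for \<beta> :: "'v \<times> 'w \<Rightarrow> 'k" and x y y' a
  proof -
    have "finite {t. single x t - single y t \<noteq> (0::'k)}"
      by (rule finite_subset[of _ "{x, y}"]) (auto simp: single_def)
    then show "lin_val \<beta> (\<lambda>z. single x z - single y z - single y' z) = \<beta> x - \<beta> y - \<beta> y'"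
      by (subst lin_val_diff) (simp_all only: finite_support_single lin_val_diff lin_val_single)
    have "finite {t. a * single y t \<noteq> (0::'k)}"
      by (rule finite_subset[of _ "{y}"]) (auto simp: single_def)
    then show "lin_val \<beta> (\<lambda>z. single x z - a * single y z) = \<beta> x - a * \<beta> y"
      by (subst lin_val_diff) (simp_all only: finite_support_single lin_val_scale lin_val_single)
  qed
  have "submodule class_ring ?M F"
    by (rule function_space_submodule[OF function_space_free_space])
      (use N function_spaceD(4-6)[OF function_space_free_space[of "carrier V \<times> carrier W"]] in
        \<open>auto simp: lin_val_add lin_val_scale free_space_finite\<close>)
  moreover have "tensor_generators V W \<subseteq> ?M"
  proof
    fix g assume g: "g \<in> tensor_generators V W"
    then have "(\<lambda>z. lin_val (\<lambda>y. T y z) g) \<in> N"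
      unfolding tensor_generators_def
      by (auto simp: two three T)
    then show "g \<in> ?M" using g tensor_generators_subset by blast
  qed
  ultimately have "R \<subseteq> ?M" by (rule R_minimal)
  then show ?thesis using f by blast
qed

lemma lin_val_R_eq_0:
  assumes "f \<in> R"
    and "\<And>v v' w. v \<in> carrier V \<Longrightarrow> v' \<in> carrier V \<Longrightarrow> w \<in> carrier W \<Longrightarrow>
        \<beta> (v \<oplus>\<^bsub>V\<^esub> v', w) = \<beta> (v, w) + \<beta> (v', w)"
      "\<And>v w w'. v \<in> carrier V \<Longrightarrow> w \<in> carrier W \<Longrightarrow> w' \<in> carrier W \<Longrightarrow>
        \<beta> (v, w \<oplus>\<^bsub>W\<^esub> w') = \<beta> (v, w) + \<beta> (v, w')"
      "\<And>a v w. v \<in> carrier V \<Longrightarrow> w \<in> carrier W \<Longrightarrow> \<beta> (a \<odot>\<^bsub>V\<^esub> v, w) = a * \<beta> (v, w)"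
      "\<And>a v w. v \<in> carrier V \<Longrightarrow> w \<in> carrier W \<Longrightarrow> \<beta> (v, a \<odot>\<^bsub>W\<^esub> w) = a * \<beta> (v, w)"
  shows "lin_val \<beta> f = 0"
  \<comment> \<open>A functional is the case of a target indexed by one point and N = 0.\<close>
  using lin_val_R[of f "{\<lambda>_::unit. 0}" "\<lambda>y _. \<beta> y"] assms by (auto simp: fun_eq_iff)

end

section \<open>Matrix representations and cyclic words\<close>

text \<open>Square matrices are functions of two indices, of which only those in \<open>I\<close> matter.\<close>

definition mat_mul :: "'i set \<Rightarrow> ('i \<Rightarrow> 'i \<Rightarrow> 'k::comm_ring_1) \<Rightarrow> ('i \<Rightarrow> 'i \<Rightarrow> 'k) \<Rightarrow> 'i \<Rightarrow> 'i \<Rightarrow> 'k" where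
  "mat_mul I A B s t = (\<Sum>u\<in>I. A s u * B u t)"

lemma mat_mul_assoc:
  "mat_mul I (mat_mul I A B) C s t = mat_mul I A (mat_mul I B C) s t"
  unfolding mat_mul_def sum_distrib_left sum_distrib_right
  by (subst sum.swap) (simp add: mult.assoc)

lemma mat_mul_cong:
  "(\<And>u. u \<in> I \<Longrightarrow> A s u = A' s u) \<Longrightarrow> (\<And>u. u \<in> I \<Longrightarrow> B u t = B' u t) \<Longrightarrow> mat_mul I A B s t = mat_mul I A' B' s t"
  by (simp add: mat_mul_def)

definition mat_trace :: "'i set \<Rightarrow> ('i \<Rightarrow> 'i \<Rightarrow> 'k::comm_ring_1) \<Rightarrow> 'k" where
  "mat_trace I A = (\<Sum>s\<in>I. A s s)"

lemma mat_trace_commute: "mat_trace I (mat_mul I A B) = mat_trace I (mat_mul I B A)"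
  unfolding mat_trace_def mat_mul_def by (subst sum.swap) (simp add: mult.commute)

fun word_mat :: "'i set \<Rightarrow> ('l \<Rightarrow> 'i \<Rightarrow> 'i \<Rightarrow> 'k::comm_ring_1) \<Rightarrow> 'l list \<Rightarrow> 'i \<Rightarrow> 'i \<Rightarrow> 'k" where
  "word_mat I A [] = (\<lambda>s t. if s = t then 1 else 0)"
| "word_mat I A (i # w) = mat_mul I (A i) (word_mat I A w)"

text \<open>The matrix of the empty word is the identity on all indices, but multiplication sums
  over I only, so it acts as the identity just on rows s in I.\<close>

lemma word_mat_append:
  assumes "finite I" "s \<in> I"
  shows "word_mat I A (v @ w) s t = mat_mul I (word_mat I A v) (word_mat I A w) s t"
  using assms(2)
proof (induction v arbitrary: s)
  case Nil
  have "(\<Sum>u\<in>I. (if s = u then 1 else 0) * word_mat I A w u t) =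
      (\<Sum>u\<in>I. if s = u then word_mat I A w u t else 0)"
    by (intro sum.cong) auto
  then show ?case using assms(1) Nil by (simp add: mat_mul_def)
next
  case (Cons i v)
  then show ?case
    by (simp add: mat_mul_assoc) (intro mat_mul_cong refl, simp)
qed

lemma mat_trace_word_commute:
  assumes "finite I"
  shows "mat_trace I (word_mat I A (v @ w)) = mat_trace I (word_mat I A (w @ v))"
proof -
  have "mat_trace I (word_mat I A (v @ w)) = mat_trace I (mat_mul I (word_mat I A v) (word_mat I A w))" for v w
    unfolding mat_trace_def using word_mat_append[OF assms] by (intro sum.cong) auto
  then show ?thesis by (simp add: mat_trace_commute)
qed

text \<open>The matrices \<open>P\<close> and \<open>Q\<close> of a binary word \<open>g\<close>: the cyclic shift of length \<open>length g\<close>,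
  with the arrow out of \<open>j\<close> labelled by the \<open>j\<close>-th letter, is \<open>P + Q\<close>. The trace of a product
  of copies of \<open>P\<close> and \<open>Q\<close> counts the occurrences of the corresponding cyclic word.\<close>

definition shift_mat :: "bool list \<Rightarrow> bool \<Rightarrow> nat \<Rightarrow> nat \<Rightarrow> 'k::comm_ring_1" where
  "shift_mat g b j j' = (if j' = Suc j mod length g \<and> g ! j = b then 1 else 0)"

text \<open>Two diagonal copies of A: doubling the index set makes room for a square root of an
  arbitrary matrix.\<close>

definition blow_up :: "(nat \<Rightarrow> nat \<Rightarrow> 'k) \<Rightarrow> nat \<times> bool \<Rightarrow> nat \<times> bool \<Rightarrow> 'k::comm_ring_1" where
  "blow_up A s t = (if snd s = snd t then A (fst s) (fst t) else 0)"

text \<open>The block matrix with rows \<open>(0, 1)\<close> and \<open>(S, 0)\<close>, whose square is \<open>S\<close> in both diagonal blocks.\<close>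

definition root_mat :: "(nat \<Rightarrow> nat \<Rightarrow> 'k) \<Rightarrow> nat \<times> bool \<Rightarrow> nat \<times> bool \<Rightarrow> 'k::comm_ring_1" where
  "root_mat S s t =
     (if snd s = snd t then 0 else if snd s then S (fst s) (fst t)
      else if fst s = fst t then 1 else 0)"

abbreviation idx :: "nat \<Rightarrow> (nat \<times> bool) set" where
  "idx r \<equiv> {..<r} \<times> UNIV"

lemma sum_idx: "(\<Sum>u\<in>idx r. f u) = (\<Sum>j<r. f (j, True) + f (j, False))"
proof -
  have "(\<Sum>u\<in>idx r. f u) = (\<Sum>j<r. \<Sum>b\<in>UNIV. f (j, b))"
    by (simp add: sum.cartesian_product)
  then show ?thesis by (simp add: UNIV_bool add.commute)
qed

lemma mat_mul_blow_up:
  "mat_mul (idx r) (blow_up A) (blow_up B) s t = blow_up (mat_mul {..<r} A B) s t"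
  unfolding mat_mul_def sum_idx
  by (cases "snd s"; cases "snd t") (simp_all add: blow_up_def)

lemma mat_mul_root_mat:
  assumes "s \<in> idx r" "t \<in> idx r"
  shows "mat_mul (idx r) (root_mat S) (root_mat S) s t = blow_up S s t"
proof -
  have "(\<Sum>j<r. S (fst s) j * (if j = fst t then 1 else 0)) = S (fst s) (fst t)"
    "(\<Sum>j<r. (if fst s = j then 1 else 0) * S j (fst t)) = S (fst s) (fst t)"
    using assms by (auto simp: if_distrib[of "\<lambda>x. x * _"] if_distrib[of "\<lambda>x. _ * x"] cong: if_cong)
  then show ?thesis
    unfolding mat_mul_def sum_idx
    by (cases "snd s"; cases "snd t") (simp_all add: root_mat_def blow_up_def)
qed

lemma word_mat_blow_up:
  "word_mat (idx r) (\<lambda>l. blow_up (A l)) w s t = blow_up (word_mat {..<r} A w) s t"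
proof (induction w arbitrary: s)
  case Nil
  then show ?case by (auto simp: blow_up_def prod_eq_iff)
next
  case (Cons l w)
  have "word_mat (idx r) (\<lambda>l. blow_up (A l)) (l # w) s t =
      mat_mul (idx r) (blow_up (A l)) (blow_up (word_mat {..<r} A w)) s t"
    by (simp, intro mat_mul_cong refl Cons.IH)
  then show ?case by (simp add: mat_mul_blow_up)
qed

text \<open>Exactly one arrow of the labelled cycle leaves each point, so row j has at most one
  nonzero entry; it is present when g, read cyclically from j, spells h.\<close>

lemma word_mat_shift:
  assumes "j < length g"
  shows "word_mat {..<length g} (shift_mat g) h j j' =
    (if j' = (j + length h) mod length g \<and> (\<forall>i<length h. g ! ((j + i) mod length g) = h ! i)
     then 1 else 0 :: 'k::comm_ring_1)"
  using assms
proof (induction h arbitrary: j)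
  case Nil
  then show ?case by auto
next
  case (Cons b h)
  let ?r = "length g" and ?W = "word_mat {..<length g} (shift_mat g) h :: nat \<Rightarrow> nat \<Rightarrow> 'k"
  let ?j = "Suc j mod ?r"
  have j: "?j < ?r" using Cons.prems by (intro mod_less_divisor) auto
  have shift: "(?j + i) mod ?r = (j + Suc i) mod ?r" for i
    by (simp add: mod_simps)
  have "word_mat {..<?r} (shift_mat g) (b # h) j j' =
      (\<Sum>u<?r. if u = ?j then (if g ! j = b then ?W u j' else 0) else 0)"
    unfolding word_mat.simps mat_mul_def by (intro sum.cong refl) (simp add: shift_mat_def)
  also have "\<dots> = (if g ! j = b then ?W ?j j' else 0)"
    using j by simp
  also have "?W ?j j' = (if j' = (j + Suc (length h)) mod ?r \<and>
      (\<forall>i<length h. g ! ((j + Suc i) mod ?r) = h ! i) then 1 else 0)"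
    unfolding Cons.IH[OF j] shift ..
  also have "(if g ! j = b then \<dots> else 0) = (if j' = (j + length (b # h)) mod ?r \<and>
      (\<forall>i<length (b # h). g ! ((j + i) mod ?r) = (b # h) ! i) then 1 else 0)"
  proof -
    have "(\<forall>i<length (b # h). g ! ((j + i) mod ?r) = (b # h) ! i) \<longleftrightarrow>
      g ! j = b \<and> (\<forall>i<length h. g ! ((j + Suc i) mod ?r) = h ! i)"
      using Cons.prems unfolding length_Cons All_less_Suc2 by simp
    then show ?thesis by simp
  qed
  finally show ?case .
qed

text \<open>A word as long as the cycle ends where it starts, so the diagonal entry at j only asks
  whether g read from j is h. The factor 2 comes from the two diagonal copies.\<close>

lemma mat_trace_shift:
  assumes "length h = length g"
  shows "mat_trace (idx (length g)) (word_mat (idx (length g)) (\<lambda>b. blow_up (shift_mat g b)) h) =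
    (of_nat (2 * card {j. j < length g \<and> rotate j g = h}) :: 'k::comm_ring_1)"
proof -
  let ?r = "length g"
  have "rotate j g = h \<longleftrightarrow> (\<forall>i<?r. g ! ((j + i) mod ?r) = h ! i)" for j
    unfolding list_eq_iff_nth_eq using assms by (simp add: nth_rotate)
  then have "word_mat {..<?r} (shift_mat g) h j j = (if rotate j g = h then 1 else 0 :: 'k)" if "j < ?r" for j
    using that assms by (simp add: word_mat_shift)
  then have "mat_trace (idx ?r) (word_mat (idx ?r) (\<lambda>b. blow_up (shift_mat g b)) h) =
      (\<Sum>j<?r. (if rotate j g = h then 1 else 0) + (if rotate j g = h then 1 else 0 :: 'k))"
    unfolding mat_trace_def sum_idx word_mat_blow_up by (intro sum.cong refl) (simp add: blow_up_def)
  also have "\<dots> = 2 * (\<Sum>j<?r. if rotate j g = h then 1 else 0)"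
    by (simp only: sum.distrib mult_2)
  also have "(\<Sum>j<?r. if rotate j g = h then 1 else 0 :: 'k) = of_nat (card ({..<?r} \<inter> {j. rotate j g = h}))"
    by (simp add: sum.If_cases)
  also have "{..<?r} \<inter> {j. rotate j g = h} = {j. j < ?r \<and> rotate j g = h}" by auto
  finally show ?thesis by (simp only: of_nat_mult of_nat_numeral)
qed

section \<open>Matrices that satisfy the quadratic relation\<close>

definition bil :: "nat \<Rightarrow> (nat \<Rightarrow> nat \<Rightarrow> 'k) \<Rightarrow> (nat \<Rightarrow> 'k) \<Rightarrow> (nat \<Rightarrow> 'k) \<Rightarrow> 'k::comm_ring_1" where
  "bil m \<omega> x y = (\<Sum>i<m. \<Sum>j<m. \<omega> i j * x i * y j)"

definition dot :: "nat \<Rightarrow> (nat \<Rightarrow> 'k) \<Rightarrow> (nat \<Rightarrow> 'k) \<Rightarrow> 'k::comm_ring_1" where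
  "dot m x y = (\<Sum>i<m. x i * y i)"

text \<open>The matrices that represent the generators of \<open>U\<close>. Here \<open>v\<close> and \<open>z\<close> are linear forms on
  the span of the generators, and \<open>q\<close> is chosen such that the square of the root matrix cancels
  the quadratic form on the span of \<open>P\<close> and \<open>Q\<close>.\<close>

definition gen_mat ::
  "bool list \<Rightarrow> (bool \<Rightarrow> nat \<Rightarrow> 'k) \<Rightarrow> (nat \<Rightarrow> 'k) \<Rightarrow> (bool \<Rightarrow> bool \<Rightarrow> 'k) \<Rightarrow> nat \<Rightarrow>
    nat \<times> bool \<Rightarrow> nat \<times> bool \<Rightarrow> 'k::comm_ring_1" where
  "gen_mat g v z q i s t =
     v True i * blow_up (shift_mat g True) s t + v False i * blow_up (shift_mat g False) s t +
     z i * root_mat (\<lambda>j j'. \<Sum>b\<in>UNIV. \<Sum>b'\<in>UNIV.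
       q b b' * mat_mul {..<length g} (shift_mat g b) (shift_mat g b') j j') s t"

lemma bil_expand:
  "(\<Sum>i<m. \<Sum>j<m. \<omega> i j * ((a i * x + b i * y + z i * w) * (a j * x' + b j * y' + z j * w'))) =
    bil m \<omega> a a * (x * x') + bil m \<omega> a b * (x * y') + bil m \<omega> a z * (x * w') +
    bil m \<omega> b a * (y * x') + bil m \<omega> b b * (y * y') + bil m \<omega> b z * (y * w') +
    bil m \<omega> z a * (w * x') + bil m \<omega> z b * (w * y') + bil m \<omega> z z * (w * w')"
proof -
  have *: "\<omega> i j * ((a i * x + b i * y + z i * w) * (a j * x' + b j * y' + z j * w')) =
    \<omega> i j * a i * a j * (x * x') + \<omega> i j * a i * b j * (x * y') + \<omega> i j * a i * z j * (x * w') +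
    \<omega> i j * b i * a j * (y * x') + \<omega> i j * b i * b j * (y * y') + \<omega> i j * b i * z j * (y * w') +
    \<omega> i j * z i * a j * (w * x') + \<omega> i j * z i * b j * (w * y') + \<omega> i j * z i * z j * (w * w')" for i j
    by (simp add: algebra_simps)
  show ?thesis
    by (simp only: * sum.distrib bil_def sum_distrib_right)
qed

text \<open>After expansion in the three matrices, products of the root matrix with P or Q carry a
  coefficient \<omega>(v b, z) or \<omega>(z, v b) and vanish. The square of the root matrix is the
  combination of products of P and Q with coefficients \<open>q b b'\<close>, which cancels the
  remaining part.\<close>

lemma gen_mat_relation:
  fixes \<omega> :: "nat \<Rightarrow> nat \<Rightarrow> 'k::comm_ring_1"
  assumes orth: "\<And>b. bil m \<omega> (v b) z = 0" "\<And>b. bil m \<omega> z (v b) = 0"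
    and q: "\<And>b b'. bil m \<omega> (v b) (v b') + bil m \<omega> z z * q b b' = 0"
    and st: "s \<in> idx (length g)" "t \<in> idx (length g)"
  shows "(\<Sum>i<m. \<Sum>j<m. \<omega> i j * mat_mul (idx (length g)) (gen_mat g v z q i) (gen_mat g v z q j) s t) = 0"
proof -
  let ?I = "idx (length g)" and ?P = "\<lambda>b. shift_mat g b :: nat \<Rightarrow> nat \<Rightarrow> 'k"
  let ?X = "\<lambda>b. blow_up (?P b)"
  let ?S = "\<lambda>j j'. \<Sum>b\<in>UNIV. \<Sum>b'\<in>UNIV. q b b' * mat_mul {..<length g} (?P b) (?P b') j j'"
  let ?J = "root_mat ?S"
  have "(\<Sum>i<m. \<Sum>j<m. \<omega> i j * mat_mul ?I (gen_mat g v z q i) (gen_mat g v z q j) s t) =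
    (\<Sum>u\<in>?I. \<Sum>i<m. \<Sum>j<m. \<omega> i j * (gen_mat g v z q i s u * gen_mat g v z q j u t))"
  proof -
    have "(\<Sum>i<m. \<Sum>j<m. \<Sum>u\<in>?I. f i j u) = (\<Sum>u\<in>?I. \<Sum>i<m. \<Sum>j<m. f i j u)"
      for f :: "nat \<Rightarrow> nat \<Rightarrow> nat \<times> bool \<Rightarrow> 'k"
    proof -
      have "(\<Sum>i<m. \<Sum>j<m. \<Sum>u\<in>?I. f i j u) = (\<Sum>i<m. \<Sum>u\<in>?I. \<Sum>j<m. f i j u)"
        by (intro sum.cong refl sum.swap)
      also have "\<dots> = (\<Sum>u\<in>?I. \<Sum>i<m. \<Sum>j<m. f i j u)" by (rule sum.swap)
      finally show ?thesis .
    qed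
    then show ?thesis unfolding mat_mul_def sum_distrib_left .
  qed
  also have "\<dots> = (\<Sum>u\<in>?I.
      bil m \<omega> (v True) (v True) * (?X True s u * ?X True u t) +
      bil m \<omega> (v True) (v False) * (?X True s u * ?X False u t) +
      bil m \<omega> (v False) (v True) * (?X False s u * ?X True u t) +
      bil m \<omega> (v False) (v False) * (?X False s u * ?X False u t) +
      bil m \<omega> z z * (?J s u * ?J u t))"
    unfolding gen_mat_def bil_expand by (simp add: orth)
  also have "\<dots> =
      bil m \<omega> (v True) (v True) * mat_mul ?I (?X True) (?X True) s t +
      bil m \<omega> (v True) (v False) * mat_mul ?I (?X True) (?X False) s t +
      bil m \<omega> (v False) (v True) * mat_mul ?I (?X False) (?X True) s t +
      bil m \<omega> (v False) (v False) * mat_mul ?I (?X False) (?X False) s t +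
      bil m \<omega> z z * mat_mul ?I ?J ?J s t"
    by (simp add: sum.distrib mat_mul_def sum_distrib_left)
  also have "mat_mul ?I ?J ?J s t = (\<Sum>b\<in>UNIV. \<Sum>b'\<in>UNIV. q b b' * mat_mul ?I (?X b) (?X b') s t)"
    unfolding mat_mul_root_mat[OF st] mat_mul_blow_up by (simp add: blow_up_def)
  finally have "(\<Sum>i<m. \<Sum>j<m. \<omega> i j * mat_mul ?I (gen_mat g v z q i) (gen_mat g v z q j) s t) =
    (\<Sum>b\<in>UNIV. \<Sum>b'\<in>UNIV. (bil m \<omega> (v b) (v b') + bil m \<omega> z z * q b b') * mat_mul ?I (?X b) (?X b') s t)"
    by (simp add: UNIV_bool algebra_simps)
  then show ?thesis by (simp add: q)
qed

lemma gen_mat_dual: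
  assumes "\<And>b b'. dot m (\<xi> b) (v b') = (if b = b' then 1 else 0)" "\<And>b. dot m (\<xi> b) z = 0"
  shows "(\<Sum>i<m. \<xi> b i * gen_mat g v z q i s t) = blow_up (shift_mat g b) s t"
proof -
  let ?J = "root_mat (\<lambda>j j'. \<Sum>b\<in>UNIV. \<Sum>b'\<in>UNIV.
       q b b' * mat_mul {..<length g} (shift_mat g b) (shift_mat g b') j j') s t"
  have "(\<Sum>i<m. \<xi> b i * gen_mat g v z q i s t) =
    dot m (\<xi> b) (v True) * blow_up (shift_mat g True) s t +
    dot m (\<xi> b) (v False) * blow_up (shift_mat g False) s t + dot m (\<xi> b) z * ?J"
    unfolding dot_def gen_mat_def sum_distrib_right sum.distrib[symmetric]
    by (intro sum.cong refl) (simp add: algebra_simps)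
  then show ?thesis by (cases b) (simp_all add: assms)
qed

definition unit_fun :: "nat \<Rightarrow> nat \<Rightarrow> 'k::comm_ring_1" where
  "unit_fun i j = (if i = j then 1 else 0)"

lemma bil_add_left: "bil m \<omega> (\<lambda>i. x i + a * y i) z = bil m \<omega> x z + a * bil m \<omega> y z"
  unfolding bil_def sum_distrib_left sum.distrib[symmetric]
  by (intro sum.cong refl) (simp add: algebra_simps)

lemma bil_add_right: "bil m \<omega> z (\<lambda>i. x i + a * y i) = bil m \<omega> z x + a * bil m \<omega> z y"
  unfolding bil_def sum_distrib_left sum.distrib[symmetric]
  by (intro sum.cong refl) (simp add: algebra_simps)

lemma bil_zero: "bil m \<omega> (\<lambda>_. 0) z = 0" "bil m \<omega> z (\<lambda>_. 0) = 0"
  by (simp_all add: bil_def)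

lemma bil_unit:
  assumes "i < m" "j < m"
  shows "bil m \<omega> (unit_fun i) (unit_fun j) = \<omega> i j"
proof -
  have "\<omega> k l * unit_fun i k * unit_fun j l = (if k = i then if l = j then \<omega> i j else 0 else 0)" for k l
    by (simp add: unit_fun_def)
  then have "bil m \<omega> (unit_fun i) (unit_fun j) = (\<Sum>k<m. \<Sum>l<m. if k = i then if l = j then \<omega> i j else 0 else 0)"
    by (simp only: bil_def)
  also have "\<dots> = (\<Sum>k<m. if k = i then \<Sum>l<m. if l = j then \<omega> i j else 0 else 0)"
    by (intro sum.cong refl) (simp split: if_splits)
  finally show ?thesis using assms by simp
qed

lemma bil_commute:
  assumes "\<And>i j. i < m \<Longrightarrow> j < m \<Longrightarrow> \<omega> i j = e * \<omega> j i"
  shows "bil m \<omega> x y = e * bil m \<omega> y x"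
proof -
  have "bil m \<omega> x y = (\<Sum>i<m. \<Sum>j<m. e * (\<omega> j i * y j * x i))"
    unfolding bil_def
  proof (intro sum.cong refl)
    fix i j assume "i \<in> {..<m}" "j \<in> {..<m}"
    then show "\<omega> i j * x i * y j = e * (\<omega> j i * y j * x i)"
      by (subst assms) (simp_all add: mult_ac)
  qed
  also have "\<dots> = (\<Sum>j<m. \<Sum>i<m. e * (\<omega> j i * y j * x i))" by (rule sum.swap)
  finally show ?thesis by (simp add: bil_def sum_distrib_left)
qed

lemma dot_add: "dot m z (\<lambda>i. x i + a * y i) = dot m z x + a * dot m z y"
  "dot m (\<lambda>i. x i + a * y i) z = dot m x z + a * dot m y z"
  unfolding dot_def sum_distrib_left sum.distrib[symmetric]
  by (intro sum.cong refl; simp add: algebra_simps)+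

lemma dot_zero: "dot m x (\<lambda>_. 0) = 0"
  by (simp add: dot_def)

lemma dot_unit:
  assumes "i < m"
  shows "dot m (unit_fun i) (unit_fun j) = (if i = j then 1 else 0)"
proof -
  have "dot m (unit_fun i) (unit_fun j) = (\<Sum>k<m. if k = i then if i = j then 1 else 0 else 0)"
    unfolding dot_def by (intro sum.cong refl) (auto simp: unit_fun_def)
  then show ?thesis using assms by simp
qed

text \<open>The data for the matrices above. The vectors \<open>\<xi> True\<close> and \<open>\<xi> False\<close> are two elements of the span
  of the generators whose matrices are \<open>P\<close> and \<open>Q\<close>.\<close>

definition splitting ::
  "nat \<Rightarrow> (nat \<Rightarrow> nat \<Rightarrow> 'k::field) \<Rightarrow> (bool \<Rightarrow> nat \<Rightarrow> 'k) \<Rightarrow> (nat \<Rightarrow> 'k) \<Rightarrow> (bool \<Rightarrow> bool \<Rightarrow> 'k) \<Rightarrow>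
    (bool \<Rightarrow> nat \<Rightarrow> 'k) \<Rightarrow> bool" where
  "splitting m \<omega> v z q \<xi> \<longleftrightarrow>
     (\<forall>b. bil m \<omega> (v b) z = 0 \<and> bil m \<omega> z (v b) = 0 \<and> dot m (\<xi> b) z = 0) \<and>
     (\<forall>b b'. bil m \<omega> (v b) (v b') + bil m \<omega> z z * q b b' = 0 \<and>
        dot m (\<xi> b) (v b') = (if b = b' then 1 else 0))"

text \<open>With z = 0 the root matrix drops out: the generators act through P and Q, and each
  product of these has a vanishing coefficient.\<close>

lemma splitting_isotropic:
  assumes "bil m \<omega> x x = 0" "bil m \<omega> x y = 0" "bil m \<omega> y x = 0" "bil m \<omega> y y = 0"
    and "dot m \<xi> x = 1" "dot m \<xi> y = 0" "dot m \<eta> x = 0" "dot m \<eta> y = 1"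
  shows "splitting m \<omega> (\<lambda>b. if b then x else y) (\<lambda>_. 0) (\<lambda>_ _. 0) (\<lambda>b. if b then \<xi> else \<eta>)"
  unfolding splitting_def using assms by (simp add: bil_zero dot_zero)

text \<open>One step of Gram-Schmidt: x and y are projected to the orthogonal complement of z. The
  test vectors \<xi> and \<eta> vanish on z, so their pairings survive the projection. Division by
  \<omega>(z, z) yields q.\<close>

lemma splitting_anisotropic:
  fixes \<omega> :: "nat \<Rightarrow> nat \<Rightarrow> 'k::field"
  assumes sym: "\<And>x y. bil m \<omega> x y = bil m \<omega> y x" and z: "bil m \<omega> z z \<noteq> 0"
    and \<xi>: "dot m \<xi> x = 1" "dot m \<xi> y = 0" "dot m \<xi> z = 0"
    and \<eta>: "dot m \<eta> x = 0" "dot m \<eta> y = 1" "dot m \<eta> z = 0"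
  shows "\<exists>v q. splitting m \<omega> v z q (\<lambda>b. if b then \<xi> else \<eta>)"
proof -
  define p where "p u = (\<lambda>i. u i + - (bil m \<omega> u z / bil m \<omega> z z) * z i)" for u
  define v where "v b = p (if b then x else y)" for b
  have p: "bil m \<omega> (p u) z = 0" for u
    unfolding p_def bil_add_left using z by simp
  then have p': "bil m \<omega> z (p u) = 0" for u
    by (subst sym)
  have d: "dot m t (p u) = dot m t u" if "dot m t z = 0" for t u
    unfolding p_def dot_add using that by simp
  have "splitting m \<omega> v z (\<lambda>b b'. - bil m \<omega> (v b) (v b') / bil m \<omega> z z) (\<lambda>b. if b then \<xi> else \<eta>)"
    unfolding splitting_def using \<xi> \<eta> z by (simp add: v_def p p' d)
  then show ?thesis by blast
qed

text \<open>Three coordinates suffice. In the skew case every vector is isotropic, and \<omega>(e_0,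
  -) has a kernel on the span of e_1 and e_2, which gives an isotropic plane. In the symmetric case,
  either some e_i or e_i + e_j is anisotropic, or \<omega> vanishes on the span of e_0, e_1,
  e_2.\<close>

lemma splitting_exists:
  fixes \<omega> :: "nat \<Rightarrow> nat \<Rightarrow> 'k::field_char_0"
  assumes m: "3 \<le> m" and \<omega>: "\<And>i j. i < m \<Longrightarrow> j < m \<Longrightarrow> \<omega> i j = (-1) ^ n * \<omega> j i"
  shows "\<exists>v z q \<xi>. splitting m \<omega> v z q \<xi>"
proof (cases "even n")
  case False
  have skew: "bil m \<omega> x y = - bil m \<omega> y x" for x y
  proof -
    have "bil m \<omega> x y = (-1) ^ n * bil m \<omega> y x" by (rule bil_commute[OF \<omega>])
    then show ?thesis using False by simp
  qed
  have diag: "bil m \<omega> x x = 0" for x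
  proof -
    have "2 * bil m \<omega> x x = 0" using skew[of x x] by (simp only: mult_2 eq_neg_iff_add_eq_0)
    then show ?thesis by simp
  qed
  show ?thesis
  proof (cases "\<omega> 0 2 = 0")
    case True
    have "bil m \<omega> (unit_fun 0) (unit_fun 2) = 0" using m True by (simp add: bil_unit)
    moreover from this have "bil m \<omega> (unit_fun 2) (unit_fun 0) = 0" by (subst skew) simp
    ultimately have "splitting m \<omega> (\<lambda>b. if b then unit_fun 0 else unit_fun 2) (\<lambda>_. 0) (\<lambda>_ _. 0)
        (\<lambda>b. if b then unit_fun 0 else unit_fun 2)"
      using m by (intro splitting_isotropic) (simp_all add: diag dot_unit)
    then show ?thesis by blast
  next
    case False
    \<comment> \<open>The coefficient solves \<omega>(e_0, e_1 + t e_2) = 0.\<close>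
    let ?y = "\<lambda>i. unit_fun 1 i + - (\<omega> 0 1 / \<omega> 0 2) * unit_fun 2 i"
    have "bil m \<omega> (unit_fun 0) ?y = 0"
      unfolding bil_add_right using m False by (simp add: bil_unit)
    moreover from this have "bil m \<omega> ?y (unit_fun 0) = 0" by (subst skew) (simp only: minus_zero)
    ultimately have "splitting m \<omega> (\<lambda>b. if b then unit_fun 0 else ?y) (\<lambda>_. 0) (\<lambda>_ _. 0)
        (\<lambda>b. if b then unit_fun 0 else unit_fun 1)"
      using m by (intro splitting_isotropic) (simp_all only: diag dot_add, simp_all add: dot_unit)
    then show ?thesis by blast
  qed
next
  case True
  have sym: "bil m \<omega> x y = bil m \<omega> y x" for x y
  proof -
    have "bil m \<omega> x y = (-1) ^ n * bil m \<omega> y x" by (rule bil_commute[OF \<omega>])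
    then show ?thesis using True by simp
  qed
  have third: "\<exists>j l. j < 3 \<and> l < 3 \<and> j \<noteq> i \<and> l \<noteq> i \<and> j \<noteq> l" if "i < (3::nat)" for i
    using that by (intro exI[of _ "(i + 1) mod 3"] exI[of _ "(i + 2) mod 3"]) presburger
  consider (a) i where "i < 3" "\<omega> i i \<noteq> 0"
    | (b) i j where "i < 3" "j < 3" "i \<noteq> j" "\<omega> i j \<noteq> 0" "\<omega> i i = 0" "\<omega> j j = 0"
    | (c) "\<And>i j. i < 3 \<Longrightarrow> j < 3 \<Longrightarrow> \<omega> i j = 0"
    by metis
  then show ?thesis
  proof cases
    case a
    obtain j l where jl: "j < 3" "l < 3" "j \<noteq> i" "l \<noteq> i" "j \<noteq> l" using third[OF a(1)] by blast
    have "\<exists>v q. splitting m \<omega> v (unit_fun i) q (\<lambda>b. if b then unit_fun j else unit_fun l)"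
      using m a jl by (intro splitting_anisotropic[OF sym, of _ _ "unit_fun j" "unit_fun l"]) (simp_all add: bil_unit dot_unit)
    then show ?thesis by blast
  next
    case b
    obtain l where l: "l < 3" "l \<noteq> i" "l \<noteq> j"
      using b third[OF b(1)] by metis
    \<comment> \<open>Polarisation: \<omega>(z, z) = 2 \<omega>(e_i, e_j) for z = e_i + e_j. The
      test vector e_j - e_i vanishes on z and is 1 on e_j.\<close>
    let ?z = "\<lambda>k. unit_fun i k + 1 * unit_fun j k" and ?\<xi> = "\<lambda>k. unit_fun j k + (-1) * unit_fun i k"
    have "bil m \<omega> ?z ?z = 2 * \<omega> i j"
      unfolding bil_add_left bil_add_right using m b sym[of "unit_fun j" "unit_fun i"] by (simp add: bil_unit)
    then have "bil m \<omega> ?z ?z \<noteq> 0" using b(4) by simp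
    then have "\<exists>v q. splitting m \<omega> v ?z q (\<lambda>b. if b then ?\<xi> else unit_fun l)"
      by (rule splitting_anisotropic[OF sym, of _ _ "unit_fun j" "unit_fun l"])
        (use m b l in \<open>simp_all only: dot_add, simp_all add: dot_unit\<close>)
    then show ?thesis by blast
  next
    case c
    have "splitting m \<omega> (\<lambda>b. if b then unit_fun 0 else unit_fun 1) (\<lambda>_. 0) (\<lambda>_ _. 0)
        (\<lambda>b. if b then unit_fun 0 else unit_fun 1)"
      using m c by (intro splitting_isotropic) (simp_all add: bil_unit dot_unit)
    then show ?thesis by blast
  qed
qed

text \<open>One word is chosen from each rotation class. A class has at most r members, so the 2^r
  words force at least 2^r / r classes.\<close>

lemma necklaces:
  assumes "0 < r"
  shows "\<exists>\<Gamma> :: bool list set. finite \<Gamma> \<and> (\<forall>g \<in> \<Gamma>. length g = r) \<and>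
    (\<forall>g \<in> \<Gamma>. \<forall>h \<in> \<Gamma>. \<forall>j. rotate j g = h \<longrightarrow> g = h) \<and> 2 ^ r \<le> r * card \<Gamma>"
proof -
  let ?L = "{g :: bool list. length g = r}"
  define rel where "rel g h \<longleftrightarrow> (\<exists>j. rotate j g = h)" for g h :: "bool list"
  have finL: "finite ?L" and cardL: "card ?L = 2 ^ r"
    using finite_lists_length_eq[of "UNIV :: bool set" r] card_lists_length_eq[of "UNIV :: bool set" r] by simp_all
  have inv: "\<exists>j. rotate j (rotate i g) = g" for i and g :: "bool list"
  proof (cases "g = []")
    case False
    \<comment> \<open>Rotation by a multiple of the length is the identity, so this amount undoes a
      rotation by i.\<close>
    then have "i * length g - i + i = i * length g" by (cases "length g") simp_all
    then have "rotate (i * length g - i) (rotate i g) = rotate (i * length g) g"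
      by (simp only: rotate_rotate)
    also have "\<dots> = g" by (simp add: rotate_id)
    finally show ?thesis by blast
  qed simp
  have refl: "rel g g" for g unfolding rel_def by (metis rotate0 id_apply)
  have sym: "rel h g" if "rel g h" for g h using that inv unfolding rel_def by blast
  have trans: "rel g k" if "rel g h" "rel h k" for g h k
    using that unfolding rel_def by (metis rotate_rotate)
  \<comment> \<open>The choice is made from the predicate \<open>rel g\<close> alone, which is the
    same for all members of a class; hence it is constant on classes.\<close>
  define rep where "rep g = (SOME h. rel g h)" for g
  have rep: "rel g (rep g)" for g unfolding rep_def using refl by (rule someI)
  have rep_eq: "rep g = rep h" if "rel g h" for g h
  proof -
    have "rel g = rel h" using that sym trans by blast
    then show ?thesis by (simp add: rep_def)
  qed
  let ?\<Gamma> = "rep ` ?L"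
  have "?L \<subseteq> (\<Union>g \<in> ?\<Gamma>. (\<lambda>j. rotate j g) ` {..<r})"
  proof
    fix h assume h: "h \<in> ?L"
    obtain j where "rotate j (rep h) = h" using sym[OF rep[of h]] unfolding rel_def by blast
    moreover have "length (rep h) = r" using rep[of h] h length_rotate unfolding rel_def by (metis mem_Collect_eq)
    ultimately have "rotate (j mod r) (rep h) = h" by (metis rotate_conv_mod)
    then show "h \<in> (\<Union>g \<in> ?\<Gamma>. (\<lambda>j. rotate j g) ` {..<r})" using h assms by (intro UN_I[of "rep h"] image_eqI[of _ _ "j mod r"]) auto
  qed
  then have "card ?L \<le> card (\<Union>g \<in> ?\<Gamma>. (\<lambda>j. rotate j g) ` {..<r})"
    using finL by (intro card_mono) auto
  also have "\<dots> \<le> (\<Sum>g\<in>?\<Gamma>. card ((\<lambda>j. rotate j g) ` {..<r}))"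
    using finL by (intro card_UN_le) auto
  also have "\<dots> \<le> (\<Sum>g\<in>?\<Gamma>. r)"
    by (intro sum_mono) (metis card_image_le card_lessThan finite_lessThan)
  finally have "2 ^ r \<le> r * card ?\<Gamma>" by (simp add: cardL mult.commute)
  moreover have "length g = r" if "g \<in> ?\<Gamma>" for g
    using that rep unfolding rel_def by (metis (mono_tags, lifting) imageE length_rotate mem_Collect_eq)
  moreover have "g = h" if "g \<in> ?\<Gamma>" "h \<in> ?\<Gamma>" "rotate j g = h" for g h j
  proof -
    obtain g' h' where gh: "g = rep g'" "h = rep h'" using \<open>g \<in> ?\<Gamma>\<close> \<open>h \<in> ?\<Gamma>\<close> by blast
    have "rel g h" using that(3) unfolding rel_def by blast
    then have "rel g' h'" using rep[of g'] sym[OF rep[of h']] trans gh by metis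
    then show ?thesis using rep_eq gh by simp
  qed
  ultimately show ?thesis using finL by (intro exI[of _ ?\<Gamma>]) blast
qed

section \<open>The free algebra and its quotient\<close>

definition conv :: "(nat list \<Rightarrow> 'k::field) \<Rightarrow> (nat list \<Rightarrow> 'k) \<Rightarrow> nat list \<Rightarrow> 'k" where
  "conv f g w = (\<Sum>i\<le>length w. f (take i w) * g (drop i w))"

lemma free_algebra_simps [simp]:
  "carrier (free_algebra m) = carrier (free_space (lists {..<m}))"
  "zero (free_algebra m) = (\<lambda>_. 0)"
  "add (free_algebra m) = (\<lambda>f g s. f s + g s)"
  "smult (free_algebra m) = (\<lambda>a f s. a * f s)"
  "mult (free_algebra m) = conv"
  "one (free_algebra m) = single []"
  by (simp_all add: free_algebra_def conv_def fun_eq_iff)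

lemma function_space_free_algebra: "function_space (free_algebra m)"
  using function_space_free_space[of "lists {..<m}"] unfolding function_space_def by simp

lemma conv_support: "{w. conv f g w \<noteq> 0} \<subseteq> (\<lambda>(v, w). v @ w) ` ({v. f v \<noteq> 0} \<times> {w. g w \<noteq> 0})"
proof
  fix w assume "w \<in> {w. conv f g w \<noteq> 0}"
  then obtain i where "f (take i w) * g (drop i w) \<noteq> 0"
    unfolding conv_def by (metis (mono_tags, lifting) mem_Collect_eq sum.neutral)
  then show "w \<in> (\<lambda>(v, w). v @ w) ` ({v. f v \<noteq> 0} \<times> {w. g w \<noteq> 0})"
    by (intro image_eqI[of _ _ "(take i w, drop i w)"]) auto
qed

lemma conv_finite: "finite {w. f w \<noteq> 0} \<Longrightarrow> finite {w. g w \<noteq> 0} \<Longrightarrow> finite {w. conv f g w \<noteq> 0}"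
  by (rule finite_subset[OF conv_support]) auto

lemma conv_carrier:
  assumes "f \<in> carrier (free_space (lists A))" "g \<in> carrier (free_space (lists A))"
  shows "conv f g \<in> carrier (free_space (lists A))"
proof -
  have "{w. conv f g w \<noteq> 0} \<subseteq> lists A"
  proof
    fix w assume "w \<in> {w. conv f g w \<noteq> 0}"
    then obtain v v' where "w = v @ v'" "f v \<noteq> 0" "g v' \<noteq> 0" using conv_support[of f g] by auto
    moreover have "v \<in> lists A" "v' \<in> lists A"
      using assms calculation(2,3) by (auto simp: free_space_carrier)
    ultimately show "w \<in> lists A" by simp
  qed
  then show ?thesis
    using assms conv_finite[of f g] by (simp add: free_space_carrier)
qed

text \<open>The product in the free algebra is the pushforward of the weights f v * g w along
  concatenation. Associativity and the multiplicativity of matrix representations rest on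
  this.\<close>

lemma lin_val_conv:
  fixes f g :: "nat list \<Rightarrow> 'k::field"
  assumes "finite {w. f w \<noteq> 0}" "finite {w. g w \<noteq> 0}"
  shows "lin_val L (conv f g) = lin_val (\<lambda>v. lin_val (\<lambda>w. L (v @ w)) g) f"
proof -
  let ?S = "{v. f v \<noteq> 0} \<times> {w. g w \<noteq> 0}" and ?c = "\<lambda>(v, w). v @ w" and ?F = "\<lambda>(v, w). f v * g w"
  have eq: "conv f g x = sum ?F {p \<in> ?S. ?c p = x}" for x
  proof -
    have "conv f g x = sum ?F {p. ?c p = x}"
      unfolding conv_def
      by (rule sum.reindex_bij_witness[of _ "\<lambda>p. length (fst p)" "\<lambda>i. (take i x, drop i x)"]) auto
    also have "\<dots> = sum ?F {p \<in> ?S. ?c p = x}"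
    proof (rule sum.mono_neutral_right)
      have "{p. ?c p = x} \<subseteq> (\<lambda>i. (take i x, drop i x)) ` {..length x}"
      proof
        fix p assume "p \<in> {p. ?c p = x}"
        then show "p \<in> (\<lambda>i. (take i x, drop i x)) ` {..length x}"
          by (cases p, intro image_eqI[of _ _ "length (fst p)"]) auto
      qed
      then show "finite {p. ?c p = x}" by (rule finite_subset) simp
    qed auto
    finally show ?thesis .
  qed
  have fin: "finite ?S" using assms by simp
  have "lin_val L (conv f g) = (\<Sum>x\<in>?c ` ?S. conv f g x * L x)"
    using fin conv_support[of f g] by (intro lin_val_eq) auto
  also have "\<dots> = (\<Sum>x\<in>?c ` ?S. sum (\<lambda>p. ?F p * L (?c p)) {p \<in> ?S. ?c p = x})"
    unfolding eq sum_distrib_right by (intro sum.cong refl) auto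
  also have "\<dots> = sum (\<lambda>p. ?F p * L (?c p)) ?S"
    using fin by (intro sum.group) auto
  also have "\<dots> = lin_val (\<lambda>v. lin_val (\<lambda>w. L (v @ w)) g) f"
    unfolding lin_val_def sum_distrib_left sum.cartesian_product
    by (intro sum.cong refl) (auto simp: mult.assoc)
  finally show ?thesis .
qed

lemma lin_val_indicator:
  "finite {w. f w \<noteq> 0} \<Longrightarrow> lin_val (\<lambda>w. if w = x then 1 else 0) f = f x"
  unfolding lin_val_def by (simp add: if_distrib[of "\<lambda>a. _ * a"] cong: if_cong)

lemma conv_eq_lin_val:
  assumes "finite {w. f w \<noteq> 0}" "finite {w. g w \<noteq> 0}"
  shows "conv f g x = lin_val (\<lambda>v. lin_val (\<lambda>w. if v @ w = x then 1 else 0) g) f"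
proof -
  have "conv f g x = lin_val (\<lambda>w. if w = x then 1 else 0) (conv f g)"
    by (rule lin_val_indicator[OF conv_finite[OF assms], symmetric])
  also have "\<dots> = lin_val (\<lambda>v. lin_val (\<lambda>w. if v @ w = x then 1 else 0) g) f"
    by (rule lin_val_conv[OF assms])
  finally show ?thesis .
qed

text \<open>A coefficient is the value of an indicator functional, so both sides become sums over
  triples of words and differ only in the bracketing of the concatenation.\<close>

lemma conv_assoc:
  assumes "finite {w. f w \<noteq> 0}" "finite {w. g w \<noteq> 0}" "finite {w. h w \<noteq> 0}"
  shows "conv (conv f g) h = conv f (conv g h)"
proof
  fix x
  have "conv (conv f g) h x = lin_val (\<lambda>u. lin_val (\<lambda>w. if u @ w = x then 1 else 0) h) (conv f g)"
    by (intro conv_eq_lin_val conv_finite assms)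
  also have "\<dots> = lin_val (\<lambda>v. lin_val (\<lambda>v'. lin_val (\<lambda>w. if v @ v' @ w = x then 1 else 0) h) g) f"
    by (simp add: lin_val_conv[OF assms(1,2)])
  also have "\<dots> = lin_val (\<lambda>v. lin_val (\<lambda>w. if v @ w = x then 1 else 0) (conv g h)) f"
    by (simp add: lin_val_conv[OF assms(2,3)])
  also have "\<dots> = conv f (conv g h) x"
    by (intro conv_eq_lin_val[symmetric] conv_finite assms)
  finally show "conv (conv f g) h x = conv f (conv g h) x" .
qed

lemma conv_add_left: "conv (\<lambda>w. f w + f' w) g = (\<lambda>w. conv f g w + conv f' g w)"
  by (simp add: conv_def distrib_right sum.distrib fun_eq_iff)

lemma conv_add_right: "conv g (\<lambda>w. f w + f' w) = (\<lambda>w. conv g f w + conv g f' w)"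
  by (simp add: conv_def distrib_left sum.distrib fun_eq_iff)

lemma conv_scale_left: "conv (\<lambda>w. a * f w) g = (\<lambda>w. a * conv f g w)"
  by (simp add: conv_def sum_distrib_left mult.assoc fun_eq_iff)

lemma conv_scale_right: "conv g (\<lambda>w. a * f w) = (\<lambda>w. a * conv g f w)"
  by (simp add: conv_def sum_distrib_left mult.left_commute fun_eq_iff)

lemma conv_one:
  assumes "finite {w. f w \<noteq> 0}"
  shows "conv (single []) f = f" "conv f (single []) = f"
  by (simp_all add: fun_eq_iff conv_eq_lin_val[OF finite_support_single assms]
      conv_eq_lin_val[OF assms finite_support_single] lin_val_indicator[OF assms])

lemma free_algebra_ring: "ring (free_algebra m :: ('k::field, nat list \<Rightarrow> 'k) module)"
proof (rule ringI)
  interpret vectorspace class_ring "free_algebra m :: ('k, nat list \<Rightarrow> 'k) module"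
    by (rule function_space_is_space[OF function_space_free_algebra])
  show "abelian_group (free_algebra m :: ('k, nat list \<Rightarrow> 'k) module)" ..
  show "monoid (free_algebra m :: ('k, nat list \<Rightarrow> 'k) module)"
    by (rule monoidI) (simp_all add: conv_carrier single_in_free_space conv_assoc conv_one free_space_finite)
qed (simp_all add: conv_add_left conv_add_right)

lemma omega_carrier: "omega n m c \<in> carrier (free_algebra m)"
proof -
  have sub: "{w. omega n m c w \<noteq> 0} \<subseteq> (\<lambda>(i, j). [i, j]) ` ({..<m} \<times> {..<m})"
  proof
    fix w assume "w \<in> {w. omega n m c w \<noteq> 0}"
    then obtain i j where "i < m" "j < m" "(-1) ^ n * c j i * single [i, j] w \<noteq> 0"
      unfolding omega_def by (metis (mono_tags, lifting) lessThan_iff mem_Collect_eq sum.neutral)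
    then show "w \<in> (\<lambda>(i, j). [i, j]) ` ({..<m} \<times> {..<m})"
      by (intro image_eqI[of _ _ "(i, j)"]) (auto simp: single_def split: if_splits)
  qed
  then have "finite {w. omega n m c w \<noteq> 0}" by (rule finite_subset) simp
  with sub show ?thesis by (auto simp: free_space_carrier)
qed

section \<open>Homogeneous elements and the quotient by \<omega>\<close>

definition homogeneous :: "nat \<Rightarrow> (nat list \<Rightarrow> 'k::zero) \<Rightarrow> bool" where
  "homogeneous r f \<longleftrightarrow> (\<forall>w. f w \<noteq> 0 \<longrightarrow> length w = r)"

lemma homogeneous_conv:
  assumes "homogeneous r f" "homogeneous s g"
  shows "homogeneous (r + s) (conv f g)"
  unfolding homogeneous_def
proof (intro allI impI)
  fix w assume "conv f g w \<noteq> 0"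
  then obtain v v' where "w = v @ v'" "f v \<noteq> 0" "g v' \<noteq> 0" using conv_support[of f g] by auto
  then show "length w = r + s" using assms by (simp add: homogeneous_def)
qed

locale U_algebra =
  fixes n m :: nat and c :: "nat \<Rightarrow> nat \<Rightarrow> 'k::field"
begin

abbreviation T where "T \<equiv> free_algebra m :: ('k, nat list \<Rightarrow> 'k) module"

abbreviation I where "I \<equiv> U_ideal n m c"

lemma ideal: "ideal I T"
  unfolding U_ideal_def using omega_carrier[of n m c]
  by (intro ring.genideal_ideal free_algebra_ring) simp

lemma ideal_submodule: "submodule class_ring I T"
proof -
  interpret I: ideal I T by (rule ideal)
  show ?thesis
  proof (rule function_space_submodule[OF function_space_free_algebra])
    show "I \<subseteq> carrier T" by (rule I.a_subset)
    show "(\<lambda>_. 0) \<in> I" using additive_subgroup.zero_closed[OF I.is_additive_subgroup] by simp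
    show "(\<lambda>s. f s + g s) \<in> I" if "f \<in> I" "g \<in> I" for f g using additive_subgroup.a_closed[OF I.is_additive_subgroup that] by simp
    \<comment> \<open>An ideal of the ring is closed under scalars because a f is the product of a
      times the unit with f.\<close>
    show "(\<lambda>s. a * f s) \<in> I" if f: "f \<in> I" for a f
    proof -
      have fc: "f \<in> carrier (free_space (lists {..<m}))" using I.a_subset f by auto
      have "(\<lambda>w. a * single [] w) \<in> carrier T"
        using function_spaceD(6)[OF function_space_free_algebra single_in_free_space[of "[]" "lists {..<m}", folded free_algebra_simps(1)]]
        by simp
      then have "conv (\<lambda>w. a * single [] w) f \<in> I" using I.I_l_closed[OF f] by simp
      then show ?thesis using fc by (simp add: conv_scale_left conv_one free_space_finite)
    qed
  qed
qed

sublocale U: space_quotient T I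
  by (intro space_quotient.intro function_space_is_space function_space_free_algebra ideal_submodule)

lemma U_alg_eq: "U_alg n m c = U.Q"
  by (simp add: U_alg_def)

lemma U_mult:
  assumes "f \<in> carrier T" "g \<in> carrier T"
  shows "U.cl f \<otimes>\<^bsub>U_alg n m c\<^esub> U.cl g = U.cl (conv f g)"
  using ideal.rcoset_mult_add[OF ideal assms] by (simp add: U_alg_eq)

lemma U_part_simps [simp]:
  "carrier (U_part n m c r) = U.cl ` {f \<in> carrier T. homogeneous r f}"
  "add (U_part n m c r) = add (U_alg n m c)"
  "zero (U_part n m c r) = zero (U_alg n m c)"
  "smult (U_part n m c r) = smult (U_alg n m c)"
  by (auto simp: U_part_def homogeneous_def)

lemma U_part_carrierE:
  assumes "u \<in> carrier (U_part n m c r)"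
  obtains f where "f \<in> carrier T" "homogeneous r f" "u = U.cl f"
  using assms by auto

lemma U_partI: "f \<in> carrier T \<Longrightarrow> homogeneous r f \<Longrightarrow> U.cl f \<in> carrier (U_part n m c r)"
  by simp

lemma U_part_add_closed:
  assumes "u \<in> carrier (U_part n m c r)" "v \<in> carrier (U_part n m c r)"
  shows "u \<oplus>\<^bsub>U_part n m c r\<^esub> v \<in> carrier (U_part n m c r)"
proof -
  obtain f where "f \<in> carrier T" "homogeneous r f" "u = U.cl f"
    using assms(1) by (rule U_part_carrierE)
  moreover obtain g where "g \<in> carrier T" "homogeneous r g" "v = U.cl g"
    using assms(2) by (rule U_part_carrierE)
  moreover have "(\<lambda>s. f s + g s) \<in> carrier T"
    using calculation by (intro function_spaceD(5)[OF function_space_free_algebra])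
  moreover have "homogeneous r (\<lambda>s. f s + g s)"
    using calculation unfolding homogeneous_def by (metis add.right_neutral)
  ultimately show ?thesis
    unfolding U_part_simps(2) U_alg_eq by (simp only: U.cl_add) (intro U_partI, simp_all)
qed

lemma U_part_smult_closed:
  assumes "u \<in> carrier (U_part n m c r)"
  shows "a \<odot>\<^bsub>U_part n m c r\<^esub> u \<in> carrier (U_part n m c r)"
proof -
  obtain f where "f \<in> carrier T" "homogeneous r f" "u = U.cl f"
    using assms by (rule U_part_carrierE)
  moreover have "(\<lambda>s. a * f s) \<in> carrier T" "homogeneous r (\<lambda>s. a * f s)"
    using calculation function_spaceD(6)[OF function_space_free_algebra] unfolding homogeneous_def by auto
  ultimately show ?thesis
    unfolding U_part_simps(4) U_alg_eq by (simp only: U.cl_smult) (intro U_partI, simp_all)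
qed

lemma U_part_mult_closed:
  assumes "u \<in> carrier (U_part n m c r)" "v \<in> carrier (U_part n m c s)"
  shows "u \<otimes>\<^bsub>U_alg n m c\<^esub> v \<in> carrier (U_part n m c (r + s))"
proof -
  obtain f where "f \<in> carrier T" "homogeneous r f" "u = U.cl f"
    using assms(1) by (rule U_part_carrierE)
  moreover obtain g where "g \<in> carrier T" "homogeneous s g" "v = U.cl g"
    using assms(2) by (rule U_part_carrierE)
  ultimately show ?thesis
    using conv_carrier[of f "{..<m}" g] homogeneous_conv[of r f s g]
    by (simp only: U_mult) (intro U_partI, simp_all)
qed

lemma U_part_subset: "u \<in> carrier (U_part n m c r) \<Longrightarrow> \<exists>f \<in> carrier T. u = U.cl f"
  by auto

lemma U_mult_add:
  assumes "u \<in> carrier (U_part n m c r)" "u' \<in> carrier (U_part n m c r)" "v \<in> carrier (U_part n m c s)"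
  shows "(u \<oplus>\<^bsub>U_alg n m c\<^esub> u') \<otimes>\<^bsub>U_alg n m c\<^esub> v = (u \<otimes>\<^bsub>U_alg n m c\<^esub> v) \<oplus>\<^bsub>U_alg n m c\<^esub> (u' \<otimes>\<^bsub>U_alg n m c\<^esub> v)"
    "v \<otimes>\<^bsub>U_alg n m c\<^esub> (u \<oplus>\<^bsub>U_alg n m c\<^esub> u') = (v \<otimes>\<^bsub>U_alg n m c\<^esub> u) \<oplus>\<^bsub>U_alg n m c\<^esub> (v \<otimes>\<^bsub>U_alg n m c\<^esub> u')"
    "(a \<odot>\<^bsub>U_alg n m c\<^esub> u) \<otimes>\<^bsub>U_alg n m c\<^esub> v = a \<odot>\<^bsub>U_alg n m c\<^esub> (u \<otimes>\<^bsub>U_alg n m c\<^esub> v)"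
    "v \<otimes>\<^bsub>U_alg n m c\<^esub> (a \<odot>\<^bsub>U_alg n m c\<^esub> u) = a \<odot>\<^bsub>U_alg n m c\<^esub> (v \<otimes>\<^bsub>U_alg n m c\<^esub> u)"
proof -
  obtain f f' g where fg: "f \<in> carrier T" "u = U.cl f" "f' \<in> carrier T" "u' = U.cl f'" "g \<in> carrier T" "v = U.cl g"
    using assms[THEN U_part_subset] by blast
  note cs = conv_carrier[of _ "{..<m}", folded free_algebra_simps(1)]
    function_spaceD(5,6)[OF function_space_free_algebra[of m]]
  have add: "U.cl h \<oplus>\<^bsub>U_alg n m c\<^esub> U.cl h' = U.cl (\<lambda>w. h w + h' w)" if "h \<in> carrier T" "h' \<in> carrier T" for h h'
    unfolding U_alg_eq using U.cl_add[OF that] by simp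
  have smult: "a \<odot>\<^bsub>U_alg n m c\<^esub> U.cl h = U.cl (\<lambda>w. a * h w)" if "h \<in> carrier T" for h a
    unfolding U_alg_eq using U.cl_smult[OF that, of a] by simp
  show "(u \<oplus>\<^bsub>U_alg n m c\<^esub> u') \<otimes>\<^bsub>U_alg n m c\<^esub> v = (u \<otimes>\<^bsub>U_alg n m c\<^esub> v) \<oplus>\<^bsub>U_alg n m c\<^esub> (u' \<otimes>\<^bsub>U_alg n m c\<^esub> v)"
    "v \<otimes>\<^bsub>U_alg n m c\<^esub> (u \<oplus>\<^bsub>U_alg n m c\<^esub> u') = (v \<otimes>\<^bsub>U_alg n m c\<^esub> u) \<oplus>\<^bsub>U_alg n m c\<^esub> (v \<otimes>\<^bsub>U_alg n m c\<^esub> u')"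
    "(a \<odot>\<^bsub>U_alg n m c\<^esub> u) \<otimes>\<^bsub>U_alg n m c\<^esub> v = a \<odot>\<^bsub>U_alg n m c\<^esub> (u \<otimes>\<^bsub>U_alg n m c\<^esub> v)"
    "v \<otimes>\<^bsub>U_alg n m c\<^esub> (a \<odot>\<^bsub>U_alg n m c\<^esub> u) = a \<odot>\<^bsub>U_alg n m c\<^esub> (v \<otimes>\<^bsub>U_alg n m c\<^esub> u)"
    unfolding fg using fg(1,3,5)
    by (simp_all only: add smult U_mult cs conv_add_left conv_add_right conv_scale_left conv_scale_right)
qed

end

section \<open>Traces on the free algebra\<close>

lemma lin_val_sum_right: "lin_val (\<lambda>w. \<Sum>s\<in>A. \<beta> s w) f = (\<Sum>s\<in>A. lin_val (\<beta> s) f)"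
  unfolding lin_val_def sum_distrib_left by (rule sum.swap)

lemma lin_val_sum:
  assumes "finite A" "\<And>i. i \<in> A \<Longrightarrow> finite {s. f i s \<noteq> 0}"
  shows "lin_val \<beta> (\<lambda>s. \<Sum>i\<in>A. f i s) = (\<Sum>i\<in>A. lin_val \<beta> (f i)) \<and> finite {s. (\<Sum>i\<in>A. f i s) \<noteq> 0}"
  using assms
proof (induction A rule: finite_induct)
  case (insert a A)
  then have "finite {s. f a s \<noteq> 0}" "finite {s. (\<Sum>i\<in>A. f i s) \<noteq> 0}" by auto
  then show ?case using insert by (simp add: lin_val_add finite_support_add)
qed simp

lemma finite_support_scale: "finite {s. f s \<noteq> 0} \<Longrightarrow> finite {s. a * f s \<noteq> (0::'k::field)}"
  by (rule finite_subset[of _ "{s. f s \<noteq> 0}"]) auto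

lemma lin_val_cong:
  "(\<And>s. f s \<noteq> 0 \<Longrightarrow> \<beta> s = \<gamma> s) \<Longrightarrow> lin_val \<beta> f = lin_val \<gamma> f"
  unfolding lin_val_def by (intro sum.cong) auto

lemma lin_val_omega:
  "lin_val L (omega n m c) = (\<Sum>i<m. \<Sum>j<m. (-1) ^ n * c j i * L [i, j])"
proof -
  have 1: "finite {w. (-1) ^ n * c j i * single [i, j] w \<noteq> 0}" for i j
    by (rule finite_support_scale[OF finite_support_single])
  have 2: "lin_val L (\<lambda>w. \<Sum>j<m. (-1) ^ n * c j i * single [i, j] w) = (\<Sum>j<m. (-1) ^ n * c j i * L [i, j])"
    "finite {w. (\<Sum>j<m. (-1) ^ n * c j i * single [i, j] w) \<noteq> 0}" for i
    using lin_val_sum[of "{..<m}" "\<lambda>j w. (-1) ^ n * c j i * single [i, j] w" L, OF _ 1]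
    by (simp_all add: lin_val_scale)
  show ?thesis
    unfolding omega_def
    using lin_val_sum[of "{..<m}" "\<lambda>i w. \<Sum>j<m. (-1) ^ n * c j i * single [i, j] w" L, OF _ 2(2)]
    by (simp add: 2(1))
qed

definition letter_sum :: "nat \<Rightarrow> (nat \<Rightarrow> 'k::field) \<Rightarrow> nat list \<Rightarrow> 'k" where
  "letter_sum m \<xi> = (\<lambda>w. \<Sum>i<m. \<xi> i * single [i] w)"

lemma letter_sum_support:
  assumes "letter_sum m \<xi> w \<noteq> 0"
  obtains i where "i < m" "w = [i]"
proof -
  obtain i where "i \<in> {..<m}" "\<xi> i * single [i] w \<noteq> 0"
    using assms sum.neutral[of "{..<m}" "\<lambda>i. \<xi> i * single [i] w"] unfolding letter_sum_def by blast
  then show ?thesis using that by (auto simp: single_def split: if_splits)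
qed

lemma letter_sum_carrier: "letter_sum m \<xi> \<in> carrier (free_algebra m)"
proof -
  have sub: "{w. letter_sum m \<xi> w \<noteq> 0} \<subseteq> (\<lambda>i. [i]) ` {..<m}"
    by (auto elim!: letter_sum_support)
  then have "finite {w. letter_sum m \<xi> w \<noteq> 0}" by (rule finite_subset) simp
  with sub show ?thesis by (auto simp: free_space_carrier)
qed

lemma homogeneous_letter_sum: "homogeneous 1 (letter_sum m \<xi>)"
  unfolding homogeneous_def by (auto elim!: letter_sum_support)

lemma lin_val_letter_sum: "lin_val L (letter_sum m \<xi>) = (\<Sum>i<m. \<xi> i * L [i])"
  unfolding letter_sum_def
  using lin_val_sum[of "{..<m}" "\<lambda>i w. \<xi> i * single [i] w" L, OF _ finite_support_scale[OF finite_support_single]]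
  by (simp add: lin_val_scale)

text \<open>The monomial h evaluated at the linear forms \<open>\<xi> b\<close> in the generators.
  For binary h, its class in U is the element on which the traces are tested.\<close>

fun word_product :: "nat \<Rightarrow> ('l \<Rightarrow> nat \<Rightarrow> 'k::field) \<Rightarrow> 'l list \<Rightarrow> nat list \<Rightarrow> 'k" where
  "word_product m \<xi> [] = single []"
| "word_product m \<xi> (b # h) = conv (letter_sum m (\<xi> b)) (word_product m \<xi> h)"

lemma word_product_carrier: "word_product m \<xi> h \<in> carrier (free_algebra m)"
proof (induction h)
  case Nil
  then show ?case by (simp add: single_in_free_space)
next
  case (Cons b h)
  then show ?case
    using letter_sum_carrier[of m "\<xi> b"] by (simp add: conv_carrier)
qed

lemma homogeneous_word_product: "homogeneous (length h) (word_product m \<xi> h)"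
proof (induction h)
  case Nil
  then show ?case by (simp add: homogeneous_def single_def)
next
  case (Cons b h)
  then show ?case using homogeneous_conv[OF homogeneous_letter_sum Cons, of m "\<xi> b"] by simp
qed

lemma lin_val_mult_right: "lin_val (\<lambda>s. \<beta> s * a) f = lin_val \<beta> f * a"
  by (simp add: lin_val_def sum_distrib_right mult.assoc)

text \<open>Multiplicativity of the matrix representation of the free algebra that sends the i-th
  generator to \<open>A i\<close>.\<close>

lemma lin_val_word_mat_conv:
  fixes f g :: "nat list \<Rightarrow> 'k::field"
  assumes "finite {w. f w \<noteq> 0}" "finite {w. g w \<noteq> 0}" "finite J" "s \<in> J"
  shows "lin_val (\<lambda>w. word_mat J A w s t) (conv f g) =
    mat_mul J (\<lambda>s u. lin_val (\<lambda>w. word_mat J A w s u) f) (\<lambda>u t. lin_val (\<lambda>w. word_mat J A w u t) g) s t"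
proof -
  have "lin_val (\<lambda>w. word_mat J A w s t) (conv f g) =
      lin_val (\<lambda>v. lin_val (\<lambda>w. \<Sum>u\<in>J. word_mat J A v s u * word_mat J A w u t) g) f"
    unfolding lin_val_conv[OF assms(1,2)] word_mat_append[OF assms(3,4)] mat_mul_def ..
  also have "\<dots> = (\<Sum>u\<in>J. lin_val (\<lambda>w. word_mat J A w s u) f * lin_val (\<lambda>w. word_mat J A w u t) g)"
    unfolding lin_val_sum_right lin_val_scale_right lin_val_mult_right ..
  finally show ?thesis
    unfolding mat_mul_def .
qed

lemma lin_val_word_mat_letter_sum:
  assumes "finite J" "t \<in> J"
  shows "lin_val (\<lambda>w. word_mat J A w s t) (letter_sum m \<xi>) = (\<Sum>i<m. \<xi> i * A i s t)"
proof -
  have "word_mat J A [i] s t = A i s t" for i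
  proof -
    have "(\<Sum>u\<in>J. A i s u * (if u = t then 1 else 0)) = (\<Sum>u\<in>J. if u = t then A i s u else 0)"
      by (intro sum.cong) auto
    then show ?thesis using assms by (simp add: mat_mul_def)
  qed
  then show ?thesis by (simp only: lin_val_letter_sum)
qed

lemma lin_val_word_mat_word_product:
  assumes J: "finite J" and st: "s \<in> J" "t \<in> J"
    and B: "\<And>b s t. s \<in> J \<Longrightarrow> t \<in> J \<Longrightarrow> (\<Sum>i<m. \<xi> b i * A i s t) = B b s t"
  shows "lin_val (\<lambda>w. word_mat J A w s t) (word_product m \<xi> h) = word_mat J B h s t"
  using st(1)
proof (induction h arbitrary: s)
  case (Cons b h)
  have "finite {w. letter_sum m (\<xi> b) w \<noteq> 0}" "finite {w. word_product m \<xi> h w \<noteq> 0}"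
    using letter_sum_carrier[of m "\<xi> b"] word_product_carrier[of m \<xi> h] by (simp_all add: free_space_finite)
  then have "lin_val (\<lambda>w. word_mat J A w s t) (word_product m \<xi> (b # h)) =
      mat_mul J (\<lambda>s u. lin_val (\<lambda>w. word_mat J A w s u) (letter_sum m (\<xi> b)))
        (\<lambda>u t. lin_val (\<lambda>w. word_mat J A w u t) (word_product m \<xi> h)) s t"
    using lin_val_word_mat_conv[OF _ _ J Cons.prems] by simp
  also have "\<dots> = mat_mul J (B b) (word_mat J B h) s t"
    using Cons by (intro mat_mul_cong) (simp_all add: lin_val_word_mat_letter_sum[OF J] B)
  finally show ?case by simp
qed simp

definition word_trace :: "'i set \<Rightarrow> (nat \<Rightarrow> 'i \<Rightarrow> 'i \<Rightarrow> 'k::field) \<Rightarrow> (nat list \<Rightarrow> 'k) \<Rightarrow> 'k" where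
  "word_trace J A = lin_val (\<lambda>w. mat_trace J (word_mat J A w))"

lemma word_trace_eq: "word_trace J A f = (\<Sum>s\<in>J. lin_val (\<lambda>w. word_mat J A w s s) f)"
  by (simp add: word_trace_def mat_trace_def lin_val_sum_right)

text \<open>Cyclicity of the trace on words, extended bilinearly.\<close>

lemma word_trace_commute:
  assumes "finite {w. f w \<noteq> 0}" "finite {w. g w \<noteq> 0}" "finite J"
  shows "word_trace J A (conv f g) = word_trace J A (conv g f)"
proof -
  have "word_trace J A (conv f g) = lin_val (\<lambda>v. lin_val (\<lambda>w. mat_trace J (word_mat J A (v @ w))) g) f"
    unfolding word_trace_def by (rule lin_val_conv[OF assms(1,2)])
  also have "\<dots> = lin_val (\<lambda>w. lin_val (\<lambda>v. mat_trace J (word_mat J A (v @ w))) f) g"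
    by (rule lin_val_swap[OF assms(1,2)])
  also have "\<dots> = lin_val (\<lambda>w. lin_val (\<lambda>v. mat_trace J (word_mat J A (w @ v))) f) g"
    by (intro arg_cong2[of _ _ _ _ lin_val] refl ext mat_trace_word_commute assms)
  also have "\<dots> = word_trace J A (conv g f)"
    unfolding word_trace_def by (rule lin_val_conv[OF assms(2,1), symmetric])
  finally show ?thesis .
qed

lemma linear_functional_word_trace: "linear_functional (free_algebra m) (word_trace J A)"
  using linear_functional_lin_val[of "lists {..<m}"] unfolding linear_functional_def word_trace_def by simp

context U_algebra
begin

text \<open>The common kernel of all matrix entries with indices in J is a two-sided ideal, since
  the representation is multiplicative. It contains \<omega> by hypothesis, hence the ideal
  generated by \<omega>.\<close>

lemma lin_val_ideal:
  assumes J: "finite J"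
    and A: "\<And>s t. s \<in> J \<Longrightarrow> t \<in> J \<Longrightarrow> (\<Sum>i<m. \<Sum>j<m. ((-1) ^ n * c j i) * mat_mul J (A i) (A j) s t) = 0"
    and f: "f \<in> I" and st: "s \<in> J" "t \<in> J"
  shows "lin_val (\<lambda>w. word_mat J A w s t) f = 0"
proof -
  let ?R = "\<lambda>f s t. lin_val (\<lambda>w. word_mat J A w s t) f"
  let ?K = "{f \<in> carrier T. \<forall>s\<in>J. \<forall>t\<in>J. ?R f s t = 0}"
  have fin: "finite {w. f w \<noteq> 0}" if "f \<in> carrier T" for f using that by (simp add: free_space_finite)
  have sub: "submodule class_ring ?K T"
  proof (rule function_space_submodule[OF function_space_free_algebra])
    show "(\<lambda>_. 0) \<in> ?K" using function_spaceD(4)[OF function_space_free_algebra] by simp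
    show "(\<lambda>s. f s + g s) \<in> ?K" if "f \<in> ?K" "g \<in> ?K" for f g
      using that function_spaceD(5)[OF function_space_free_algebra, of f m g] fin[of f] fin[of g]
      by (simp add: lin_val_add)
    show "(\<lambda>s. a * f s) \<in> ?K" if "f \<in> ?K" for a f
      using that function_spaceD(6)[OF function_space_free_algebra, of f m a] by (simp add: lin_val_scale)
  qed auto
  interpret K: space_quotient T ?K
    by (intro space_quotient.intro function_space_is_space function_space_free_algebra sub)
  have "ideal ?K T"
  proof (rule idealI[OF free_algebra_ring K.W.a_subgroup])
    fix f g assume f: "f \<in> ?K" and g: "g \<in> carrier T"
    have "conv g f \<in> carrier T" "conv f g \<in> carrier T"
      using f g conv_carrier[of f "{..<m}" g] conv_carrier[of g "{..<m}" f] by simp_all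
    moreover have "?R (conv g f) s t = 0" "?R (conv f g) s t = 0" if "s \<in> J" "t \<in> J" for s t
      using lin_val_word_mat_conv[OF fin fin J that(1)] f g that by (simp_all add: mat_mul_def)
    ultimately show "g \<otimes>\<^bsub>T\<^esub> f \<in> ?K" "f \<otimes>\<^bsub>T\<^esub> g \<in> ?K" by simp_all
  qed
  moreover have "omega n m c \<in> ?K"
  proof -
    have "word_mat J A [i, j] s t = mat_mul J (A i) (A j) s t" if "t \<in> J" for i j s t
    proof -
      have "mat_mul J (A j) (\<lambda>s t. if s = t then 1 else 0) u t = A j u t" for u
      proof -
        have "(\<Sum>v\<in>J. A j u v * (if v = t then 1 else 0)) = (\<Sum>v\<in>J. if v = t then A j u v else 0)"
          by (intro sum.cong) auto
        then show ?thesis using J that by (simp add: mat_mul_def)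
      qed
      then show ?thesis by (simp add: mat_mul_def)
    qed
    then show ?thesis using omega_carrier[of n m c] A by (simp add: lin_val_omega del: word_mat.simps)
  qed
  ultimately have "I \<subseteq> ?K"
    unfolding U_ideal_def by (intro ring.genideal_minimal free_algebra_ring) simp_all
  then show ?thesis using f st by blast
qed

lemma word_trace_ideal:
  assumes "finite J"
    and "\<And>s t. s \<in> J \<Longrightarrow> t \<in> J \<Longrightarrow> (\<Sum>i<m. \<Sum>j<m. ((-1) ^ n * c j i) * mat_mul J (A i) (A j) s t) = 0"
    and "f \<in> I"
  shows "word_trace J A f = 0"
  unfolding word_trace_eq using lin_val_ideal[OF assms] by (intro sum.neutral) blast

end

text \<open>The forms \<open>\<xi> b\<close> are dual to the \<open>v b\<close> and vanish on z, so
  they act by P and Q, and the trace becomes the count of rotations.\<close>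

lemma word_trace_gen_mat:
  fixes v \<xi> :: "bool \<Rightarrow> nat \<Rightarrow> 'k::field"
  assumes "splitting m \<omega> v z q \<xi>" "length h = length g"
  shows "word_trace (idx (length g)) (gen_mat g v z q) (word_product m \<xi> h) =
    of_nat (2 * card {j. j < length g \<and> rotate j g = h})"
proof -
  let ?J = "idx (length g)"
  have "(\<Sum>i<m. \<xi> b i * gen_mat g v z q i s t) = blow_up (shift_mat g b) s t" for b s t
    using assms(1) by (intro gen_mat_dual) (auto simp: splitting_def)
  then have "word_trace ?J (gen_mat g v z q) (word_product m \<xi> h) =
      mat_trace ?J (word_mat ?J (\<lambda>b. blow_up (shift_mat g b)) h)"
    unfolding word_trace_eq mat_trace_def
    by (intro sum.cong refl lin_val_word_mat_word_product) auto
  then show ?thesis by (simp only: mat_trace_shift[OF assms(2)])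
qed

section \<open>The cup product in cohomology\<close>

abbreviation cocycle_space :: "'a topology \<Rightarrow> nat \<Rightarrow> ('k::field, ('a, 'k) cochain) module" where
  "cocycle_space X p \<equiv> (cochain_space X p)\<lparr>carrier := cocycles X p\<rparr>"

lemma function_space_cocycle_space: "function_space (cocycle_space X p)"
  unfolding function_space_def by (auto simp: cocycles_def coboundary_add coboundary_scale coboundary_zero)

lemma coboundary_in_cocycles: "coboundary X p \<phi> \<in> cocycles X (Suc p)"
  by (simp add: cocycles_def coboundary_coboundary) (simp add: coboundary_def)

lemma coboundaries_zero: "(\<lambda>_. 0) \<in> coboundaries X p"
  by (auto simp: coboundaries_def coboundary_zero intro!: image_eqI[of _ _ "\<lambda>_. 0"])

lemma coboundariesI:
  "\<phi> \<in> carrier (cochain_space X p) \<Longrightarrow> coboundary X p \<phi> \<in> coboundaries X (Suc p)"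
  by (simp add: coboundaries_def)

lemma coboundaries_submodule: "submodule class_ring (coboundaries X p) (cocycle_space X p)"
proof (rule function_space_submodule[OF function_space_cocycle_space])
  show "coboundaries X p \<subseteq> carrier (cocycle_space X p)"
    using function_spaceD(4)[OF function_space_cocycle_space[of X 0]] coboundary_in_cocycles[of X]
    by (cases p) (auto simp: coboundaries_def)
  show "(\<lambda>\<sigma>. \<phi> \<sigma> + \<psi> \<sigma>) \<in> coboundaries X p" if *: "\<phi> \<in> coboundaries X p" "\<psi> \<in> coboundaries X p" for \<phi> \<psi>
  proof (cases p)
    case (Suc q)
    obtain \<phi>' \<psi>' where "\<phi>' \<in> carrier (cochain_space X q)" "\<psi>' \<in> carrier (cochain_space X q)"
      "\<phi> = coboundary X q \<phi>'" "\<psi> = coboundary X q \<psi>'"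
      using * Suc by (auto simp: coboundaries_def)
    then have "(\<lambda>\<sigma>. \<phi> \<sigma> + \<psi> \<sigma>) = coboundary X q (\<lambda>\<sigma>. \<phi>' \<sigma> + \<psi>' \<sigma>)"
      "(\<lambda>\<sigma>. \<phi>' \<sigma> + \<psi>' \<sigma>) \<in> carrier (cochain_space X q)"
      by (simp_all add: coboundary_add)
    then show ?thesis using Suc coboundariesI by metis
  qed (use * in \<open>simp add: coboundaries_def\<close>)
  show "(\<lambda>\<sigma>. a * \<phi> \<sigma>) \<in> coboundaries X p" if *: "\<phi> \<in> coboundaries X p" for a \<phi>
  proof (cases p)
    case (Suc q)
    obtain \<phi>' where "\<phi>' \<in> carrier (cochain_space X q)" "\<phi> = coboundary X q \<phi>'"
      using * Suc by (auto simp: coboundaries_def)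
    then have "(\<lambda>\<sigma>. a * \<phi> \<sigma>) = coboundary X q (\<lambda>\<sigma>. a * \<phi>' \<sigma>)"
      "(\<lambda>\<sigma>. a * \<phi>' \<sigma>) \<in> carrier (cochain_space X q)"
      by (simp_all add: coboundary_scale)
    then show ?thesis using Suc coboundariesI by metis
  qed (use * in \<open>simp add: coboundaries_def\<close>)
qed (rule coboundaries_zero)

interpretation H: space_quotient "cocycle_space X p" "coboundaries X p" for X p
  by (intro space_quotient.intro function_space_is_space function_space_cocycle_space coboundaries_submodule)

lemma cohomology_eq: "cohomology X p = quot_module (cocycle_space X p) (coboundaries X p)"
  by (simp add: cohomology_def)

abbreviation cocycle_class :: "'a topology \<Rightarrow> nat \<Rightarrow> ('a, 'k::field) cochain \<Rightarrow> ('a, 'k) cochain set" where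
  "cocycle_class X p \<phi> \<equiv> coboundaries X p +>\<^bsub>cocycle_space X p\<^esub> \<phi>"

lemma cohomology_carrierE:
  assumes "a \<in> carrier (cohomology X p)"
  obtains \<phi> where "\<phi> \<in> cocycles X p" "a = cocycle_class X p \<phi>"
  using assms unfolding cohomology_eq H.quotient_carrier by auto

lemma cocycle_class_closed: "\<phi> \<in> cocycles X p \<Longrightarrow> cocycle_class X p \<phi> \<in> carrier (cohomology X p)"
  unfolding cohomology_eq by (rule H.cl_closed) simp

lemma cocycle_class_add:
  "\<phi> \<in> cocycles X p \<Longrightarrow> \<psi> \<in> cocycles X p \<Longrightarrow>
    cocycle_class X p \<phi> \<oplus>\<^bsub>cohomology X p\<^esub> cocycle_class X p \<psi> = cocycle_class X p (\<lambda>\<sigma>. \<phi> \<sigma> + \<psi> \<sigma>)"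
  unfolding cohomology_eq using H.cl_add[of \<phi> X p \<psi>] by simp

lemma cocycle_class_smult:
  "\<phi> \<in> cocycles X p \<Longrightarrow> a \<odot>\<^bsub>cohomology X p\<^esub> cocycle_class X p \<phi> = cocycle_class X p (\<lambda>\<sigma>. a * \<phi> \<sigma>)"
  unfolding cohomology_eq using H.cl_smult[of \<phi> X p a] by simp

lemma cocycle_class_eq_iff:
  assumes "\<phi> \<in> cocycles X p" "\<psi> \<in> cocycles X p"
  shows "cocycle_class X p \<phi> = cocycle_class X p \<psi> \<longleftrightarrow> (\<lambda>\<sigma>. \<phi> \<sigma> - \<psi> \<sigma>) \<in> coboundaries X p"
  using assms H.cl_eq_iff[of \<phi> X p \<psi>] function_space_minus[OF function_space_cocycle_space, of \<phi> X p \<psi>] by simp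

lemma in_cocycle_class_iff:
  assumes "\<psi> \<in> cocycles X p"
  shows "\<phi> \<in> cocycle_class X p \<psi> \<longleftrightarrow> \<phi> \<in> cocycles X p \<and> (\<lambda>\<sigma>. \<phi> \<sigma> - \<psi> \<sigma>) \<in> coboundaries X p"
  using assms H.in_cl_iff[of \<psi> X p \<phi>] function_space_minus[OF function_space_cocycle_space, of \<phi> X p \<psi>] by auto

lemma cup_cochain_carrier: "cup_cochain X p q \<phi> \<psi> \<in> carrier (cochain_space X (p + q))"
  by (simp add: cup_cochain_def)

lemma cup_cochain_zero: "cup_cochain X p q (\<lambda>_. 0) \<psi> = (\<lambda>_. 0)" "cup_cochain X p q \<phi> (\<lambda>_. 0) = (\<lambda>_. 0)"
  by (auto simp: cup_cochain_def)

lemma cup_cochain_cocycles: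
  assumes "\<phi> \<in> cocycles X p" "\<psi> \<in> cocycles X q"
  shows "cup_cochain X p q \<phi> \<psi> \<in> cocycles X (p + q)"
proof -
  have "coboundary X (p + q) (cup_cochain X p q \<phi> \<psi>) = (\<lambda>_. 0)"
    using assms by (simp add: coboundary_cup cocycles_def cup_cochain_zero)
  then show ?thesis using cup_cochain_carrier[of X p q \<phi> \<psi>] by (simp add: cocycles_def)
qed

text \<open>By the Leibniz rule, the product of the coboundary of \<eta> with a cocycle \<psi> is
  the coboundary of the product of \<eta> and \<psi>. In degree 0 the only coboundary is 0.\<close>

lemma cup_cochain_coboundary_left:
  assumes "\<phi> \<in> coboundaries X p" "\<psi> \<in> cocycles X q"
  shows "cup_cochain X p q \<phi> \<psi> \<in> coboundaries X (p + q)"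
proof (cases p)
  case 0
  then show ?thesis using assms by (simp add: coboundaries_def cup_cochain_zero coboundaries_zero[unfolded coboundaries_def])
next
  case (Suc r)
  obtain \<eta> where "\<phi> = coboundary X r \<eta>" using assms(1) Suc by (auto simp: coboundaries_def)
  then have "cup_cochain X p q \<phi> \<psi> = coboundary X (r + q) (cup_cochain X r q \<eta> \<psi>)"
    using assms(2) Suc by (simp add: coboundary_cup cocycles_def cup_cochain_zero)
  then show ?thesis using Suc coboundariesI[OF cup_cochain_carrier] by simp
qed

lemma cup_cochain_scale:
  "cup_cochain X p q (\<lambda>\<sigma>. a * \<phi> \<sigma>) \<psi> = (\<lambda>\<sigma>. a * cup_cochain X p q \<phi> \<psi> \<sigma>)"
  "cup_cochain X p q \<phi> (\<lambda>\<sigma>. a * \<psi> \<sigma>) = (\<lambda>\<sigma>. a * cup_cochain X p q \<phi> \<psi> \<sigma>)"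
  by (auto simp: cup_cochain_def)

lemma cup_cochain_add:
  "cup_cochain X p q (\<lambda>\<sigma>. \<phi> \<sigma> + \<phi>' \<sigma>) \<psi> = (\<lambda>\<sigma>. cup_cochain X p q \<phi> \<psi> \<sigma> + cup_cochain X p q \<phi>' \<psi> \<sigma>)"
  "cup_cochain X p q \<phi> (\<lambda>\<sigma>. \<psi> \<sigma> + \<psi>' \<sigma>) = (\<lambda>\<sigma>. cup_cochain X p q \<phi> \<psi> \<sigma> + cup_cochain X p q \<phi> \<psi>' \<sigma>)"
  by (auto simp: cup_cochain_def algebra_simps)

lemma cup_cochain_coboundary_right:
  assumes "\<phi> \<in> cocycles X p" "\<psi> \<in> coboundaries X q"
  shows "cup_cochain X p q \<phi> \<psi> \<in> coboundaries X (p + q)"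
proof (cases q)
  case 0
  then have "\<psi> = (\<lambda>_. 0)" using assms(2) by (simp add: coboundaries_def)
  then show ?thesis by (simp add: cup_cochain_zero coboundaries_zero)
next
  case (Suc r)
  obtain \<eta> where \<eta>: "\<psi> = coboundary X r \<eta>" using assms(2) Suc by (auto simp: coboundaries_def)
  have "(-1) ^ p * ((-1) ^ p * z) = z" for z :: 'b by (simp flip: mult.assoc power_add)
  then have "cup_cochain X p q \<phi> \<psi> = (\<lambda>\<sigma>. (-1) ^ p * coboundary X (p + r) (cup_cochain X p r \<phi> \<eta>) \<sigma>)"
    using assms(1) Suc \<eta> by (simp add: coboundary_cup cocycles_def cup_cochain_zero)
  then have "cup_cochain X p q \<phi> \<psi> = coboundary X (p + r) (\<lambda>\<sigma>. (-1) ^ p * cup_cochain X p r \<phi> \<eta> \<sigma>)"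
    by (simp only: coboundary_scale)
  then show ?thesis
    using Suc coboundariesI[of "\<lambda>\<sigma>. (-1) ^ p * cup_cochain X p r \<phi> \<eta> \<sigma>" X "p + r"] cup_cochain_carrier[of X p r \<phi> \<eta>]
    by simp
qed

text \<open>The product of classes is defined as a union over all representatives; it is a single
  class because another representative changes the cochain product by a coboundary.\<close>

lemma cup_cocycle_class:
  assumes \<phi>: "\<phi> \<in> cocycles X p" and \<psi>: "\<psi> \<in> cocycles X q"
  shows "cup X p q (cocycle_class X p \<phi>) (cocycle_class X q \<psi>) =
    cocycle_class X (p + q) (cup_cochain X p q \<phi> \<psi>)"
proof -
  \<comment> \<open>A coset involves addition only, which is the same for cochains and for
    cocycles.\<close>
  have coset: "coboundaries X (p + q) +>\<^bsub>cochain_space X (p + q)\<^esub> \<theta> = cocycle_class X (p + q) \<theta>"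
    for \<theta> :: "('a, 'b) cochain"
    by (simp add: a_r_coset_def')
  have eq: "cocycle_class X (p + q) (cup_cochain X p q \<phi>' \<psi>') = cocycle_class X (p + q) (cup_cochain X p q \<phi> \<psi>)"
    if "\<phi>' \<in> cocycle_class X p \<phi>" "\<psi>' \<in> cocycle_class X q \<psi>" for \<phi>' \<psi>'
  proof -
    have \<phi>': "\<phi>' \<in> cocycles X p" "(\<lambda>\<sigma>. \<phi>' \<sigma> - \<phi> \<sigma>) \<in> coboundaries X p"
      and \<psi>': "\<psi>' \<in> cocycles X q" "(\<lambda>\<sigma>. \<psi>' \<sigma> - \<psi> \<sigma>) \<in> coboundaries X q"
      using that \<phi> \<psi> by (simp_all add: in_cocycle_class_iff)
    \<comment> \<open>Vary one factor at a time.\<close>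
    have "(\<lambda>\<sigma>. cup_cochain X p q \<phi>' \<psi>' \<sigma> - cup_cochain X p q \<phi> \<psi> \<sigma>) =
      (\<lambda>\<sigma>. cup_cochain X p q (\<lambda>\<sigma>. \<phi>' \<sigma> - \<phi> \<sigma>) \<psi>' \<sigma> + cup_cochain X p q \<phi> (\<lambda>\<sigma>. \<psi>' \<sigma> - \<psi> \<sigma>) \<sigma>)"
      by (auto simp: cup_cochain_def algebra_simps)
    also have "\<dots> \<in> coboundaries X (p + q)"
      using H.W_add[OF cup_cochain_coboundary_left[OF \<phi>'(2) \<psi>'(1)] cup_cochain_coboundary_right[OF \<phi> \<psi>'(2)]]
      by simp
    finally show ?thesis
      using \<phi> \<psi> \<phi>'(1) \<psi>'(1) by (simp add: cocycle_class_eq_iff cup_cochain_cocycles)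
  qed
  have "\<phi> \<in> cocycle_class X p \<phi>" "\<psi> \<in> cocycle_class X q \<psi>"
    using \<phi> \<psi> by (simp_all add: in_cocycle_class_iff coboundaries_zero)
  moreover have "cup X p q (cocycle_class X p \<phi>) (cocycle_class X q \<psi>) =
    (\<Union>\<phi>'\<in>cocycle_class X p \<phi>. \<Union>\<psi>'\<in>cocycle_class X q \<psi>. cocycle_class X (p + q) (cup_cochain X p q \<phi> \<psi>))"
    unfolding cup_def coset using eq by (intro SUP_cong refl)
  ultimately show ?thesis by auto
qed

lemma cup_closed:
  assumes "a \<in> carrier (cohomology X p)" "b \<in> carrier (cohomology X q)"
  shows "cup X p q a b \<in> carrier (cohomology X (p + q))"
  using assms by (elim cohomology_carrierE) (simp add: cup_cocycle_class cocycle_class_closed cup_cochain_cocycles)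

lemma cocycles_closed:
  "\<phi> \<in> cocycles X p \<Longrightarrow> \<psi> \<in> cocycles X p \<Longrightarrow> (\<lambda>\<sigma>. \<phi> \<sigma> + \<psi> \<sigma>) \<in> cocycles X p"
  "\<phi> \<in> cocycles X p \<Longrightarrow> (\<lambda>\<sigma>. a * \<phi> \<sigma>) \<in> cocycles X p"
  using function_spaceD(5,6)[OF function_space_cocycle_space[of X p]] by simp_all

lemma cup_add:
  assumes "a \<in> carrier (cohomology X p)" "a' \<in> carrier (cohomology X p)" "b \<in> carrier (cohomology X q)"
  shows "cup X p q (a \<oplus>\<^bsub>cohomology X p\<^esub> a') b = cup X p q a b \<oplus>\<^bsub>cohomology X (p + q)\<^esub> cup X p q a' b"
    "cup X q p b (a \<oplus>\<^bsub>cohomology X p\<^esub> a') = cup X q p b a \<oplus>\<^bsub>cohomology X (q + p)\<^esub> cup X q p b a'"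
  using assms
  by (elim cohomology_carrierE; simp add: cup_cocycle_class cocycle_class_add cocycles_closed
      cup_cochain_cocycles cup_cochain_add)+

lemma cup_smult:
  assumes "a \<in> carrier (cohomology X p)" "b \<in> carrier (cohomology X q)"
  shows "cup X p q (r \<odot>\<^bsub>cohomology X p\<^esub> a) b = r \<odot>\<^bsub>cohomology X (p + q)\<^esub> cup X p q a b"
    "cup X q p b (r \<odot>\<^bsub>cohomology X p\<^esub> a) = r \<odot>\<^bsub>cohomology X (q + p)\<^esub> cup X q p b a"
  using assms
  by (elim cohomology_carrierE; simp add: cup_cocycle_class cocycle_class_smult cocycles_closed
      cup_cochain_cocycles cup_cochain_scale)+

lemma cup_commute:
  assumes "a \<in> carrier (cohomology X n)" "b \<in> carrier (cohomology X n)" "1 \<le> n"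
  shows "cup X n n a b = (-1) ^ n \<odot>\<^bsub>cohomology X (n + n)\<^esub> cup X n n b a"
proof -
  obtain \<phi> where \<phi>: "\<phi> \<in> cocycles X n" "a = cocycle_class X n \<phi>" using assms(1) by (rule cohomology_carrierE)
  obtain \<psi> where \<psi>: "\<psi> \<in> cocycles X n" "b = cocycle_class X n \<psi>" using assms(2) by (rule cohomology_carrierE)
  show ?thesis
    using cup_cochain_commute[OF \<phi>(1) \<psi>(1) assms(3)] \<phi> \<psi>
    by (simp add: cup_cocycle_class cocycle_class_smult cocycle_class_eq_iff cup_cochain_cocycles
        cocycles_closed mult_2)
qed

lemma cohomology_space: "vectorspace class_ring (cohomology X p)"
  unfolding cohomology_eq by (rule H.quotient_space)

section \<open>The differential\<close>

text \<open>With N a space of relations, this reduces statements about products of representatives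
  to basis elements in one factor.\<close>

lemma lin_val_closed:
  assumes "g \<in> carrier (free_space S)"
    and N: "(\<lambda>_. 0) \<in> N" "\<And>f g. f \<in> N \<Longrightarrow> g \<in> N \<Longrightarrow> (\<lambda>s. f s + g s) \<in> N"
      "\<And>a f. f \<in> N \<Longrightarrow> (\<lambda>s. a * f s) \<in> N"
    and K: "\<And>y. y \<in> S \<Longrightarrow> K y \<in> N"
  shows "(\<lambda>z. lin_val (\<lambda>y. K y z) g) \<in> N"
  using assms(1)
proof (induction g rule: free_space_induct)
  case zero
  then show ?case using N by simp
next
  case (single s)
  then show ?case using K by simp
next
  case (add f g)
  then show ?case using N(2) by (simp add: lin_val_add free_space_finite)
next
  case (scale a f)
  then show ?case using N(3) by (simp add: lin_val_scale)
qed

lemma lin_val_lin_val: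
  assumes "g \<in> carrier (free_space S)" "\<And>y. y \<in> S \<Longrightarrow> K y \<in> carrier (free_space S')"
  shows "lin_val \<beta> (\<lambda>z. lin_val (\<lambda>y. K y z) g) = lin_val (\<lambda>y. lin_val \<beta> (K y)) g"
proof -
  have c: "(\<lambda>z. lin_val (\<lambda>y. K y z) g) \<in> carrier (free_space S')" if "g \<in> carrier (free_space S)" for g
    using that function_spaceD(4-6)[OF function_space_free_space[of S']] assms(2) by (intro lin_val_closed) auto
  show ?thesis
    using assms(1)
  proof (induction g rule: free_space_induct)
    case (add f g)
    then show ?case
      using c[of f] c[of g] by (simp add: lin_val_add free_space_finite)
  qed (simp_all add: lin_val_scale)
qed

text \<open>The exponent contains n (n - 1), which is even; so pieces of cohomological degree n are
  multiplied without signs.\<close>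

lemma koszul_sign_U_A: "koszul_sign (U_deg n s) (A_deg n) = 1"
  by (simp add: koszul_sign_def U_deg_def A_deg_def)

text \<open>The element \<kappa> has degree -n + (n - 1) = -1, so the sign is the parity of n + s (n
  - 1), which for even s is that of n.\<close>

lemma koszul_sign_kappa: "even s \<Longrightarrow> koszul_sign (A_deg n + U_deg n 1) (A_deg n + U_deg n s) = (-1) ^ n"
  by (simp add: koszul_sign_def U_deg_def A_deg_def uminus_power_if)

context tensor_pair
begin

lemma R_add_left:
  "v \<in> carrier V \<Longrightarrow> v' \<in> carrier V \<Longrightarrow> w \<in> carrier W \<Longrightarrow>
    (\<lambda>z. single (v \<oplus>\<^bsub>V\<^esub> v', w) z - single (v, w) z - single (v', w) z) \<in> R"
  by (rule generators_in_R) (unfold tensor_generators_def, blast)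

lemma R_add_right:
  "v \<in> carrier V \<Longrightarrow> w \<in> carrier W \<Longrightarrow> w' \<in> carrier W \<Longrightarrow>
    (\<lambda>z. single (v, w \<oplus>\<^bsub>W\<^esub> w') z - single (v, w) z - single (v, w') z) \<in> R"
  by (rule generators_in_R) (unfold tensor_generators_def, blast)

lemma R_smult_left:
  "v \<in> carrier V \<Longrightarrow> w \<in> carrier W \<Longrightarrow> (\<lambda>z. single (a \<odot>\<^bsub>V\<^esub> v, w) z - a * single (v, w) z) \<in> R"
  by (rule generators_in_R) (unfold tensor_generators_def, blast)

lemma R_smult_right:
  "v \<in> carrier V \<Longrightarrow> w \<in> carrier W \<Longrightarrow> (\<lambda>z. single (v, a \<odot>\<^bsub>W\<^esub> w) z - a * single (v, w) z) \<in> R"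
  by (rule generators_in_R) (unfold tensor_generators_def, blast)

end

text \<open>Functoriality of the tensor product on representatives: the linear maps \<alpha> and
  \<mu> induce \<alpha> \<otimes> \<mu>.\<close>

lemma tensor_map_R:
  fixes V :: "('k::field, 'v, 'r) module_scheme" and W :: "('k, 'w, 's) module_scheme"
    and V' :: "('k, 'v2, 'r2) module_scheme" and W' :: "('k, 'w2, 's2) module_scheme"
  assumes "tensor_pair V W" "tensor_pair V' W'" "f \<in> tensor_relations V W"
    and \<alpha>: "\<And>a. a \<in> carrier V \<Longrightarrow> \<alpha> a \<in> carrier V'"
      "\<And>a a'. a \<in> carrier V \<Longrightarrow> a' \<in> carrier V \<Longrightarrow> \<alpha> (a \<oplus>\<^bsub>V\<^esub> a') = \<alpha> a \<oplus>\<^bsub>V'\<^esub> \<alpha> a'"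
      "\<And>r a. a \<in> carrier V \<Longrightarrow> \<alpha> (r \<odot>\<^bsub>V\<^esub> a) = r \<odot>\<^bsub>V'\<^esub> \<alpha> a"
    and \<mu>: "\<And>u. u \<in> carrier W \<Longrightarrow> \<mu> u \<in> carrier W'"
      "\<And>u u'. u \<in> carrier W \<Longrightarrow> u' \<in> carrier W \<Longrightarrow> \<mu> (u \<oplus>\<^bsub>W\<^esub> u') = \<mu> u \<oplus>\<^bsub>W'\<^esub> \<mu> u'"
      "\<And>r u. u \<in> carrier W \<Longrightarrow> \<mu> (r \<odot>\<^bsub>W\<^esub> u) = r \<odot>\<^bsub>W'\<^esub> \<mu> u"
  shows "(\<lambda>z. lin_val (\<lambda>y. single (\<alpha> (fst y), \<mu> (snd y)) z) f) \<in> tensor_relations V' W'"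
proof -
  interpret A: tensor_pair V W by fact
  interpret B: tensor_pair V' W' by fact
  show ?thesis
  proof (rule A.lin_val_R[OF assms(3) B.R_function_space(1-3)])
    fix v v' w assume "v \<in> carrier V" "v' \<in> carrier V" "w \<in> carrier W"
    then show "(\<lambda>z. single (\<alpha> (fst (v \<oplus>\<^bsub>V\<^esub> v', w)), \<mu> (snd (v \<oplus>\<^bsub>V\<^esub> v', w))) z -
      single (\<alpha> (fst (v, w)), \<mu> (snd (v, w))) z - single (\<alpha> (fst (v', w)), \<mu> (snd (v', w))) z) \<in> B.R"
      by (simp add: B.R_add_left \<alpha> \<mu>)
  next
    fix v w w' assume "v \<in> carrier V" "w \<in> carrier W" "w' \<in> carrier W"
    then show "(\<lambda>z. single (\<alpha> (fst (v, w \<oplus>\<^bsub>W\<^esub> w')), \<mu> (snd (v, w \<oplus>\<^bsub>W\<^esub> w'))) z -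
      single (\<alpha> (fst (v, w)), \<mu> (snd (v, w))) z - single (\<alpha> (fst (v, w')), \<mu> (snd (v, w'))) z) \<in> B.R"
      by (simp add: B.R_add_right \<alpha> \<mu>)
  next
    fix a v w assume "v \<in> carrier V" "w \<in> carrier W"
    then show "(\<lambda>z. single (\<alpha> (fst (a \<odot>\<^bsub>V\<^esub> v, w)), \<mu> (snd (a \<odot>\<^bsub>V\<^esub> v, w))) z -
      a * single (\<alpha> (fst (v, w)), \<mu> (snd (v, w))) z) \<in> B.R"
      by (simp add: B.R_smult_left \<alpha> \<mu>)
  next
    fix a v w assume "v \<in> carrier V" "w \<in> carrier W"
    then show "(\<lambda>z. single (\<alpha> (fst (v, a \<odot>\<^bsub>W\<^esub> w)), \<mu> (snd (v, a \<odot>\<^bsub>W\<^esub> w))) z -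
      a * single (\<alpha> (fst (v, w)), \<mu> (snd (v, w))) z) \<in> B.R"
      by (simp add: B.R_smult_right \<alpha> \<mu>)
  qed
qed

section \<open>Products and the differential on representatives\<close>

locale loop_complex = U_algebra n m c
  for n m :: nat and c :: "nat \<Rightarrow> nat \<Rightarrow> 'k::field" +
  fixes X :: "'a topology" and x :: "nat \<Rightarrow> ('a, 'k) cochain set"
  assumes n_pos: "1 \<le> n" and x_carrier: "\<And>i. i < m \<Longrightarrow> x i \<in> carrier (cohomology X n)"
begin

abbreviation H where "H p \<equiv> cohomology X p :: ('k, ('a, 'k) cochain set) module"

abbreviation UU where "UU s \<equiv> U_part n m c s"

abbreviation U_times (infixl \<open>\<star>\<close> 70) where "u \<star> v \<equiv> u \<otimes>\<^bsub>U_alg n m c\<^esub> v"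

declare U_part_simps [simp del]

lemma tensor_pair_AU: "tensor_pair (H p) (UU s)"
proof -
  interpret V: vectorspace class_ring "H p" by (rule cohomology_space)
  show ?thesis
    using V.smult_closed by unfold_locales (simp_all add: U_part_add_closed U_part_smult_closed)
qed

sublocale AU: tensor_pair "H p" "UU s" for p s
  by (rule tensor_pair_AU)

abbreviation F where "F p s \<equiv> free_space (carrier (H p) \<times> carrier (UU s)) ::
  ('k, ('a, 'k) cochain set \<times> (nat list \<Rightarrow> 'k) set \<Rightarrow> 'k) module"

abbreviation R where "R p s \<equiv> tensor_relations (H p) (UU s)"

abbreviation cls where "cls p s f \<equiv> R p s +>\<^bsub>F p s\<^esub> f"

lemma AU_eq: "AU X n m c p s = quot_module (F p s) (R p s)"
  by (simp add: AU_def AU.tensor_eq)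

text \<open>The product of H^n \<otimes> U(s) with H^n \<otimes> U(t) before passage to the
  quotient. The Koszul sign is absent because it is 1 by \<open>koszul_sign_U_A\<close>.\<close>

definition mult_rep where
  "mult_rep f g = (\<lambda>z. lin_val (\<lambda>y. lin_val (\<lambda>y'.
     single (cup X n n (fst y) (fst y'), snd y \<star> snd y') z) g) f)"

lemma mult_rep_swap:
  assumes "f \<in> carrier (F n s)" "g \<in> carrier (F n t)"
  shows "mult_rep f g = (\<lambda>z. lin_val (\<lambda>y'. lin_val (\<lambda>y.
     single (cup X n n (fst y) (fst y'), snd y \<star> snd y') z) f) g)"
  unfolding mult_rep_def using assms by (intro ext lin_val_swap free_space_finite)

text \<open>Interchanging the sums fixes the right factor at a basis element (b, v). Multiplication
  by it is the tensor product of two linear maps, the cup product with b and right multiplication by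
  v.\<close>

lemma mult_rep_left:
  assumes f: "f \<in> R n s" and g: "g \<in> carrier (F n t)"
  shows "mult_rep f g \<in> R (n + n) (s + t)"
proof -
  have "f \<in> carrier (F n s)" using f AU.T.W_carrier by blast
  moreover have "(\<lambda>z. lin_val (\<lambda>y'. lin_val (\<lambda>y.
     single (cup X n n (fst y) (fst y'), snd y \<star> snd y') z) f) g) \<in> R (n + n) (s + t)"
  proof (rule lin_val_closed[OF g AU.R_function_space(1-3)])
    fix y' assume "y' \<in> carrier (H n) \<times> carrier (UU t)"
    then have "fst y' \<in> carrier (H n)" "snd y' \<in> carrier (UU t)" by auto
    then show "(\<lambda>z. lin_val (\<lambda>y. single (cup X n n (fst y) (fst y'), snd y \<star> snd y') z) f) \<in> R (n + n) (s + t)"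
      by (intro tensor_map_R[OF tensor_pair_AU tensor_pair_AU f])
        (simp_all add: cup_closed cup_add cup_smult U_part_mult_closed U_mult_add[of _ s _ _ t] U_part_simps(2,4))
  qed
  ultimately show ?thesis using mult_rep_swap[OF _ g] by simp
qed

lemma mult_rep_right:
  assumes f: "f \<in> carrier (F n s)" and g: "g \<in> R n t"
  shows "mult_rep f g \<in> R (n + n) (s + t)"
  unfolding mult_rep_def
proof (rule lin_val_closed[OF f AU.R_function_space(1-3)])
  fix y assume "y \<in> carrier (H n) \<times> carrier (UU s)"
  then have "fst y \<in> carrier (H n)" "snd y \<in> carrier (UU s)" by auto
  then show "(\<lambda>z. lin_val (\<lambda>y'. single (cup X n n (fst y) (fst y'), snd y \<star> snd y') z) g) \<in> R (n + n) (s + t)"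
    by (intro tensor_map_R[OF tensor_pair_AU tensor_pair_AU g])
      (simp_all add: cup_closed cup_add cup_smult U_part_mult_closed U_mult_add[of _ t _ _ s] U_part_simps(2,4))
qed

lemma single_product_carrier:
  assumes "y \<in> carrier (H n) \<times> carrier (UU s)" "y' \<in> carrier (H n) \<times> carrier (UU t)"
  shows "single (cup X n n (fst y) (fst y'), snd y \<star> snd y') \<in> carrier (F (n + n) (s + t))"
  using assms by (intro single_in_free_space) (auto simp: cup_closed U_part_mult_closed)

lemmas F_closed = function_spaceD(4-6)[OF function_space_free_space[of "carrier (H p) \<times> carrier (UU s)" for p s]]
  and F_diff = function_space_diff_closed[OF function_space_free_space[of "carrier (H p) \<times> carrier (UU s)" for p s]]

lemma mult_rep_carrier:
  assumes f: "f \<in> carrier (F n s)" and g: "g \<in> carrier (F n t)"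
  shows "mult_rep f g \<in> carrier (F (n + n) (s + t))"
  unfolding mult_rep_def
  by (intro lin_val_closed[OF f F_closed] lin_val_closed[OF g F_closed] single_product_carrier)

lemma lin_val_mult_rep:
  assumes f: "f \<in> carrier (F n s)" and g: "g \<in> carrier (F n t)"
  shows "lin_val \<beta> (mult_rep f g) =
    lin_val (\<lambda>y. lin_val (\<lambda>y'. \<beta> (cup X n n (fst y) (fst y'), snd y \<star> snd y')) g) f"
proof -
  have "lin_val \<beta> (mult_rep f g) =
      lin_val (\<lambda>y. lin_val \<beta> (\<lambda>z. lin_val (\<lambda>y'. single (cup X n n (fst y) (fst y'), snd y \<star> snd y') z) g)) f"
    unfolding mult_rep_def
    by (rule lin_val_lin_val[OF f, where S' = "carrier (H (n + n)) \<times> carrier (UU (s + t))"])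
      (intro lin_val_closed[OF g F_closed] single_product_carrier)
  also have "\<dots> = lin_val (\<lambda>y. lin_val (\<lambda>y'. \<beta> (cup X n n (fst y) (fst y'), snd y \<star> snd y')) g) f"
  proof (rule lin_val_cong)
    fix y assume "f y \<noteq> 0"
    then have "y \<in> carrier (H n) \<times> carrier (UU s)" using f by (auto simp: free_space_carrier)
    then show "lin_val \<beta> (\<lambda>z. lin_val (\<lambda>y'. single (cup X n n (fst y) (fst y'), snd y \<star> snd y') z) g) =
        lin_val (\<lambda>y'. \<beta> (cup X n n (fst y) (fst y'), snd y \<star> snd y')) g"
      by (subst lin_val_lin_val[OF g single_product_carrier]) simp_all
  qed
  finally show ?thesis .
qed

lemma mult_rep_add_right:
  assumes "g \<in> carrier (F n t)" "g' \<in> carrier (F n t)"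
  shows "mult_rep f (\<lambda>y. g y + g' y) = (\<lambda>z. mult_rep f g z + mult_rep f g' z)"
  using assms by (simp add: mult_rep_def lin_val_add free_space_finite lin_val_add_right)

lemma mult_rep_add_left:
  assumes "f \<in> carrier (F n s)" "f' \<in> carrier (F n s)"
  shows "mult_rep (\<lambda>y. f y + f' y) g = (\<lambda>z. mult_rep f g z + mult_rep f' g z)"
  using assms by (simp add: mult_rep_def lin_val_add free_space_finite)

lemma mult_rep_scale:
  "mult_rep (\<lambda>y. a * f y) g = (\<lambda>z. a * mult_rep f g z)" "mult_rep f (\<lambda>y. a * g y) = (\<lambda>z. a * mult_rep f g z)"
  by (simp_all add: mult_rep_def lin_val_scale lin_val_scale_right)

lemma in_cls_iff:
  "g \<in> carrier (F p s) \<Longrightarrow> f \<in> cls p s g \<longleftrightarrow> f \<in> carrier (F p s) \<and> (\<lambda>y. f y - g y) \<in> R p s"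
  using AU.T.in_cl_iff[of g p s f] function_space_minus[OF function_space_free_space, of f _ g] by auto

lemma cls_eq_iff:
  "f \<in> carrier (F p s) \<Longrightarrow> g \<in> carrier (F p s) \<Longrightarrow> cls p s f = cls p s g \<longleftrightarrow> (\<lambda>y. f y - g y) \<in> R p s"
  using AU.T.cl_eq_iff[of f p s g] function_space_minus[OF function_space_free_space, of f _ g] by auto

lemma AU_mult_cls:
  assumes f: "f \<in> carrier (F n s)" and g: "g \<in> carrier (F n t)"
  shows "AU_mult X n m c n s n t (cls n s f) (cls n t g) = cls (n + n) (s + t) (mult_rep f g)"
proof -
  \<comment> \<open>The sum in the definition of the product, with its sign evaluated to 1, is the
    iterated linear extension.\<close>
  have rep: "(\<lambda>z. \<Sum>(a, u) \<in> {y. f' y \<noteq> 0}. \<Sum>(b, v) \<in> {y. g' y \<noteq> 0}.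
           koszul_sign (U_deg n s) (A_deg n) * f' (a, u) * g' (b, v) * single (cup X n n a b, u \<star> v) z) = mult_rep f' g'"
    for f' g' :: "('a, 'k) cochain set \<times> (nat list \<Rightarrow> 'k) set \<Rightarrow> 'k"
    by (simp add: mult_rep_def lin_val_def koszul_sign_U_A split_def sum_distrib_left mult.assoc)
  have eq: "cls (n + n) (s + t) (mult_rep f' g') = cls (n + n) (s + t) (mult_rep f g)"
    if "f' \<in> cls n s f" "g' \<in> cls n t g" for f' g'
  proof -
    have f': "f' \<in> carrier (F n s)" "(\<lambda>y. f' y - f y) \<in> R n s" using that f by (simp_all add: in_cls_iff)
    have g': "g' \<in> carrier (F n t)" "(\<lambda>y. g' y - g y) \<in> R n t" using that g by (simp_all add: in_cls_iff)
    have "mult_rep (\<lambda>y. (f' y - f y) + f y) g' = (\<lambda>z. mult_rep (\<lambda>y. f' y - f y) g' z + mult_rep f g' z)"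
      by (rule mult_rep_add_left[OF F_diff[OF f'(1) f] f])
    moreover have "mult_rep f (\<lambda>y. (g' y - g y) + g y) = (\<lambda>z. mult_rep f (\<lambda>y. g' y - g y) z + mult_rep f g z)"
      by (rule mult_rep_add_right[OF F_diff[OF g'(1) g] g])
    ultimately have "(\<lambda>z. mult_rep f' g' z - mult_rep f g z) =
        (\<lambda>z. mult_rep (\<lambda>y. f' y - f y) g' z + mult_rep f (\<lambda>y. g' y - g y) z)"
      by (simp add: fun_eq_iff)
    also have "\<dots> \<in> R (n + n) (s + t)"
      by (intro AU.R_function_space(2) mult_rep_left mult_rep_right f f' g g')
    finally show ?thesis using f g f' g' by (simp add: cls_eq_iff mult_rep_carrier)
  qed
  have "f \<in> cls n s f" "g \<in> cls n t g"
    using f g AU.R_function_space(1) by (simp_all add: in_cls_iff)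
  moreover have "AU_mult X n m c n s n t (cls n s f) (cls n t g) =
    (\<Union>f'\<in>cls n s f. \<Union>g'\<in>cls n t g. cls (n + n) (s + t) (mult_rep f g))"
    unfolding AU_mult_def Let_def rep using eq by (intro SUP_cong refl)
  ultimately show ?thesis by auto
qed

definition kappa_rep where
  "kappa_rep = (\<lambda>z. \<Sum>i<m. single (x i, U_gen n m c i) z :: 'k)"

lemma U_gen_carrier: "i < m \<Longrightarrow> U_gen n m c i \<in> carrier (UU 1)"
proof -
  assume "i < m"
  then have "single [i] \<in> carrier T" by (simp add: single_in_free_space)
  moreover have "homogeneous 1 (single [i] :: nat list \<Rightarrow> 'k)" by (simp add: homogeneous_def single_def)
  ultimately show ?thesis unfolding U_gen_def by (rule U_partI)
qed

lemma single_kappa: "i < m \<Longrightarrow> single (x i, U_gen n m c i) \<in> carrier (F n 1)"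
  by (intro single_in_free_space SigmaI x_carrier U_gen_carrier)

lemma kappa_eq: "kappa X n m c x = cls n 1 kappa_rep" and kappa_rep_carrier: "kappa_rep \<in> carrier (F n 1)"
proof -
  have s: "(\<lambda>i. single (x i, U_gen n m c i)) \<in> {..<m} \<rightarrow> carrier (F n 1)"
    using single_kappa by auto
  have "finsum (F n 1) (\<lambda>i. single (x i, U_gen n m c i)) {..<m} = kappa_rep"
    unfolding kappa_rep_def by (rule function_space_finsum[OF function_space_free_space _ s]) simp
  moreover have "(\<lambda>z. \<Sum>i<k. single (x i, U_gen n m c i) z) \<in> carrier (F n 1)" if "k \<le> m" for k
    using that
  proof (induction k)
    case 0
    then show ?case using F_closed(1)[of n 1] by simp
  next
    case (Suc k)
    then show ?case using F_closed(2)[OF _ single_kappa[of k]] by simp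
  qed
  ultimately show "kappa_rep \<in> carrier (F n 1)" "kappa X n m c x = cls n 1 kappa_rep"
    using AU.T.cl_finsum[OF _ s] by (simp_all add: kappa_def AU_eq pure_tensor_def kappa_rep_def)
qed

definition diff_rep where
  "diff_rep e g = (\<lambda>z. mult_rep kappa_rep g z - e * mult_rep g kappa_rep z)"

lemma diff_rep_carrier: "g \<in> carrier (F n s) \<Longrightarrow> diff_rep e g \<in> carrier (F (n + n) (s + 1))"
  unfolding diff_rep_def
  using mult_rep_carrier[OF kappa_rep_carrier, of g s] mult_rep_carrier[OF _ kappa_rep_carrier, of g s]
  by (intro F_diff F_closed) (simp_all add: add.commute)

lemma AU_diff_cls:
  assumes g: "g \<in> carrier (F n s)"
  shows "AU_diff X n m c x n s (cls n s g) =
    cls (n + n) (s + 1) (diff_rep (koszul_sign (A_deg n + U_deg n 1) (A_deg n + U_deg n s)) g)"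
proof -
  let ?e = "koszul_sign (A_deg n + U_deg n 1) (A_deg n + U_deg n s) :: 'k"
  have c: "mult_rep kappa_rep g \<in> carrier (F (n + n) (s + 1))" "mult_rep g kappa_rep \<in> carrier (F (n + n) (s + 1))"
    using mult_rep_carrier[OF kappa_rep_carrier g] mult_rep_carrier[OF g kappa_rep_carrier] by (simp_all add: add.commute)
  have "AU_mult X n m c n 1 n s (kappa X n m c x) (cls n s g) = cls (n + n) (s + 1) (mult_rep kappa_rep g)"
    unfolding kappa_eq AU_mult_cls[OF kappa_rep_carrier g] by (simp only: add.commute)
  moreover have "AU_mult X n m c n s n 1 (cls n s g) (kappa X n m c x) = cls (n + n) (s + 1) (mult_rep g kappa_rep)"
    unfolding kappa_eq by (rule AU_mult_cls[OF g kappa_rep_carrier])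
  moreover have "?e \<odot>\<^bsub>AU X n m c (n + n) (s + 1)\<^esub> cls (n + n) (s + 1) (mult_rep g kappa_rep) =
      cls (n + n) (s + 1) (\<lambda>z. ?e * mult_rep g kappa_rep z)"
    unfolding AU_eq using AU.T.cl_smult[OF c(2), of ?e] by simp
  moreover have "cls (n + n) (s + 1) (mult_rep kappa_rep g) \<ominus>\<^bsub>AU X n m c (n + n) (s + 1)\<^esub>
      cls (n + n) (s + 1) (\<lambda>z. ?e * mult_rep g kappa_rep z) = cls (n + n) (s + 1) (diff_rep ?e g)"
    unfolding AU_eq diff_rep_def
    using AU.T.cl_minus[OF c(1) F_closed(3)[OF c(2), of ?e]]
      function_space_minus[OF function_space_free_space c(1) F_closed(3)[OF c(2), of ?e]] by simp
  ultimately show ?thesis unfolding AU_diff_def Let_def by (simp only:)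
qed

end

section \<open>The homology at the last spot\<close>

text \<open>The coordinate functional of a line; it turns top-dimensional cup products into
  scalars.\<close>

lemma basis_singleton_functional:
  assumes "vectorspace class_ring V" "is_basis V {b}"
  shows "\<exists>\<theta>. linear_functional V \<theta> \<and> \<theta> b = 1 \<and> b \<in> carrier V \<and> (\<forall>v \<in> carrier V. v = \<theta> v \<odot>\<^bsub>V\<^esub> b)"
proof -
  interpret V: vectorspace class_ring V by fact
  have b: "b \<in> carrier V" and li: "V.lin_indpt {b}" and gen: "V.span {b} = carrier V"
    using assms(2) by (auto simp: V.basis_def)
  have lincomb: "V.lincomb a {b} = a b \<odot>\<^bsub>V\<^esub> b" for a
    using b by (simp add: V.lincomb_def)
  have zero: "a = 0" if "a \<odot>\<^bsub>V\<^esub> b = \<zero>\<^bsub>V\<^esub>" for a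
  proof (rule ccontr)
    assume "a \<noteq> 0"
    then have "V.lin_dep {b}"
      unfolding V.lin_dep_def using that lincomb[of "\<lambda>_. a"]
      by (intro exI[of _ "{b}"] exI[of _ "\<lambda>_. a"] exI[of _ b]) auto
    with li show False by blast
  qed
  have ex: "\<exists>a. v = a \<odot>\<^bsub>V\<^esub> b" if "v \<in> carrier V" for v
  proof -
    have "v \<in> V.span {b}" using gen that by simp
    then obtain a where "v = V.lincomb a {b}"
      using V.finite_span[of "{b}"] b by auto
    then show ?thesis using lincomb by blast
  qed
  have l: "(a + a') \<odot>\<^bsub>V\<^esub> b = a \<odot>\<^bsub>V\<^esub> b \<oplus>\<^bsub>V\<^esub> a' \<odot>\<^bsub>V\<^esub> b" "(a * a') \<odot>\<^bsub>V\<^esub> b = a \<odot>\<^bsub>V\<^esub> (a' \<odot>\<^bsub>V\<^esub> b)"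
    "1 \<odot>\<^bsub>V\<^esub> b = b" "a \<odot>\<^bsub>V\<^esub> b \<in> carrier V" for a a'
    using V.smult_l_distr[of a a' b] V.smult_assoc1[of a a' b] V.smult_one[of b] V.smult_closed[of a b] b by simp_all
  have uniq: "a = a'" if "a \<odot>\<^bsub>V\<^esub> b = a' \<odot>\<^bsub>V\<^esub> b" for a a'
  proof -
    have "(a + - a') \<odot>\<^bsub>V\<^esub> b = (a' + - a') \<odot>\<^bsub>V\<^esub> b"
      using l(1)[of a "- a'"] l(1)[of a' "- a'"] that by simp
    then have "(a - a') \<odot>\<^bsub>V\<^esub> b = \<zero>\<^bsub>V\<^esub>" using V.smult_l_null[OF b] by simp
    then show ?thesis using zero[of "a - a'"] by simp
  qed
  define \<theta> where "\<theta> v = (SOME a. v = a \<odot>\<^bsub>V\<^esub> b)" for v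
  have \<theta>: "v = \<theta> v \<odot>\<^bsub>V\<^esub> b" if "v \<in> carrier V" for v
    unfolding \<theta>_def using someI_ex[OF ex[OF that]] .
  have eq: "\<theta> (a \<odot>\<^bsub>V\<^esub> b) = a" for a using \<theta>[OF l(4)[of a]] uniq by metis
  have "\<theta> (v \<oplus>\<^bsub>V\<^esub> w) = \<theta> v + \<theta> w" if "v \<in> carrier V" "w \<in> carrier V" for v w
    using \<theta>[OF that(1)] \<theta>[OF that(2)] l(1)[of "\<theta> v" "\<theta> w"] eq by metis
  moreover have "\<theta> (a \<odot>\<^bsub>V\<^esub> v) = a * \<theta> v" if "v \<in> carrier V" for a v
    using \<theta>[OF that] l(2)[of a "\<theta> v"] eq by metis
  ultimately show ?thesis
    using eq[of 1] l(3) b \<theta> by (intro exI[of _ \<theta>]) (simp add: linear_functional_def)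
qed

context loop_complex
begin

abbreviation AU2 where "AU2 s \<equiv> AU X n m c (n + n) (s + 1)"

abbreviation Bd where "Bd s \<equiv> AU_boundaries X n m c x 2 (s + 1)"

abbreviation Hom where "Hom s \<equiv> AU_homology X n m c x 2 (s + 1)"

lemma diff_rep_add:
  assumes "g \<in> carrier (F n s)" "g' \<in> carrier (F n s)"
  shows "diff_rep e (\<lambda>y. g y + g' y) = (\<lambda>z. diff_rep e g z + diff_rep e g' z)"
  using assms by (simp add: diff_rep_def mult_rep_add_right mult_rep_add_left algebra_simps)

lemma diff_rep_scale: "diff_rep e (\<lambda>y. a * g y) = (\<lambda>z. a * diff_rep e g z)"
  by (simp add: diff_rep_def mult_rep_scale algebra_simps)

abbreviation kappa_sgn where "kappa_sgn s \<equiv> koszul_sign (A_deg n + U_deg n 1) (A_deg n + U_deg n s) :: 'k"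

lemma AU_boundaries_eq:
  "Bd s = (\<lambda>g. cls (n + n) (s + 1) (diff_rep (kappa_sgn s) g)) ` carrier (F n s)"
proof -
  have "Bd s = AU_diff X n m c x n s ` carrier (AU X n m c n s)"
    by (simp add: AU_boundaries_def)
  also have "\<dots> = AU_diff X n m c x n s ` (cls n s ` carrier (F n s))"
    unfolding AU_eq AU.T.quotient_carrier ..
  also have "\<dots> = (\<lambda>g. cls (n + n) (s + 1) (diff_rep (kappa_sgn s) g)) ` carrier (F n s)"
    unfolding image_image by (intro image_cong refl AU_diff_cls)
  finally show ?thesis .
qed

lemma cls_add:
  "f \<in> carrier (F p s) \<Longrightarrow> g \<in> carrier (F p s) \<Longrightarrow>
    cls p s f \<oplus>\<^bsub>AU X n m c p s\<^esub> cls p s g = cls p s (\<lambda>z. f z + g z)"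
  unfolding AU_eq using AU.T.cl_add[of f p s g] by simp

lemma cls_smult:
  "f \<in> carrier (F p s) \<Longrightarrow> a \<odot>\<^bsub>AU X n m c p s\<^esub> cls p s f = cls p s (\<lambda>z. a * f z)"
  unfolding AU_eq using AU.T.cl_smult[of f p s a] by simp

lemma cls_closed: "f \<in> carrier (F p s) \<Longrightarrow> cls p s f \<in> carrier (AU X n m c p s)"
  unfolding AU_eq by (rule AU.T.cl_closed)

lemma AU_space: "vectorspace class_ring (AU X n m c p s)"
  unfolding AU_eq by (rule AU.T.quotient_space)

lemma AU_carrierE:
  assumes "P \<in> carrier (AU X n m c p s)"
  obtains f where "f \<in> carrier (F p s)" "P = cls p s f"
  using assms unfolding AU_eq AU.T.quotient_carrier by blast

lemma AU_boundaries_submodule: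
  "submodule class_ring (Bd s) (AU2 s)"
proof -
  let ?d = "\<lambda>g. cls (n + n) (s + 1) (diff_rep (kappa_sgn s) g)"
  interpret A: vectorspace class_ring "AU2 s" by (rule AU_space)
  have mem: "?d g \<in> Bd s" if "g \<in> carrier (F n s)" for g
    unfolding AU_boundaries_eq using that by (rule imageI)
  have E: "\<exists>g \<in> carrier (F n s). P = ?d g" if "P \<in> Bd s" for P
    using that unfolding AU_boundaries_eq by blast
  have smult: "a \<odot>\<^bsub>AU2 s\<^esub> ?d g = ?d (\<lambda>z. a * g z)" if "g \<in> carrier (F n s)" for a g
    using cls_smult[OF diff_rep_carrier[OF that], of a "kappa_sgn s"] by (simp only: diff_rep_scale)
  show ?thesis
  proof (rule submodule.intro)
    show "module class_ring (AU2 s)" by (rule A.module_axioms)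
    show "Bd s \<subseteq> carrier (AU2 s)"
      unfolding AU_boundaries_eq using cls_closed[OF diff_rep_carrier] by blast
    show "P \<oplus>\<^bsub>AU2 s\<^esub> Q \<in> Bd s"
      if P: "P \<in> Bd s" and Q: "Q \<in> Bd s" for P Q
    proof -
      obtain g h where g: "g \<in> carrier (F n s)" "P = ?d g" and h: "h \<in> carrier (F n s)" "Q = ?d h"
        using E[OF P] E[OF Q] by blast
      have "P \<oplus>\<^bsub>AU2 s\<^esub> Q = ?d (\<lambda>z. g z + h z)"
        unfolding g(2) h(2) using cls_add[OF diff_rep_carrier[OF g(1)] diff_rep_carrier[OF h(1)]]
        by (simp only: diff_rep_add[OF g(1) h(1)])
      then show ?thesis using mem[OF F_closed(2)[OF g(1) h(1)]] by simp
    qed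
    \<comment> \<open>Zero is the boundary of the zero function scaled by 0; \<open>0 * 0\<close> is
      the shape that \<open>smult\<close> produces.\<close>
    have z: "\<zero>\<^bsub>AU2 s\<^esub> = ?d (\<lambda>z. 0 * 0)"
      using smult[OF F_closed(1), of 0] cls_closed[OF diff_rep_carrier[OF F_closed(1)]]
        A.smult_l_null[of "?d (\<lambda>_. 0)"] by simp
    show "\<zero>\<^bsub>AU2 s\<^esub> \<in> Bd s"
      unfolding z using mem[OF F_closed(1)] by simp
    show "a \<odot>\<^bsub>AU2 s\<^esub> P \<in> Bd s"
      if "P \<in> Bd s" for a P
      using E[OF that] smult mem[OF F_closed(3)] by metis
  qed
qed

sublocale B: space_quotient "AU2 s" "Bd s" for s
  by (intro space_quotient.intro AU_space AU_boundaries_submodule)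

text \<open>The complex ends at A(2), where everything is a cycle, so the homology is a
  cokernel.\<close>

lemma AU_homology_eq:
  "Hom s = quot_module (AU2 s) (Bd s)"
  by (simp add: AU_homology_def AU_cycles_def mult_2)

text \<open>The composite of two projections: from finitely supported functions to the tensor
  product, and from there to the homology.\<close>

definition hcls where
  "hcls s f = Bd s +>\<^bsub>AU2 s\<^esub> cls (n + n) (s + 1) f"

lemma hcls:
  assumes "f \<in> carrier (F (n + n) (s + 1))"
  shows "hcls s f \<in> carrier (Hom s)"
    "g \<in> carrier (F (n + n) (s + 1)) \<Longrightarrow>
      hcls s f \<oplus>\<^bsub>Hom s\<^esub> hcls s g = hcls s (\<lambda>z. f z + g z)"
    "a \<odot>\<^bsub>Hom s\<^esub> hcls s f = hcls s (\<lambda>z. a * f z)"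
  unfolding hcls_def AU_homology_eq
  using assms by (simp_all only: B.cl_closed B.cl_add B.cl_smult cls_closed cls_add cls_smult)

lemma hcls_relation:
  assumes "f \<in> R (n + n) (s + 1)"
  shows "hcls s f = \<zero>\<^bsub>Hom s\<^esub>"
proof -
  have "f \<in> carrier (F (n + n) (s + 1))" using assms AU.T.W_carrier by blast
  then have "cls (n + n) (s + 1) f = \<zero>\<^bsub>AU2 s\<^esub>"
    unfolding AU_eq using assms AU.T.cl_zero by blast
  then show ?thesis
    unfolding hcls_def AU_homology_eq using B.cl_zero[of "\<zero>\<^bsub>AU2 s\<^esub>" s] B.W_zero B.V.zero_closed
    by simp
qed

lemma AU_homology_space: "vectorspace class_ring (Hom s)"
  unfolding AU_homology_eq by (rule B.quotient_space)

text \<open>H^(2n) is spanned by b and U(s+1) by the finitely many words of length s+1, so the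
  tensors of b with these words span the homology.\<close>

lemma AU_homology_fin_dim:
  assumes b: "b \<in> carrier (H (n + n))" "\<And>v. v \<in> carrier (H (n + n)) \<Longrightarrow> v = \<theta> v \<odot>\<^bsub>H (n + n)\<^esub> b"
  shows "vectorspace.fin_dim class_ring (Hom s)"
proof (rule fin_dimI[OF AU_homology_space])
  let ?L = "{w \<in> lists {..<m}. length w = s + 1}"
  let ?S = "(\<lambda>w. hcls s (single (b, U.cl (single w)))) ` ?L"
  have U_cl: "U.cl f \<in> carrier (UU (s + 1))" if "f \<in> carrier (free_space ?L)" for f
    using that by (intro U_partI) (auto simp: free_space_carrier homogeneous_def)
  have sc: "single (v, u) \<in> carrier (F (n + n) (s + 1))"
    if "v \<in> carrier (H (n + n))" "u \<in> carrier (UU (s + 1))" for v u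
    using that by (intro single_in_free_space) simp
  have "?L = {w. set w \<subseteq> {..<m} \<and> length w = s + 1}" by auto
  then have "finite ?L" by (simp only: finite_lists_length_eq[OF finite_lessThan])
  then show "finite ?S" by (rule finite_imageI)
  show "?S \<subseteq> carrier (Hom s)"
    by (intro image_subsetI hcls(1) sc b(1) U_cl single_in_free_space)
  fix N assume N: "submodule class_ring N (Hom s)" and S: "?S \<subseteq> N"
  have N_add: "\<And>P Q. P \<in> N \<Longrightarrow> Q \<in> N \<Longrightarrow> P \<oplus>\<^bsub>Hom s\<^esub> Q \<in> N"
    and N_smult: "\<And>a P. P \<in> N \<Longrightarrow> a \<odot>\<^bsub>Hom s\<^esub> P \<in> N"
    and N_zero: "\<zero>\<^bsub>Hom s\<^esub> \<in> N"
    using submodule.m_closed[OF N] submodule.smult_closed[OF N] submodule.zero_closed[OF N] by auto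
  \<comment> \<open>The subspace N pulled back to the free space, where induction over elements is
    available.\<close>
  define N' where "N' = {f \<in> carrier (F (n + n) (s + 1)). hcls s f \<in> N}"
  have N'_add: "(\<lambda>z. f z + g z) \<in> N'" if "f \<in> N'" "g \<in> N'" for f g
    using that N_add[of "hcls s f" "hcls s g"] F_closed(2)[of f "n + n" "s + 1" g] hcls(2)[of f s g]
    unfolding N'_def by simp
  have N'_scale: "(\<lambda>z. a * f z) \<in> N'" if "f \<in> N'" for f a
    using that N_smult[of "hcls s f" a] F_closed(3)[of f "n + n" "s + 1" a] hcls(3)[of f s a]
    unfolding N'_def by simp
  have N'_R: "f \<in> N'" if "f \<in> R (n + n) (s + 1)" for f
    using N_zero AU.T.W_carrier[OF that] hcls_relation[OF that] unfolding N'_def by simp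
  have word: "single (b, U.cl f) \<in> N'" if "f \<in> carrier (free_space ?L)" for f
    using that
  proof (induction f rule: free_space_induct)
    case zero
    have 0: "(\<lambda>_. 0) \<in> carrier (free_space ?L :: ('k, nat list \<Rightarrow> 'k) module)"
      by (simp add: free_space_carrier)
    \<comment> \<open>Writing the zero class as 0 times itself makes this case an instance of the
      scalar relation.\<close>
    have "U.cl (\<lambda>_. 0) = 0 \<odot>\<^bsub>UU (s + 1)\<^esub> U.cl (\<lambda>_. 0)"
      using U.cl_smult[of "\<lambda>_. 0" 0] function_spaceD(4)[OF function_space_free_algebra[of m]]
      by (simp add: U_part_simps U_alg_eq)
    then have "single (b, U.cl (\<lambda>_. 0)) = (\<lambda>z. single (b, 0 \<odot>\<^bsub>UU (s + 1)\<^esub> U.cl (\<lambda>_. 0)) z - 0 * single (b, U.cl (\<lambda>_. 0)) z)"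
      by simp
    also have "\<dots> \<in> N'" by (intro N'_R AU.R_smult_right b(1) U_cl 0)
    finally show ?case .
  next
    case (single w)
    have "hcls s (single (b, U.cl (single w))) \<in> N" using S single by blast
    then show ?case using sc[OF b(1) U_cl[OF single_in_free_space[OF single]]] by (simp add: N'_def)
  next
    case (add f g)
    have fg: "f \<in> carrier T" "g \<in> carrier T" using add(1,2) by (auto simp: free_space_carrier)
    have "U.cl (\<lambda>w. f w + g w) = U.cl f \<oplus>\<^bsub>UU (s + 1)\<^esub> U.cl g"
      using U.cl_add[OF fg] by (simp add: U_part_simps U_alg_eq)
    then have "single (b, U.cl (\<lambda>w. f w + g w)) =
        (\<lambda>z. (single (b, U.cl f \<oplus>\<^bsub>UU (s + 1)\<^esub> U.cl g) z - single (b, U.cl f) z - single (b, U.cl g) z) +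
          (single (b, U.cl f) z + single (b, U.cl g) z))" by simp
    also have "\<dots> \<in> N'" by (intro N'_add N'_R AU.R_add_right b(1) U_cl add)
    finally show ?case .
  next
    case (scale a f)
    have f: "f \<in> carrier T" using scale(1) by (auto simp: free_space_carrier)
    have "U.cl (\<lambda>w. a * f w) = a \<odot>\<^bsub>UU (s + 1)\<^esub> U.cl f"
      using U.cl_smult[OF f] by (simp add: U_part_simps U_alg_eq)
    then have "single (b, U.cl (\<lambda>w. a * f w)) =
        (\<lambda>z. (single (b, a \<odot>\<^bsub>UU (s + 1)\<^esub> U.cl f) z - a * single (b, U.cl f) z) + a * single (b, U.cl f) z)" by simp
    also have "\<dots> \<in> N'" by (intro N'_add N'_scale N'_R AU.R_smult_right b(1) U_cl scale)
    finally show ?case .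
  qed
  have "f \<in> N'" if "f \<in> carrier (F (n + n) (s + 1))" for f
    using that
  proof (induction f rule: free_space_induct)
    case zero
    show ?case by (intro N'_R AU.R_function_space(1))
  next
    case (single y)
    obtain v u where y: "y = (v, u)" "v \<in> carrier (H (n + n))" "u \<in> carrier (UU (s + 1))" using single by auto
    obtain f where f: "f \<in> carrier T" "homogeneous (s + 1) f" "u = U.cl f" using y(3) by (rule U_part_carrierE)
    have "f \<in> carrier (free_space ?L)" using f(1,2) by (auto simp: free_space_carrier homogeneous_def)
    then have bu: "single (b, u) \<in> N'" using word f(3) by simp
    have "single y = (\<lambda>z. (single (\<theta> v \<odot>\<^bsub>H (n + n)\<^esub> b, u) z - \<theta> v * single (b, u) z) + \<theta> v * single (b, u) z)"
      using b(2)[OF y(2)] y(1) by simp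
    also have "\<dots> \<in> N'" by (intro N'_add N'_scale N'_R AU.R_smult_left b(1) y(3) bu)
    finally show ?case .
  qed (simp_all add: N'_add N'_scale)
  then show "carrier (Hom s) \<subseteq> N"
    unfolding AU_homology_eq B.quotient_carrier
    by (auto elim!: AU_carrierE simp: N'_def hcls_def)
qed

text \<open>The functional is \<theta> \<otimes> \<tau>. Exchanging the factors of a product
  multiplies \<theta> of the cup product by (-1)^n and leaves the cyclic \<tau> unchanged. For even
  s the commutator with \<kappa> carries the same sign, so its two terms have equal values and
  cancel.\<close>

lemma AU_homology_functional:
  assumes \<theta>: "linear_functional (H (n + n)) \<theta>"
    and \<tau>: "linear_functional T \<tau>" "\<And>f. f \<in> I \<Longrightarrow> \<tau> f = 0"
      "\<And>f g. f \<in> carrier T \<Longrightarrow> g \<in> carrier T \<Longrightarrow> \<tau> (conv f g) = \<tau> (conv g f)"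
    and s: "even s"
  shows "\<exists>G. linear_functional (Hom s) G \<and>
    (\<forall>v \<in> carrier (H (n + n)). \<forall>f \<in> carrier T. homogeneous (s + 1) f \<longrightarrow>
      G (hcls s (single (v, U.cl f))) = \<theta> v * \<tau> f)"
proof -
  define \<beta> where "\<beta> y = \<theta> (fst y) * coset_functional \<tau> (snd y)" for y :: "('a, 'k) cochain set \<times> (nat list \<Rightarrow> 'k) set"
  have cf: "coset_functional \<tau> (U.cl f) = \<tau> f" if "f \<in> carrier T" for f
    by (rule U.coset_functional_cl[OF \<tau>(1) _ that]) (rule \<tau>(2))
  have U_lin: "linear_functional (U_alg n m c) (coset_functional \<tau>)"
    unfolding U_alg_eq by (rule U.linear_functional_coset[OF \<tau>(1,2)])
  have sub: "u \<in> carrier (U_alg n m c)" if "u \<in> carrier (UU t)" for u t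
    using U_part_subset[OF that] U.cl_closed unfolding U_alg_eq by blast
  have \<beta>_R: "lin_val \<beta> f = 0" if "f \<in> R (n + n) (s + 1)" for f
    by (rule AU.lin_val_R_eq_0[OF that])
      (simp_all add: \<beta>_def linear_functionalD[OF \<theta>] linear_functionalD[OF U_lin] sub U_part_simps(2,4) algebra_simps)
  define G where "G = coset_functional (lin_val \<beta>)"
  have G_cls: "G (cls (n + n) (s + 1) f) = lin_val \<beta> f" if "f \<in> carrier (F (n + n) (s + 1))" for f
    unfolding G_def by (rule AU.T.coset_functional_cl[OF linear_functional_lin_val \<beta>_R that])
  have G_lin: "linear_functional (AU2 s) G"
    unfolding G_def AU_eq by (rule AU.T.linear_functional_coset[OF linear_functional_lin_val \<beta>_R])
  have sym: "\<beta> (cup X n n a b, u \<star> v) = kappa_sgn s * \<beta> (cup X n n b a, v \<star> u)"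
    if ab: "a \<in> carrier (H n)" "b \<in> carrier (H n)" and uv: "u \<in> carrier (UU t)" "v \<in> carrier (UU t')" for a b u v t t'
  proof -
    obtain f g where fg: "f \<in> carrier T" "u = U.cl f" "g \<in> carrier T" "v = U.cl g"
      using U_part_subset[OF uv(1)] U_part_subset[OF uv(2)] by blast
    have "conv f g \<in> carrier T" "conv g f \<in> carrier T"
      using fg(1,3) conv_carrier[of f "{..<m}" g] conv_carrier[of g "{..<m}" f] by simp_all
    then have "coset_functional \<tau> (u \<star> v) = coset_functional \<tau> (v \<star> u)"
      unfolding fg(2,4) U_mult[OF fg(1,3)] U_mult[OF fg(3,1)] using \<tau>(3)[OF fg(1,3)] by (simp only: cf)
    moreover have "\<theta> (cup X n n a b) = (-1) ^ n * \<theta> (cup X n n b a)"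
      unfolding cup_commute[OF ab n_pos] using linear_functionalD(2)[OF \<theta> cup_closed[OF ab(2,1)]] .
    ultimately show ?thesis unfolding \<beta>_def koszul_sign_kappa[OF s] by simp
  qed
  have G_B: "G P = 0" if "P \<in> Bd s" for P
  proof -
    obtain g where g: "g \<in> carrier (F n s)" "P = cls (n + n) (s + 1) (diff_rep (kappa_sgn s) g)"
      using \<open>P \<in> _\<close> unfolding AU_boundaries_eq by blast
    have c: "mult_rep kappa_rep g \<in> carrier (F (n + n) (s + 1))" "mult_rep g kappa_rep \<in> carrier (F (n + n) (s + 1))"
      using mult_rep_carrier[OF kappa_rep_carrier g(1)] mult_rep_carrier[OF g(1) kappa_rep_carrier]
      by (simp_all add: add.commute)
    have "lin_val \<beta> (mult_rep kappa_rep g) =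
        lin_val (\<lambda>y. lin_val (\<lambda>y'. \<beta> (cup X n n (fst y) (fst y'), snd y \<star> snd y')) g) kappa_rep"
      by (rule lin_val_mult_rep[OF kappa_rep_carrier g(1)])
    also have "\<dots> = lin_val (\<lambda>y'. lin_val (\<lambda>y. \<beta> (cup X n n (fst y) (fst y'), snd y \<star> snd y')) kappa_rep) g"
      by (intro lin_val_swap free_space_finite[OF kappa_rep_carrier] free_space_finite[OF g(1)])
    also have "\<dots> = lin_val (\<lambda>y'. lin_val (\<lambda>y. kappa_sgn s * \<beta> (cup X n n (fst y') (fst y), snd y' \<star> snd y)) kappa_rep) g"
    proof (intro lin_val_cong)
      fix y y' assume "g y' \<noteq> 0" "kappa_rep y \<noteq> 0"
      then have "y' \<in> carrier (H n) \<times> carrier (UU s)" "y \<in> carrier (H n) \<times> carrier (UU 1)"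
        using g(1) kappa_rep_carrier unfolding free_space_carrier by blast+
      then show "\<beta> (cup X n n (fst y) (fst y'), snd y \<star> snd y') = kappa_sgn s * \<beta> (cup X n n (fst y') (fst y), snd y' \<star> snd y)"
        by (intro sym) auto
    qed
    also have "\<dots> = kappa_sgn s * lin_val \<beta> (mult_rep g kappa_rep)"
      unfolding lin_val_mult_rep[OF g(1) kappa_rep_carrier] lin_val_scale_right ..
    finally have "lin_val \<beta> (diff_rep (kappa_sgn s) g) = 0"
      unfolding diff_rep_def
      using lin_val_diff[OF free_space_finite[OF c(1)] free_space_finite[OF F_closed(3)[OF c(2), of "kappa_sgn s"]], of \<beta>]
      by (simp add: lin_val_scale)
    then show ?thesis using g G_cls[OF diff_rep_carrier] by simp
  qed
  have "linear_functional (Hom s) (coset_functional G)"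
    unfolding AU_homology_eq by (rule B.linear_functional_coset[OF G_lin G_B])
  moreover have "coset_functional G (hcls s (single (v, U.cl f))) = \<theta> v * \<tau> f"
    if "v \<in> carrier (H (n + n))" "f \<in> carrier T" "homogeneous (s + 1) f" for v f
  proof -
    have sc: "single (v, U.cl f) \<in> carrier (F (n + n) (s + 1))"
      using that by (intro single_in_free_space) (simp add: U_partI)
    have "coset_functional G (hcls s (single (v, U.cl f))) = G (cls (n + n) (s + 1) (single (v, U.cl f)))"
      unfolding hcls_def by (rule B.coset_functional_cl[OF G_lin G_B cls_closed[OF sc]])
    also have "\<dots> = \<theta> v * \<tau> f"
      unfolding G_cls[OF sc] by (simp add: \<beta>_def cf[OF that(2)])
    finally show ?thesis .
  qed
  ultimately show ?thesis by blast
qed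

end

section \<open>The exponential lower bound\<close>

theorem corollary5p8:
  fixes M :: "'a topology" and n m :: nat
    and x :: "nat \<Rightarrow> ('a, 'k::field_char_0) cochain set"
    and Mv :: "('a, 'k) cochain set"
    and c :: "nat \<Rightarrow> nat \<Rightarrow> 'k"
  assumes "n \<ge> 2"
    and "closed_manifold (2 * n) M"
    and "k_connected (n - 1) M"
    and "m = vdim (cohomology M n :: ('k, ('a, 'k) cochain set) module)"
    and "m \<ge> 3"
    and "inj_on x {..<m}" and "is_basis (cohomology M n) (x ` {..<m})"
    and "is_basis (cohomology M (2 * n)) {Mv}"
    and "\<And>i j. i < m \<Longrightarrow> j < m \<Longrightarrow>
           cup M n n (x i) (x j) = c i j \<odot>\<^bsub>cohomology M (2 * n)\<^esub> Mv"
  shows "\<exists>C > 0. \<exists>a > 1. \<forall>k \<ge> 1.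
           C * a ^ k \<le> real (vdim (AU_homology M n m c x 2 (2 * k + 1)))"
proof -
  have n: "2 * n = n + n" by simp
  have basis: "is_basis (cohomology M (n + n)) {Mv}" using assms(8) unfolding n .
  have x: "x i \<in> carrier (cohomology M n)" if "i < m" for i
  proof -
    interpret V: vectorspace class_ring "cohomology M n :: ('k, ('a, 'k) cochain set) module"
      by (rule cohomology_space)
    show ?thesis using assms(7) that by (auto simp: V.basis_def)
  qed
  interpret loop_complex n m c M x
    using assms(1) x by unfold_locales auto
  obtain \<theta> where \<theta>: "linear_functional (H (n + n)) \<theta>" "\<theta> Mv = 1" "Mv \<in> carrier (H (n + n))"
    "\<And>v. v \<in> carrier (H (n + n)) \<Longrightarrow> v = \<theta> v \<odot>\<^bsub>H (n + n)\<^esub> Mv"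
    using basis_singleton_functional[OF cohomology_space basis] by blast
  have cup_x: "\<theta> (cup M n n (x i) (x j)) = c i j" if "i < m" "j < m" for i j
    using assms(9)[OF that] \<theta>(2) linear_functionalD(2)[OF \<theta>(1,3), of "c i j"] unfolding n by simp
  have c: "c i j = (-1) ^ n * c j i" if "i < m" "j < m" for i j
  proof -
    have "c i j = \<theta> ((-1) ^ n \<odot>\<^bsub>H (n + n)\<^esub> cup M n n (x j) (x i))"
      unfolding cup_x[OF that, symmetric] cup_commute[OF x[OF that(1)] x[OF that(2)] n_pos] ..
    also have "\<dots> = (-1) ^ n * \<theta> (cup M n n (x j) (x i))"
      by (rule linear_functionalD(2)[OF \<theta>(1) cup_closed[OF x[OF that(2)] x[OF that(1)]]])
    finally show ?thesis unfolding cup_x[OF that(2,1)] .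
  qed
  \<comment> \<open>The coefficient of u_i u_j in \<open>omega\<close>, with the transposed indices
    of its definition.\<close>
  define \<omega> where "\<omega> i j = (-1) ^ n * c j i" for i j
  have \<omega>: "\<omega> i j = (-1) ^ n * \<omega> j i" if "i < m" "j < m" for i j
    unfolding \<omega>_def by (subst c[OF that(2,1)]) simp
  obtain v z q \<xi> where split: "splitting m \<omega> v z q \<xi>"
    using splitting_exists[of m \<omega> n] assms(5) \<omega> by blast
  have "2 ^ k \<le> vdim (AU_homology M n m c x 2 (2 * k + 1))" for k
  proof -
    \<comment> \<open>The boundaries come from the even word length 2k and land in word length 2k +
      1, the length of the necklaces.\<close>
    let ?s = "2 * k" and ?r = "2 * k + 1"
    have "0 < ?r" by simp
    from necklaces[OF this] obtain \<Gamma> :: "bool list set" where \<Gamma>': "finite \<Gamma>" "\<forall>g \<in> \<Gamma>. length g = ?r"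
      "\<forall>g \<in> \<Gamma>. \<forall>h \<in> \<Gamma>. \<forall>j. rotate j g = h \<longrightarrow> g = h" "2 ^ ?r \<le> ?r * card \<Gamma>"
      by (elim exE conjE)
    note \<Gamma> = \<Gamma>'(1) bspec[OF \<Gamma>'(2)] bspec[OF bspec[OF \<Gamma>'(3)], THEN spec, THEN mp] \<Gamma>'(4)
    let ?\<tau> = "\<lambda>g. word_trace (idx (length g)) (gen_mat g v z q)"
    let ?e = "\<lambda>h. hcls ?s (single (Mv, U.cl (word_product m \<xi> h)))"
    have "\<exists>G. linear_functional (Hom ?s) G \<and>
      (\<forall>h \<in> \<Gamma>. G (?e h) = of_nat (2 * card {j. j < length g \<and> rotate j g = h}))" if g: "g \<in> \<Gamma>" for g
    proof -
      have rel: "(\<Sum>i<m. \<Sum>j<m. ((-1) ^ n * c j i) *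
          mat_mul (idx (length g)) (gen_mat g v z q i) (gen_mat g v z q j) s t) = 0"
        if "s \<in> idx (length g)" "t \<in> idx (length g)" for s t
        using gen_mat_relation[of m \<omega> v z q s g t] split that by (simp add: splitting_def \<omega>_def)
      have tr: "?\<tau> g f = 0" if "f \<in> I" for f
        by (rule word_trace_ideal[OF _ rel that]) simp_all
      have comm: "?\<tau> g (conv f f') = ?\<tau> g (conv f' f)" if "f \<in> carrier T" "f' \<in> carrier T" for f f'
        using that by (intro word_trace_commute) (simp_all add: free_space_finite)
      have "\<exists>G. linear_functional (Hom ?s) G \<and>
        (\<forall>w \<in> carrier (H (n + n)). \<forall>f \<in> carrier T. homogeneous (?s + 1) f \<longrightarrow>
          G (hcls ?s (single (w, U.cl f))) = \<theta> w * ?\<tau> g f)"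
        by (rule AU_homology_functional[OF \<theta>(1) linear_functional_word_trace]) (simp_all add: tr comm)
      then obtain G where G: "linear_functional (Hom ?s) G"
        "\<forall>w \<in> carrier (H (n + n)). \<forall>f \<in> carrier T. homogeneous (?s + 1) f \<longrightarrow>
          G (hcls ?s (single (w, U.cl f))) = \<theta> w * ?\<tau> g f"
        by blast
      have "G (?e h) = of_nat (2 * card {j. j < length g \<and> rotate j g = h})" if "h \<in> \<Gamma>" for h
      proof -
        have "homogeneous (?s + 1) (word_product m \<xi> h)"
          using homogeneous_word_product[of h m \<xi>] \<Gamma>(2)[OF that] by simp
        then have "G (?e h) = \<theta> Mv * ?\<tau> g (word_product m \<xi> h)"
          using G(2) \<theta>(3) word_product_carrier[of m \<xi> h] by blast
        also have "\<dots> = of_nat (2 * card {j. j < length g \<and> rotate j g = h})"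
          using word_trace_gen_mat[OF split, of h g] \<Gamma>(2)[OF that] \<Gamma>(2)[OF g] \<theta>(2) by simp
        finally show ?thesis .
      qed
      with G(1) show ?thesis by blast
    qed
    then have "\<exists>G. \<forall>g \<in> \<Gamma>. linear_functional (Hom ?s) (G g) \<and>
      (\<forall>h \<in> \<Gamma>. G g (?e h) = of_nat (2 * card {j. j < length g \<and> rotate j g = h}))"
      by (intro bchoice ballI)
    then obtain G where G: "\<And>g. g \<in> \<Gamma> \<Longrightarrow> linear_functional (Hom ?s) (G g)"
      "\<And>g h. g \<in> \<Gamma> \<Longrightarrow> h \<in> \<Gamma> \<Longrightarrow> G g (?e h) = of_nat (2 * card {j. j < length g \<and> rotate j g = h})"
      by blast
    have "card \<Gamma> \<le> vdim (Hom ?s)"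
    proof (rule card_le_vdim[OF AU_homology_space AU_homology_fin_dim[OF \<theta>(3,4)] \<Gamma>(1), where e = ?e and F = G])
      fix g assume g: "g \<in> \<Gamma>"
      have "single (Mv, U.cl (word_product m \<xi> g)) \<in> carrier (F (n + n) (?s + 1))"
        using \<theta>(3) homogeneous_word_product[of g m \<xi>] \<Gamma>(2)[OF g] word_product_carrier[of m \<xi> g]
        by (intro single_in_free_space SigmaI U_partI) simp_all
      then show "?e g \<in> carrier (Hom ?s)" by (rule hcls(1))
      show "linear_functional (Hom ?s) (G g)" by (rule G(1)[OF g])
      have "0 \<in> {j. j < length g \<and> rotate j g = g}" using \<Gamma>(2)[OF g] by simp
      then have "0 < card {j. j < length g \<and> rotate j g = g}" by (subst card_gt_0_iff) auto
      then have "2 * card {j. j < length g \<and> rotate j g = g} \<noteq> 0" by linarith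
      \<comment> \<open>In characteristic zero a positive integer stays nonzero in the
        field.\<close>
      then show "G g (?e g) \<noteq> 0" by (simp only: G(2)[OF g g] of_nat_eq_0_iff not_False_eq_True)
      fix h assume h: "h \<in> \<Gamma>" "g \<noteq> h"
      then have "{j. j < length g \<and> rotate j g = h} = {}" using \<Gamma>(3)[OF g h(1)] by blast
      then show "G g (?e h) = 0" unfolding G(2)[OF g h(1)] by simp
    qed
    moreover have "2 ^ k \<le> card \<Gamma>"
    proof -
      \<comment> \<open>It suffices that r \<le> 2^(k+1), because 2^r = 2^(k+1) 2^k.\<close>
      have "k < 2 ^ k" by (rule less_exp)
      then have "2 * k + 1 \<le> 2 * 2 ^ k" by linarith
      then have "2 * k + 1 \<le> 2 ^ (k + 1)" by (simp only: Suc_eq_plus1[symmetric] power_Suc)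
      then have "?r * card \<Gamma> \<le> 2 ^ (k + 1) * card \<Gamma>" by (rule mult_le_mono1)
      then have "2 ^ ?r \<le> 2 ^ (k + 1) * card \<Gamma>" using \<Gamma>(4) by linarith
      moreover have "(2::nat) ^ ?r = 2 ^ (k + 1) * 2 ^ k" by (simp flip: power_add)
      ultimately show ?thesis by simp
    qed
    ultimately show ?thesis by simp
  qed
  then have "real (2 ^ k) \<le> real (vdim (AU_homology M n m c x 2 (2 * k + 1)))" for k
    by (intro of_nat_mono)
  then show ?thesis
    by (intro exI[of _ 1] conjI exI[of _ 2] allI impI) simp_all
qed

end
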